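(* Let $p\ge 1$ be an integer and let $\boldsymbol{\beta}=(\beta_0,\ldots,\beta_{p-1})$ be a $p$-tuple of real numbers greater than $1$. The measure $\mu_{\boldsymbol{\beta}}$ is the unique $T_{\boldsymbol{\beta}}$-invariant probability measure on $\mathcal{T}_p$ that is absolutely continuous with respect to $\lambda_p$. Furthermore, $\mu_{\boldsymbol{\beta}}$ is equivalent to $\lambda_p$ on $\mathcal{T}_p$ and the dynamical system $(\{0,\ldots,p-1\}\times[0,1),\mathcal{T}_p,\mu_{\boldsymbol{\beta}},T_{\boldsymbol{\beta}})$ is ergodic and has entropy $\frac{1}{p}\log(\beta_{p-1}\cdots\beta_0)$.
   Context: Convention: for $n\in\mathbb{Z}$, $\beta_n=\beta_{n\bmod p}$. For a real $\beta>1$, $T_\beta\colon[0,1)\to[0,1)$, $x\mapsto \beta x-\lfloor\beta x\rfloor$. The greedy $\boldsymbol{\beta}$-transformation is $T_{\boldsymbol{\beta}}\colon\{0,\ldots,p-1\}\times[0,1)\to\{0,\ldots,p-1\}\times[0,1)$, $(i,x)\mapsto((i+1)\bmod p,\,T_{\beta_i}(x))$. $\mathcal{B}(A)$ denotes the Borel $\sigma$-algebra of $A\subset\mathbb{R}$ and $\lambda$ the Lebesgue measure. $\mathcal{T}_p$ is the $\sigma$-algebra on $\{0,\ldots,p-1\}\times[0,1)$ of all sets $\bigcup_{i=0}^{p-1}(\{i\}\times B_i)$ with $B_i\in\mathcal{B}([0,1))$ for all $i$. The $p$-Lebesgue measure $\lambda_p$ on $\mathcal{T}_p$ is $\lambda_p\big(\bigcup_{i=0}^{p-1}(\{i\}\times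 B_i)\big)=\frac1p\sum_{i=0}^{p-1}\lambda(B_i)$. For each $i\in\{0,\ldots,p-1\}$, $\mu_{\boldsymbol{\beta},i}$ denotes the unique probability measure on $\mathcal{B}([0,1))$ that is absolutely continuous with respect to $\lambda$ and invariant under $T_{\beta_{i-1}}\circ\cdots\circ T_{\beta_{i-p}}$ (existence and uniqueness hold). The measure $\mu_{\boldsymbol{\beta}}$ on $\mathcal{T}_p$ is $\mu_{\boldsymbol{\beta}}\big(\bigcup_{i=0}^{p-1}(\{i\}\times B_i)\big)=\frac1p\sum_{i=0}^{p-1}\mu_{\boldsymbol{\beta},i}(B_i)$. A measure $\mu$ is $T$-invariant if $\mu(T^{-1}(B))=\mu(B)$ for all measurable $B$. Two measures are equivalent if each is absolutely continuous with respect to the other. Ergodic: $T^{-1}(B)=B$ implies $\mu(B)\in\{0,1\}$. Entropy is the measure-theoretic (Kolmogorov–Sinai) entropy. *)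

theory Defs
  imports "HOL-Probability.Probability"
begin

section \<open>Invariant measures, ergodicity and entropy\<close>

definition invariant_measure :: "'a measure \<Rightarrow> ('a \<Rightarrow> 'a) \<Rightarrow> bool" where
  "invariant_measure M T \<longleftrightarrow>
     T \<in> measurable M M \<and> (\<forall>B\<in>sets M. emeasure M (T -` B \<inter> space M) = emeasure M B)"

text \<open>Note the argument order of the library constant:
  \<open>absolutely_continuous L M\<close> says that \<open>M\<close> is absolutely continuous with respect to \<open>L\<close>.\<close>

definition is_acip :: "'a measure \<Rightarrow> ('a \<Rightarrow> 'a) \<Rightarrow> 'a measure \<Rightarrow> bool" where
  "is_acip L T M \<longleftrightarrow>
     sets M = sets L \<and> prob_space M \<and> absolutely_continuous L M \<and> invariant_measure M T"

definition equivalent_measures :: "'a measure \<Rightarrow> 'a measure \<Rightarrow> bool" where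
  "equivalent_measures M N \<longleftrightarrow>
     sets M = sets N \<and> absolutely_continuous M N \<and> absolutely_continuous N M"

definition ergodic :: "'a measure \<Rightarrow> ('a \<Rightarrow> 'a) \<Rightarrow> bool" where
  "ergodic M T \<longleftrightarrow>
     (\<forall>B\<in>sets M. T -` B \<inter> space M = B \<longrightarrow> measure M B \<in> {0, 1})"

definition measurable_partition :: "'a measure \<Rightarrow> 'a set set \<Rightarrow> bool" where
  "measurable_partition M P \<longleftrightarrow> finite P \<and> P \<subseteq> sets M \<and> partition_on (space M) P"

text \<open>Since \<open>ln 0 = 0\<close>, null atoms contribute \<open>0\<close>, the usual convention. For the same reason
  the empty set may be left among the atoms of a join.\<close>

definition partition_entropy :: "'a measure \<Rightarrow> 'a set set \<Rightarrow> real" where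
  "partition_entropy M P = - (\<Sum>A\<in>P. measure M A * ln (measure M A))"

definition partition_join :: "'a set set \<Rightarrow> 'a set set \<Rightarrow> 'a set set" where
  "partition_join P Q = {A \<inter> B | A B. A \<in> P \<and> B \<in> Q}"

text \<open>\<open>iterated_join M T P n\<close> is the join of the pullbacks of \<open>P\<close> under \<open>T ^^ k\<close> for \<open>k < n\<close>.\<close>

primrec iterated_join ::
    "'a measure \<Rightarrow> ('a \<Rightarrow> 'a) \<Rightarrow> 'a set set \<Rightarrow> nat \<Rightarrow> 'a set set" where
  "iterated_join M T P 0 = {space M}"
| "iterated_join M T P (Suc n) =
     partition_join (iterated_join M T P n) ((\<lambda>A. (T ^^ n) -` A \<inter> space M) ` P)"

definition entropy_wrt_partition :: "'a measure \<Rightarrow> ('a \<Rightarrow> 'a) \<Rightarrow> 'a set set \<Rightarrow> real" where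
  "entropy_wrt_partition M T P =
     lim (\<lambda>n. partition_entropy M (iterated_join M T P n) / real n)"

definition ks_entropy :: "'a measure \<Rightarrow> ('a \<Rightarrow> 'a) \<Rightarrow> ereal" where
  "ks_entropy M T = (SUP P\<in>{P. measurable_partition M P}. ereal (entropy_wrt_partition M T P))"

section \<open>Measures on \<open>{0,\<dots>,p-1} \<times> [0,1)\<close>\<close>

abbreviation lebesgue01 :: "real measure" where
  "lebesgue01 \<equiv> restrict_space lborel {0..<1}"

definition fibre_algebra :: "nat \<Rightarrow> (nat \<times> real) set set" where
  "fibre_algebra p =
     {(\<Union>i<p. {i} \<times> B i) | B. \<forall>i<p. B i \<in> sets (restrict_space borel {0..<1})}"

text \<open>The fibre of \<open>A\<close> over \<open>i\<close> is \<open>Pair i -` A\<close>.\<close>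

definition average_measure :: "nat \<Rightarrow> (nat \<Rightarrow> real measure) \<Rightarrow> (nat \<times> real) measure" where
  "average_measure p N = measure_of ({..<p} \<times> {0..<1}) (fibre_algebra p)
     (\<lambda>A. (\<Sum>i<p. emeasure (N i) (Pair i -` A)) / of_nat p)"

definition p_lebesgue :: "nat \<Rightarrow> (nat \<times> real) measure" where
  "p_lebesgue p = average_measure p (\<lambda>i. lebesgue01)"

lemma fibre_algebra_iff:
  "A \<in> fibre_algebra p \<longleftrightarrow>
     A \<subseteq> {..<p} \<times> {0..<1} \<and> (\<forall>i<p. Pair i -` A \<in> sets (restrict_space borel {0..<1}))"
proof
  assume "A \<in> fibre_algebra p"
  then obtain B where A: "A = (\<Union>i<p. {i} \<times> B i)"
    and B: "\<And>i. i < p \<Longrightarrow> B i \<in> sets (restrict_space borel {0..<1::real})"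
    unfolding fibre_algebra_def by blast
  have "B i \<subseteq> {0..<1}" if "i < p" for i
    using sets.sets_into_space[OF B[OF that]] by (simp add: space_restrict_space)
  moreover have "Pair i -` A = B i" if "i < p" for i
    using that by (auto simp: A)
  ultimately show "A \<subseteq> {..<p} \<times> {0..<1} \<and>
      (\<forall>i<p. Pair i -` A \<in> sets (restrict_space borel {0..<1}))"
    using B by (auto simp: A)
next
  assume "A \<subseteq> {..<p} \<times> {0..<1} \<and>
      (\<forall>i<p. Pair i -` A \<in> sets (restrict_space borel {0..<1}))"
  moreover from this have "A = (\<Union>i<p. {i} \<times> (Pair i -` A))"
    by auto
  ultimately show "A \<in> fibre_algebra p"
    unfolding fibre_algebra_def by (intro CollectI exI[of _ "\<lambda>i. Pair i -` A"]) auto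
qed

lemma sigma_algebra_fibre_algebra: "sigma_algebra ({..<p} \<times> {0..<1}) (fibre_algebra p)"
proof (intro sigma_algebra_iff2[THEN iffD2] conjI ballI allI impI)
  show "fibre_algebra p \<subseteq> Pow ({..<p} \<times> {0..<1})"
    by (intro subsetI) (simp add: fibre_algebra_iff)
  show "{} \<in> fibre_algebra p"
    by (simp add: fibre_algebra_iff)
next
  fix A assume A: "A \<in> fibre_algebra p"
  have "Pair i -` ({..<p} \<times> {0..<1} - A) \<in> sets (restrict_space borel {0..<1})"
    if i: "i < p" for i
  proof -
    have "Pair i -` A \<in> sets (restrict_space borel {0..<1})"
      using A i by (simp add: fibre_algebra_iff)
    then have "space (restrict_space borel {0..<1}) - Pair i -` A
        \<in> sets (restrict_space borel {0..<1})"
      by (rule sets.compl_sets)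
    also have "space (restrict_space borel {0..<1}) - Pair i -` A
        = Pair i -` ({..<p} \<times> {0..<1} - A)"
      using i by (auto simp: space_restrict_space)
    finally show ?thesis .
  qed
  then show "{..<p} \<times> {0..<1} - A \<in> fibre_algebra p"
    unfolding fibre_algebra_iff by blast
next
  fix A :: "nat \<Rightarrow> (nat \<times> real) set"
  assume A: "range A \<subseteq> fibre_algebra p"
  have "A j \<in> fibre_algebra p" for j
    using A by blast
  then show "(\<Union>j. A j) \<in> fibre_algebra p"
    unfolding fibre_algebra_iff vimage_UN by (intro conjI allI impI sets.countable_UN) blast+
qed

lemma space_average_measure: "space (average_measure p N) = {..<p} \<times> {0..<1}"
  unfolding average_measure_def
  using sigma_algebra_fibre_algebra[of p] by (simp add: sigma_algebra.space_measure_of_eq)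

lemma sets_average_measure: "sets (average_measure p N) = fibre_algebra p"
  unfolding average_measure_def
  using sigma_algebra_fibre_algebra[of p] by (simp add: sigma_algebra.sets_measure_of_eq)

lemma emeasure_average_measure:
  assumes N: "\<And>i. i < p \<Longrightarrow> sets (N i) = sets (restrict_space borel {0..<1})"
    and A: "A \<in> fibre_algebra p"
  shows "emeasure (average_measure p N) A =
           (\<Sum>i<p. emeasure (N i) (Pair i -` A)) / of_nat p"
  unfolding average_measure_def
proof (rule emeasure_measure_of_sigma[OF sigma_algebra_fibre_algebra _ _ A])
  let ?m = "\<lambda>A. (\<Sum>i<p. emeasure (N i) (Pair i -` A)) / of_nat p"
  show "positive (fibre_algebra p) ?m"
    by (simp add: positive_def)
  show "countably_additive (fibre_algebra p) ?m"
  proof (rule countably_additiveI)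
    fix F :: "nat \<Rightarrow> (nat \<times> real) set"
    assume F: "range F \<subseteq> fibre_algebra p" "disjoint_family F"
    have "(\<Sum>j. emeasure (N i) (Pair i -` F j)) = emeasure (N i) (Pair i -` (\<Union>j. F j))"
      if "i < p" for i
      unfolding vimage_UN
    proof (rule suminf_emeasure)
      have "F j \<in> fibre_algebra p" for j
        using F(1) by blast
      then show "range (\<lambda>j. Pair i -` F j) \<subseteq> sets (N i)"
        using that by (auto simp: fibre_algebra_iff N)
      show "disjoint_family (\<lambda>j. Pair i -` F j)"
        using F(2) by (auto simp: disjoint_family_on_def)
    qed
    then show "(\<Sum>j. ?m (F j)) = ?m (\<Union>j. F j)"
      by (simp add: divide_ennreal_def ennreal_suminf_multc suminf_sum)
  qed
qed

lemma emeasure_average_measure_UN: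
  assumes "\<And>i. i < p \<Longrightarrow> sets (N i) = sets (restrict_space borel {0..<1})"
    and B: "\<And>i. i < p \<Longrightarrow> B i \<in> sets (restrict_space borel {0..<1})"
  shows "emeasure (average_measure p N) (\<Union>i<p. {i} \<times> B i) =
           (\<Sum>i<p. emeasure (N i) (B i)) / of_nat p"
proof -
  have "(\<Union>i<p. {i} \<times> B i) \<in> fibre_algebra p"
    unfolding fibre_algebra_def using B by blast
  moreover have "Pair i -` (\<Union>i<p. {i} \<times> B i) = B i" if "i < p" for i
    using that by auto
  ultimately show ?thesis
    by (subst emeasure_average_measure[OF assms(1)]) (auto intro!: arg_cong2[where f = "(/)"] sum.cong)
qed

section \<open>The greedy transformation of an alternate base\<close>

definition T_single :: "real \<Rightarrow> real \<Rightarrow> real" where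
  "T_single b x = b * x - of_int \<lfloor>b * x\<rfloor>"

text \<open>A base \<open>(\<beta> 0, \<dots>, \<beta> (p - 1))\<close> is a function of which only the values below \<open>p\<close> matter.\<close>

definition periodic_base :: "nat \<Rightarrow> (nat \<Rightarrow> real) \<Rightarrow> int \<Rightarrow> real" where
  "periodic_base p \<beta> n = \<beta> (nat (n mod int p))"

definition T_alt :: "nat \<Rightarrow> (nat \<Rightarrow> real) \<Rightarrow> nat \<times> real \<Rightarrow> nat \<times> real" where
  "T_alt p \<beta> = (\<lambda>(i, x). ((i + 1) mod p, T_single (\<beta> i) x))"

text \<open>The composition of the maps with bases \<open>\<beta>\<^sub>i\<^sub>-\<^sub>1, \<dots>, \<beta>\<^sub>i\<^sub>-\<^sub>p\<close> in this order, so the last one is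
  applied first.\<close>

definition T_cycle :: "nat \<Rightarrow> (nat \<Rightarrow> real) \<Rightarrow> nat \<Rightarrow> real \<Rightarrow> real" where
  "T_cycle p \<beta> i =
     foldr (\<circ>) (map (\<lambda>k. T_single (periodic_base p \<beta> (int i - int k))) [1..<Suc p]) id"

definition mu_fibre :: "nat \<Rightarrow> (nat \<Rightarrow> real) \<Rightarrow> nat \<Rightarrow> real measure" where
  "mu_fibre p \<beta> i = (THE M. is_acip lebesgue01 (T_cycle p \<beta> i) M)"

definition mu_alt :: "nat \<Rightarrow> (nat \<Rightarrow> real) \<Rightarrow> (nat \<times> real) measure" where
  "mu_alt p \<beta> = average_measure p (mu_fibre p \<beta>)"

end

theory Submission
  imports Defs "HOL-Real_Asymp.Real_Asymp"
begin

text \<open>The transfer operator of a beta-transformation maps decreasing densities on \<open>[0,1)\<close> to decreasing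
  densities. For decreasing densities with a common bound, long compositions of such operators
  satisfy a Doeblin condition and hence contract the differences of densities at a geometric rate.
  The iterates therefore converge to an invariant density that is bounded away from \<open>0\<close> and
  \<open>\<infinity>\<close>. Since indicators of intervals \<open>[0,c)\<close> span a dense subspace of \<open>L\<^sup>1\<close>, the maps \<open>T_cycle\<close>
  are mixing, which gives uniqueness and ergodicity on each fibre.

  For the entropy, an itinerary of length \<open>n\<close> determines a point up to the inverse of the product of
  the \<open>n\<close> slopes, so that the cylinders have small measure. Conversely, the number of cylinders is at
  most a polynomial factor times this product. An arbitrary partition is compared with
  these cylinders by Gibbs' inequality.\<close>

text \<open>The obstacle is that the maps need not be Markov: the last branch of
  \<open>T_single b\<close> is incomplete unless \<open>b\<close> is an integer, so lower bounds for
  densities cannot come from full branches. Decreasing densities avoid this. The branch at 0 is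
  always available, since \<open>x / b\<close> lies in \<open>[0,1)\<close>, and a decreasing
  density of mass 1 with a known upper bound cannot be small near 0. The sup bound alone takes the
  place of a bounded variation norm; the transfer operators keep it because
  \<open>C / b + 1 \<le> C\<close> once \<open>C \<ge> b / (b - 1)\<close>. For \<open>p > 1\<close>
  the map \<open>T_alt\<close> is not mixing, because it permutes the fibres cyclically. Mixing is
  therefore proved for the return maps \<open>T_cycle\<close>, and the fibres are linked by pushing
  measures forward one step. The entropy is a supremum over all finite partitions. A coding argument
  does the work of a generator theorem: a partition agrees up to measure \<open>d\<close> with a
  function of digit blocks, and the price of the errors per time step tends to 0 with
  \<open>d\<close>.\<close>

section \<open>The transfer operator\<close>

text \<open>The Perron-Frobenius operator of \<open>T_single b\<close> for Lebesgue measure. The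
  preimages of \<open>x\<close> are the points \<open>(x + k) / b\<close> below 1, which is the test
  \<open>x + k < b\<close>; thus the incomplete last branch needs no separate treatment.\<close>

definition transfer :: "real \<Rightarrow> (real \<Rightarrow> real) \<Rightarrow> real \<Rightarrow> real" where
  "transfer b h x = (\<Sum>k\<le>nat \<lfloor>b\<rfloor>. if x + real k < b then h ((x + real k) / b) else 0) / b"

lemma T_single_bounds: "T_single b x \<in> {0..<1}"
  unfolding T_single_def by (simp add: frac_def[symmetric] frac_lt_1)

lemma measurable_T_single_borel [measurable]: "T_single b \<in> borel_measurable borel"
  unfolding T_single_def by measurable

lemma measurable_T_single [measurable]: "T_single b \<in> measurable lebesgue01 lebesgue01"
  by (rule measurable_restrict_space3) (auto simp: T_single_bounds simp del: atLeastLessThan_iff)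

lemma space_lebesgue01: "space lebesgue01 = {0..<1}"
  by (simp add: space_restrict_space)

lemma prob_space_lebesgue01: "prob_space lebesgue01"
  by (rule prob_spaceI) (simp add: emeasure_restrict_space space_restrict_space)

lemma measurable_transfer [measurable]:
  assumes [measurable]: "h \<in> borel_measurable borel"
  shows "transfer b h \<in> borel_measurable borel"
  unfolding transfer_def[abs_def] by measurable

lemma transfer_nonneg:
  assumes "b > 0" "\<And>x. x \<in> {0..<1} \<Longrightarrow> h x \<ge> 0" "x \<ge> 0"
  shows "transfer b h x \<ge> 0"
  unfolding transfer_def using assms by (intro divide_nonneg_nonneg sum_nonneg) (auto simp: field_simps)

text \<open>Duality between composition and transfer: split \<open>[0,1)\<close> by the digit and
  substitute \<open>x = (y + k) / b\<close> on each piece. Values in \<open>ennreal\<close> spare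
  all integrability conditions on \<open>f\<close>.\<close>

lemma nn_integral_T_single:
  assumes b: "b > 0" and [measurable]: "f \<in> borel_measurable borel" "h \<in> borel_measurable borel"
    and h: "\<And>x. x \<in> {0..<1} \<Longrightarrow> h x \<ge> 0"
  shows "(\<integral>\<^sup>+x. f (T_single b x) * ennreal (h x) \<partial>lebesgue01) =
         (\<integral>\<^sup>+x. f x * ennreal (transfer b h x) \<partial>lebesgue01)"
proof -
  \<comment> \<open>The share of digit \<open>k\<close> in the integrand; for a given
    \<open>x\<close> at most one of these is nonzero.\<close>
  define F where "F k x = f (b * x - real k) * ennreal (h x) * indicator {real k..<real k + 1} (b * x) * indicator {0..<1} x" for k x
  have [measurable]: "F k \<in> borel_measurable borel" for k
    unfolding F_def by measurable
  have ind: "(\<Sum>k\<le>nat \<lfloor>b\<rfloor>. F k x) = f (T_single b x) * ennreal (h x) * indicator {0..<1} x" for x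
  proof (cases "x \<in> {0..<1}")
    case True
    define j where "j = nat \<lfloor>b * x\<rfloor>"
    have "b * x \<ge> 0" "b * x \<le> b" using True b by auto
    then have j: "real j = of_int \<lfloor>b * x\<rfloor>" "j \<le> nat \<lfloor>b\<rfloor>"
      unfolding j_def by (auto intro!: nat_mono floor_mono)
    have "F k x = (if k = j then f (T_single b x) * ennreal (h x) else 0)" for k
    proof (cases "k = j")
      case True then show ?thesis using \<open>x \<in> {0..<1}\<close> j(1)
        by (auto simp: F_def T_single_def indicator_def)
    next
      case False
      have "\<not> (real k \<le> b * x \<and> b * x < real k + 1)"
      proof
        assume "real k \<le> b * x \<and> b * x < real k + 1"
        then have "\<lfloor>b * x\<rfloor> = int k" by linarith
        then show False using False by (simp add: j_def)
      qed
      then show ?thesis using False by (simp add: F_def indicator_def)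
    qed
    then show ?thesis using True j(2) by simp
  qed (simp add: F_def)
  have one: "(\<integral>\<^sup>+x. F k x \<partial>lborel) = (\<integral>\<^sup>+y. f y * ennreal ((if y + real k < b then h ((y + real k)/b) else 0) / b) * indicator {0..<1} y \<partial>lborel)" for k
  proof -
    have "(\<integral>\<^sup>+x. F k x \<partial>lborel) = ennreal \<bar>1/b\<bar> * (\<integral>\<^sup>+y. F k (k/b + 1/b * y) \<partial>lborel)"
      using b by (intro nn_integral_real_affine) auto
    also have "\<dots> = (\<integral>\<^sup>+y. ennreal (1/b) * F k (k/b + 1/b * y) \<partial>lborel)"
      using b by (subst nn_integral_cmult) auto
    also have "\<dots> = (\<integral>\<^sup>+y. f y * ennreal ((if y + real k < b then h ((y + real k)/b) else 0) / b) * indicator {0..<1} y \<partial>lborel)"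
    proof (rule nn_integral_cong)
      fix y
      have e: "b * (k/b + 1/b*y) = y + real k" "k/b + 1/b*y = (y + real k)/b" using b by (auto simp: field_simps)
      have e2: "(y + real k)/b < 1 \<longleftrightarrow> y + real k < b" using b by (simp add: field_simps)
      show "ennreal (1/b) * F k (k/b + 1/b * y) = f y * ennreal ((if y + real k < b then h ((y + real k)/b) else 0) / b) * indicator {0..<1} y"
      proof (cases "0 \<le> y \<and> y < 1 \<and> y + real k < b")
        case True
        then have "ennreal (1/b) * ennreal (h ((y + real k)/b)) = ennreal (h ((y + real k)/b) / b)"
          using b by (subst ennreal_mult'[symmetric]) (auto simp: field_simps)
        moreover have "F k (k/b + 1/b * y) = f y * ennreal (h ((y + real k)/b))"
          using True b e2 unfolding F_def e by (auto simp: indicator_def)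
        ultimately show ?thesis
          using True by (simp add: mult.left_commute)
      next
        case False
        then have "F k (k/b + 1/b * y) = 0"
          using b e2 unfolding F_def e by (auto simp: indicator_def)
        then show ?thesis
          using False by (auto simp: indicator_def)
      qed
    qed
    finally show ?thesis .
  qed
  have "(\<integral>\<^sup>+x. f (T_single b x) * ennreal (h x) \<partial>lebesgue01) = (\<integral>\<^sup>+x. (\<Sum>k\<le>nat \<lfloor>b\<rfloor>. F k x) \<partial>lborel)"
    unfolding ind by (subst nn_integral_restrict_space) auto
  also have "\<dots> = (\<Sum>k\<le>nat \<lfloor>b\<rfloor>. \<integral>\<^sup>+x. F k x \<partial>lborel)"
    by (subst nn_integral_sum) auto
  also have "\<dots> = (\<integral>\<^sup>+y. (\<Sum>k\<le>nat \<lfloor>b\<rfloor>. f y * ennreal ((if y + real k < b then h ((y + real k)/b) else 0) / b) * indicator {0..<1} y) \<partial>lborel)"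
    unfolding one by (subst nn_integral_sum) auto
  also have "\<dots> = (\<integral>\<^sup>+y. f y * ennreal (transfer b h y) * indicator {0..<1} y \<partial>lborel)"
  proof (rule nn_integral_cong)
    fix y
    have "y \<in> {0..<1} \<Longrightarrow> (\<Sum>k\<le>nat \<lfloor>b\<rfloor>. ennreal ((if y + real k < b then h ((y + real k)/b) else 0) / b)) = ennreal (transfer b h y)"
      unfolding transfer_def sum_divide_distrib using b h by (subst sum_ennreal) (auto simp: field_simps)
    then show "(\<Sum>k\<le>nat \<lfloor>b\<rfloor>. f y * ennreal ((if y + real k < b then h ((y + real k)/b) else 0) / b) * indicator {0..<1} y)
       = f y * ennreal (transfer b h y) * indicator {0..<1} y"
      by (cases "y \<in> {0..<1}") (simp_all add: sum_distrib_left[symmetric] sum_distrib_right[symmetric])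
  qed
  also have "\<dots> = (\<integral>\<^sup>+x. f x * ennreal (transfer b h x) \<partial>lebesgue01)"
    by (subst nn_integral_restrict_space) auto
  finally show ?thesis .
qed

section \<open>Compositions of beta-transformations and of their transfer operators\<close>

definition T_seq :: "real list \<Rightarrow> real \<Rightarrow> real" where
  "T_seq bs = foldr (\<circ>) (map T_single bs) id"

text \<open>Same order as in \<open>T_seq\<close>, with the head of the list applied last, since
  densities are pushed forward in the order in which the maps act.\<close>

definition transfer_seq :: "real list \<Rightarrow> (real \<Rightarrow> real) \<Rightarrow> real \<Rightarrow> real" where
  "transfer_seq bs = foldr (\<circ>) (map transfer bs) id"

lemma T_seq_simps [simp]: "T_seq [] = id" "T_seq (b # bs) = T_single b \<circ> T_seq bs"
  by (simp_all add: T_seq_def)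

lemma transfer_seq_simps [simp]:
  "transfer_seq [] = id" "transfer_seq (b # bs) = transfer b \<circ> transfer_seq bs"
  by (simp_all add: transfer_seq_def)

lemma T_seq_append: "T_seq (as @ bs) = T_seq as \<circ> T_seq bs"
  by (induction as) (auto simp: comp_assoc)

lemma transfer_seq_append: "transfer_seq (as @ bs) = transfer_seq as \<circ> transfer_seq bs"
  by (induction as) (auto simp: comp_assoc)

text \<open>Powers of a composition are again compositions over a list, so that everything shown for
  lists holds for iterates.\<close>

lemma T_seq_concat_replicate: "T_seq (concat (replicate n bs)) = T_seq bs ^^ n"
  by (induction n) (auto simp: T_seq_append)

lemma transfer_seq_concat_replicate:
  "transfer_seq (concat (replicate n bs)) = transfer_seq bs ^^ n"
  by (induction n) (auto simp: transfer_seq_append)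

lemma measurable_T_seq_borel [measurable]: "T_seq bs \<in> borel_measurable borel"
  by (induction bs) (auto intro: measurable_comp)

lemma measurable_T_seq [measurable]: "T_seq bs \<in> measurable lebesgue01 lebesgue01"
  by (induction bs) (auto intro: measurable_comp)

lemma measurable_transfer_seq [measurable]:
  "h \<in> borel_measurable borel \<Longrightarrow> transfer_seq bs h \<in> borel_measurable borel"
  by (induction bs) auto

lemma transfer_seq_nonneg:
  assumes "\<And>b. b \<in> set bs \<Longrightarrow> b > 0" "\<And>x. x \<in> {0..<1} \<Longrightarrow> h x \<ge> 0" "x \<in> {0..<1}"
  shows "transfer_seq bs h x \<ge> 0"
  using assms(1,3)
proof (induction bs arbitrary: x)
  case (Cons b bs)
  have "transfer b (transfer_seq bs h) x \<ge> 0"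
    by (rule transfer_nonneg) (use Cons in auto)
  then show ?case by simp
qed (use assms(2) in auto)

text \<open>The outermost map is absorbed into the test function, which is why the induction varies
  \<open>f\<close> and keeps \<open>h\<close>.\<close>

lemma nn_integral_T_seq:
  assumes b: "\<And>b. b \<in> set bs \<Longrightarrow> b > 0"
    and [measurable]: "f \<in> borel_measurable borel" "h \<in> borel_measurable borel"
    and h: "\<And>x. x \<in> {0..<1} \<Longrightarrow> h x \<ge> 0"
  shows "(\<integral>\<^sup>+x. f (T_seq bs x) * ennreal (h x) \<partial>lebesgue01) =
         (\<integral>\<^sup>+x. f x * ennreal (transfer_seq bs h x) \<partial>lebesgue01)"
  using b assms(2)
proof (induction bs arbitrary: f)
  case (Cons b bs)
  note [measurable] = Cons.prems(2)
  have "(\<integral>\<^sup>+x. f (T_seq (b # bs) x) * ennreal (h x) \<partial>lebesgue01) =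
        (\<integral>\<^sup>+x. (\<lambda>x. f (T_single b x)) (T_seq bs x) * ennreal (h x) \<partial>lebesgue01)"
    by simp
  also have "\<dots> = (\<integral>\<^sup>+x. f (T_single b x) * ennreal (transfer_seq bs h x) \<partial>lebesgue01)"
    using Cons.prems by (intro Cons.IH) auto
  also have "\<dots> = (\<integral>\<^sup>+x. f x * ennreal (transfer b (transfer_seq bs h) x) \<partial>lebesgue01)"
    using Cons.prems(1) by (intro nn_integral_T_single transfer_seq_nonneg h) auto
  finally show ?case by simp
qed simp

lemma transfer_linear:
  "transfer b (\<lambda>x. c * f x + d * g x) x = c * transfer b f x + d * transfer b g x"
proof -
  have "(if P then c * u + d * v else 0) = c * (if P then u else 0) + d * (if P then v else 0)" for P and u v :: real
    by simp
  then show ?thesis unfolding transfer_def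
    by (simp only: sum.distrib sum_distrib_left[symmetric] add_divide_distrib times_divide_eq_right)
qed

lemma transfer_seq_linear:
  "transfer_seq bs (\<lambda>x. c * f x + d * g x) = (\<lambda>x. c * transfer_seq bs f x + d * transfer_seq bs g x)"
proof (induction bs)
  case (Cons b bs)
  have "transfer b (\<lambda>x. c * transfer_seq bs f x + d * transfer_seq bs g x) =
      (\<lambda>x. c * transfer b (transfer_seq bs f) x + d * transfer b (transfer_seq bs g) x)"
    by (rule ext) (rule transfer_linear)
  then show ?case using Cons by simp
qed simp

lemma tendsto_transfer:
  assumes "b > 0" "\<And>x. x \<in> {0..<1} \<Longrightarrow> (\<lambda>n. u n x) \<longlonglongrightarrow> h x" "x \<in> {0..<1}"
  shows "(\<lambda>n. transfer b (u n) x) \<longlonglongrightarrow> transfer b h x"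
  unfolding transfer_def using assms
  by (intro tendsto_divide tendsto_sum tendsto_const) (auto simp: field_simps)

lemma tendsto_transfer_seq:
  assumes "\<And>b. b \<in> set bs \<Longrightarrow> b > 0"
    and "\<And>x. x \<in> {0..<1} \<Longrightarrow> (\<lambda>n. u n x) \<longlonglongrightarrow> h x" "x \<in> {0..<1}"
  shows "(\<lambda>n. transfer_seq bs (u n) x) \<longlonglongrightarrow> transfer_seq bs h x"
  using assms(1,3)
proof (induction bs arbitrary: x)
  case (Cons b bs)
  have "(\<lambda>n. transfer b (transfer_seq bs (u n)) x) \<longlonglongrightarrow> transfer b (transfer_seq bs h) x"
    using Cons by (intro tendsto_transfer) auto
  then show ?case by simp
qed (use assms(2) in auto)

section \<open>Decreasing densities\<close>

text \<open>For nonnegative decreasing functions the sup bound \<open>C\<close> also bounds the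
  variation. It is a parameter because the contraction must be uniform over all densities with the
  same \<open>C\<close>. Only values on \<open>[0,1)\<close> are constrained, apart from
  measurability.\<close>

definition decreasing_density :: "real \<Rightarrow> (real \<Rightarrow> real) \<Rightarrow> bool" where
  "decreasing_density C h \<longleftrightarrow> h \<in> borel_measurable borel \<and> (\<forall>x\<in>{0..<1}. 0 \<le> h x \<and> h x \<le> C) \<and>
     (\<forall>x y. 0 \<le> x \<longrightarrow> x \<le> y \<longrightarrow> y < 1 \<longrightarrow> h y \<le> h x) \<and> (LINT x|lebesgue01. h x) = 1"

lemma decreasing_densityD:
  assumes "decreasing_density C h"
  shows "h \<in> borel_measurable borel" "\<And>x. x \<in> {0..<1} \<Longrightarrow> 0 \<le> h x" "\<And>x. x \<in> {0..<1} \<Longrightarrow> h x \<le> C"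
    "\<And>x y. 0 \<le> x \<Longrightarrow> x \<le> y \<Longrightarrow> y < 1 \<Longrightarrow> h y \<le> h x" "(LINT x|lebesgue01. h x) = 1"
  using assms unfolding decreasing_density_def by auto

lemma decreasing_density_mono:
  "decreasing_density C h \<Longrightarrow> C \<le> D \<Longrightarrow> decreasing_density D h"
  unfolding decreasing_density_def by (meson order_trans)

lemma measure_lebesgue01_space: "measure lebesgue01 {0..<1} = 1"
  using prob_space.prob_space[OF prob_space_lebesgue01] by (simp add: space_lebesgue01)

lemma borel_measurable_lebesgue01:
  "f \<in> borel_measurable borel \<Longrightarrow> f \<in> borel_measurable lebesgue01"
  by (intro measurable_restrict_space1) simp

lemma integrable_lebesgue01:
  fixes f :: "real \<Rightarrow> real"
  assumes [measurable]: "f \<in> borel_measurable borel" and "\<And>x. x \<in> {0..<1} \<Longrightarrow> \<bar>f x\<bar> \<le> C"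
  shows "integrable lebesgue01 f"
proof -
  interpret prob_space lebesgue01 by (rule prob_space_lebesgue01)
  show ?thesis using assms
    by (intro integrable_const_bound[of _ C] AE_I2 borel_measurable_lebesgue01) (auto simp: space_lebesgue01)
qed

lemma integral_T_seq:
  fixes h :: "real \<Rightarrow> real"
  assumes b: "\<And>b. b \<in> set bs \<Longrightarrow> b > 0"
    and [measurable]: "A \<in> sets borel" "h \<in> borel_measurable borel"
    and h: "\<And>x. x \<in> {0..<1} \<Longrightarrow> h x \<ge> 0"
  shows "(LINT x|lebesgue01. indicator A (T_seq bs x) * h x) =
         (LINT x|lebesgue01. indicator A x * transfer_seq bs h x)"
proof -
  have "(LINT x|lebesgue01. indicator A (T_seq bs x) * h x) =
      enn2real (\<integral>\<^sup>+x. indicator A (T_seq bs x) * ennreal (h x) \<partial>lebesgue01)"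
    using h by (subst integral_eq_nn_integral)
      (auto intro!: AE_I2 borel_measurable_lebesgue01 arg_cong[of _ _ enn2real] nn_integral_cong
        simp: space_lebesgue01 indicator_def)
  also have "\<dots> = enn2real (\<integral>\<^sup>+x. indicator A x * ennreal (transfer_seq bs h x) \<partial>lebesgue01)"
    by (subst nn_integral_T_seq[OF b _ _ h]) auto
  also have "\<dots> = (LINT x|lebesgue01. indicator A x * transfer_seq bs h x)"
    using transfer_seq_nonneg[OF b h]
    by (subst integral_eq_nn_integral)
      (auto intro!: AE_I2 borel_measurable_lebesgue01 arg_cong[of _ _ enn2real] nn_integral_cong
        simp: space_lebesgue01 indicator_def)
  finally show ?thesis .
qed

text \<open>The supremum is attained at 0. There the branch \<open>k + 1\<close> contributes at most
  what branch \<open>k\<close> contributes at any \<open>y\<close>, so only the branch at 0 is in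
  excess, by at most \<open>C / b\<close>. Averaging over \<open>y\<close> replaces the remaining
  term by the integral 1.\<close>

lemma decreasing_density_transfer:
  assumes b: "b > 0" and h: "decreasing_density C h"
  shows "decreasing_density (C / b + 1) (transfer b h)"
proof -
  note [measurable] = decreasing_densityD(1)[OF h]
  note h = decreasing_densityD[OF h]
  have nn: "transfer b h x \<ge> 0" if "0 \<le> x" for x
    using that b h(2) by (intro transfer_nonneg) auto
  \<comment> \<open>Moving to the right loses branches and evaluates \<open>h\<close> further right
    in those that remain.\<close>
  have dec: "transfer b h y \<le> transfer b h x" if "0 \<le> x" "x \<le> y" for x y
    unfolding transfer_def
  proof (intro divide_right_mono sum_mono)
    fix k
    show "(if y + real k < b then h ((y + real k) / b) else 0) \<le> (if x + real k < b then h ((x + real k) / b) else 0)"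
      using that b by (auto intro!: h(2) h(4) divide_right_mono simp: field_simps)
  qed (use b in simp)
  have int: "(LINT x|lebesgue01. transfer b h x) = 1"
    using integral_T_seq[of "[b]" UNIV h] b h by simp
  \<comment> \<open>The index shift works because \<open>(k + 1) / b\<close> lies to the right of
    \<open>(y + k) / b\<close>.\<close>
  have step: "transfer b h 0 \<le> C / b + transfer b h y" if y: "y \<in> {0..<1}" for y
  proof -
    let ?m = "nat \<lfloor>b\<rfloor>"
    have "(\<Sum>k\<le>?m. if 0 + real k < b then h ((0 + real k) / b) else 0)
        = h 0 + (\<Sum>k<?m. if real (Suc k) < b then h (real (Suc k) / b) else 0)"
      using b by (subst sum.atMost_shift) (simp add: add.commute[of 1] cong: if_cong)
    also have "\<dots> \<le> C + (\<Sum>k<?m. if y + real k < b then h ((y + real k) / b) else 0)"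
    proof (intro add_mono sum_mono)
      fix k
      show "(if real (Suc k) < b then h (real (Suc k) / b) else 0) \<le> (if y + real k < b then h ((y + real k) / b) else 0)"
        using y b by (auto intro!: h(2) h(4) divide_right_mono simp: field_simps)
    qed (use h(3)[of 0] in auto)
    also have "\<dots> \<le> C + (\<Sum>k\<le>?m. if y + real k < b then h ((y + real k) / b) else 0)"
      using y b by (intro add_left_mono sum_mono2) (auto intro!: h(2) simp: field_simps)
    finally show ?thesis
      unfolding transfer_def using b by (simp add: add_divide_distrib[symmetric] divide_right_mono)
  qed
  interpret prob_space lebesgue01 by (rule prob_space_lebesgue01)
  have i: "integrable lebesgue01 (transfer b h)"
    using dec[of 0] nn by (intro integrable_lebesgue01[where C = "transfer b h 0"]) auto
  have "(LINT y|lebesgue01. transfer b h 0) \<le> (LINT y|lebesgue01. C / b + transfer b h y)"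
    using step i by (intro integral_mono) (auto simp: space_lebesgue01)
  then have "transfer b h 0 \<le> C / b + 1"
    using i int by (simp add: measure_lebesgue01_space)
  then have "transfer b h x \<le> C / b + 1" if "0 \<le> x" for x
    using dec[of 0 x] that by simp
  then show ?thesis
    using nn dec int unfolding decreasing_density_def by auto
qed

text \<open>Iterating \<open>C \<mapsto> C / b + 1\<close> forgets \<open>C\<close> geometrically
  and accumulates the series \<open>1 + 1/b + 1/b^2 + ...\<close>, whose sum is
  \<open>b / (b - 1)\<close>.\<close>

lemma decreasing_density_transfer_seq:
  assumes b: "b > 1" "\<And>\<beta>. \<beta> \<in> set bs \<Longrightarrow> b \<le> \<beta>" and h: "decreasing_density C h" and C: "C \<ge> 0"
  shows "decreasing_density (C / b ^ length bs + b / (b - 1)) (transfer_seq bs h)"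
  using b(2)
proof (induction bs)
  case Nil
  show ?case using b by (auto intro!: decreasing_density_mono[OF h])
next
  case (Cons \<beta> bs)
  let ?D = "C / b ^ length bs + b / (b - 1)"
  have "decreasing_density (?D / \<beta> + 1) (transfer \<beta> (transfer_seq bs h))"
    using b Cons by (intro decreasing_density_transfer) (auto, force)
  moreover have "?D / \<beta> + 1 \<le> ?D / b + 1"
    using b Cons.prems[of \<beta>] C by (auto intro!: divide_left_mono add_nonneg_nonneg)
  moreover have "?D / b + 1 = C / b ^ length (\<beta> # bs) + b / (b - 1)"
    using b by (simp add: field_simps)
  ultimately show ?case
    using decreasing_density_mono by simp
qed

text \<open>Above the fixed point \<open>b / (b - 1)\<close> the map
  \<open>C \<mapsto> C / b + 1\<close> does not increase the bound, so the class is
  preserved.\<close>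

lemma decreasing_density_transfer_seq_same:
  assumes b: "b > 1" "\<And>\<beta>. \<beta> \<in> set bs \<Longrightarrow> b \<le> \<beta>" and h: "decreasing_density C h" and C: "C \<ge> b / (b - 1)"
  shows "decreasing_density C (transfer_seq bs h)"
  using b(2)
proof (induction bs)
  case (Cons \<beta> bs)
  have "C \<ge> 0" using b C by (meson divide_nonneg_nonneg diff_ge_0_iff_ge order_trans less_imp_le zero_le_one)
  have "decreasing_density (C / \<beta> + 1) (transfer \<beta> (transfer_seq bs h))"
    using b Cons by (intro decreasing_density_transfer) (auto, force)
  moreover have "C / \<beta> + 1 \<le> C / b + 1"
    using b Cons.prems[of \<beta>] \<open>C \<ge> 0\<close> by (auto intro!: divide_left_mono)
  moreover have "C / b + 1 \<le> C"
    using b C by (simp add: field_simps)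
  ultimately show ?case
    using decreasing_density_mono by simp
qed (use h in simp)

text \<open>All branches but the one at 0 are dropped in every factor; this one never leaves the
  domain because \<open>x < 1 \<le> b\<close>.\<close>

lemma transfer_seq_ge:
  assumes "\<And>\<beta>. \<beta> \<in> set bs \<Longrightarrow> 1 \<le> \<beta>" "\<And>x. x \<in> {0..<1} \<Longrightarrow> h x \<ge> 0" "x \<in> {0..<1}"
  shows "h (x / prod_list bs) / prod_list bs \<le> transfer_seq bs h x"
  using assms(1,3)
proof (induction bs arbitrary: x)
  case (Cons b bs)
  have b: "b \<ge> 1" using Cons.prems by auto
  then have b0: "0 \<le> b" by simp
  have xb: "x / b \<in> {0..<1}" using b Cons.prems(2) by (auto simp: field_simps)
  have nn: "transfer_seq bs h z \<ge> 0" if "z \<in> {0..<1}" for z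
    using Cons.prems(1) assms(2) that by (intro transfer_seq_nonneg) force+
  have "h (x / prod_list (b # bs)) / prod_list (b # bs) = h ((x / b) / prod_list bs) / prod_list bs / b"
    by (simp add: mult.commute)
  also have "\<dots> \<le> transfer_seq bs h (x / b) / b"
    using Cons.IH[OF _ xb] Cons.prems(1) by (intro divide_right_mono b0) auto
  also have "\<dots> = (\<Sum>k\<in>{0}. if x + real k < b then transfer_seq bs h ((x + real k) / b) else 0) / b"
    using Cons.prems(2) b by auto
  also have "\<dots> \<le> transfer b (transfer_seq bs h) x"
    unfolding transfer_def using Cons.prems b
    by (intro divide_right_mono sum_mono2 b0) (auto intro!: nn simp: field_simps)
  finally show ?case by simp
qed simp

text \<open>Of the total mass 1, at most \<open>C * d\<close> lies over \<open>[0,d)\<close>, and to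
  the right of \<open>d\<close> the density is at most \<open>h d\<close>.\<close>

lemma decreasing_density_ge:
  assumes h: "decreasing_density C h" and d: "d \<in> {0..<1}"
  shows "h d \<ge> 1 - C * d"
proof -
  note [measurable] = decreasing_densityD(1)[OF h]
  note h = decreasing_densityD[OF h]
  interpret prob_space lebesgue01 by (rule prob_space_lebesgue01)
  have C: "C \<ge> 0" using h(2,3)[of 0] by auto
  have m: "measure lebesgue01 {0..<d} = d"
    using d by (subst measure_restrict_space) auto
  have s: "{0..<d} \<in> sets lebesgue01" using d by (subst sets_restrict_space_iff) auto
  have "1 = (LINT x|lebesgue01. h x)" using h by simp
  also have "\<dots> \<le> (LINT x|lebesgue01. indicator {0..<d} x * C + h d)"
  proof (rule integral_mono)
    show "integrable lebesgue01 h" using h(2,3) by (intro integrable_lebesgue01[where C = C]) (auto simp: abs_of_nonneg)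
    show "integrable lebesgue01 (\<lambda>x. indicator {0..<d} x * C + h d)"
      using C h(2)[OF d] by (intro integrable_lebesgue01[where C = "C + h d"]) (auto simp: indicator_def)
    fix x assume "x \<in> space lebesgue01"
    then show "h x \<le> indicator {0..<d} x * C + h d"
      using h(3)[of x] h(4)[of d x] h(2)[OF d] d by (auto simp: indicator_def space_lebesgue01)
  qed
  also have "\<dots> = d * C + h d"
  proof -
    have "has_bochner_integral lebesgue01 (indicator {0..<d}) (measure lebesgue01 {0..<d})"
      using s by (intro has_bochner_integral_real_indicator) (auto simp: less_top[symmetric])
    then have "has_bochner_integral lebesgue01 (\<lambda>x. indicator {0..<d} x * C + h d) (d * C + h d)"
      unfolding m using has_bochner_integral_integrable[OF integrable_const[of "h d"]]
      by (intro has_bochner_integral_add has_bochner_integral_mult_left) (auto simp: measure_lebesgue01_space)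
    then show ?thesis by (rule has_bochner_integral_integral_eq)
  qed
  finally show ?thesis by (simp add: mult.commute)
qed

lemma prod_list_ge_power:
  assumes "b \<ge> (0::real)" "\<And>\<beta>. \<beta> \<in> set bs \<Longrightarrow> b \<le> \<beta>"
  shows "b ^ length bs \<le> prod_list bs"
  using assms(2)
proof (induction bs)
  case (Cons \<beta> bs)
  then have "b * b ^ length bs \<le> \<beta> * prod_list bs"
    using assms(1) order_trans[OF assms(1) Cons.prems[of \<beta>]] by (intro mult_mono) auto
  then show ?case by simp
qed simp

text \<open>The Doeblin condition: long compositions of transfer operators split off a fixed multiple of
  the constant density, and the rest stays in the same class of densities.\<close>

lemma decreasing_density_rest:
  assumes b: "b > 1" "\<And>\<beta>. \<beta> \<in> set cs \<Longrightarrow> b \<le> \<beta>" and f: "decreasing_density C f"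
    and C: "C \<ge> 4 * (b / (b - 1))" and N: "b ^ length cs \<ge> 2 * C"
  defines "e \<equiv> 1 / (2 * prod_list cs)"
  shows "decreasing_density C (\<lambda>x. (transfer_seq cs f x - e) / (1 - e))" "0 < e" "e < 1"
proof -
  let ?P = "prod_list cs"
  have C1: "b / (b - 1) \<ge> 1" using b by (simp add: field_simps)
  then have C4: "C \<ge> 4" using C by linarith
  have P: "?P \<ge> 2 * C" using prod_list_ge_power[of b cs] b N by auto
  have e: "e > 0" "e \<le> 1 / 2" unfolding e_def using P C C1 by (auto simp: field_simps)
  then show "0 < e" "e < 1" by auto
  let ?g = "transfer_seq cs f"
  have g: "decreasing_density (C / b ^ length cs + b / (b - 1)) ?g"
    using b f C4 by (intro decreasing_density_transfer_seq) auto
  note [measurable] = decreasing_densityD(1)[OF g]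
  note gD = decreasing_densityD[OF g]
  \<comment> \<open>The first summand is at most \<open>1 / 2\<close> by the length of
    \<open>cs\<close>, the second at most \<open>C / 4\<close>. Stopping at \<open>C / 2\<close>
    leaves a factor 2 for the division by \<open>1 - e\<close>.\<close>
  have up: "C / b ^ length cs + b / (b - 1) \<le> C / 2"
  proof -
    have "C / b ^ length cs \<le> C / (2 * C)"
      using N C C1 by (intro divide_left_mono) auto
    also have "\<dots> = 1 / 2" using C C1 by simp
    finally show ?thesis using C C1 by simp
  qed
  \<comment> \<open>At \<open>1 / ?P\<close> the density \<open>f\<close> is at least
    \<open>1 - C / ?P \<ge> 1 / 2\<close>, hence also at every \<open>x / ?P\<close> to its left;
    the branch at 0 turns this into \<open>1 / (2 * ?P) = e\<close>.\<close>
  have lo: "e \<le> ?g x" if "x \<in> {0..<1}" for x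
  proof -
    have d: "1 / ?P \<in> {0..<1}" "x / ?P \<le> 1 / ?P" "0 \<le> x / ?P"
      using P C C1 that by (auto simp: field_simps)
    have "e \<le> (1 - C * (1 / ?P)) / ?P" unfolding e_def using P C C1 by (simp add: field_simps)
    also have "\<dots> \<le> f (1 / ?P) / ?P"
      using decreasing_density_ge[OF f d(1)] P C C1 by (intro divide_right_mono) auto
    also have "\<dots> \<le> f (x / ?P) / ?P"
      using decreasing_densityD(4)[OF f d(3,2)] d(1) P C C1 by (intro divide_right_mono) auto
    also have "\<dots> \<le> ?g x"
      using b that decreasing_densityD(2)[OF f] by (intro transfer_seq_ge) (auto, force)
    finally show ?thesis .
  qed
  interpret prob_space lebesgue01 by (rule prob_space_lebesgue01)
  have int: "integrable lebesgue01 ?g"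
    using gD(2,3) by (intro integrable_lebesgue01[where C = "C / b ^ length cs + b / (b - 1)"]) (auto simp: abs_of_nonneg)
  show "decreasing_density C (\<lambda>x. (?g x - e) / (1 - e))"
    unfolding decreasing_density_def
  proof (intro conjI ballI allI impI)
    fix x :: real assume x: "x \<in> {0..<1}"
    show "0 \<le> (?g x - e) / (1 - e)" using lo[OF x] e by simp
    \<comment> \<open>Here the reserve is spent: \<open>e \<le> 1 / 2\<close> gives
      \<open>C / 2 \<le> C * (1 - e)\<close>.\<close>
    have "?g x \<le> C / 2" using gD(3)[OF x] up by (rule order_trans)
    moreover have "C * e \<le> C * (1/2)" using C C1 e by (intro mult_left_mono) auto
    ultimately have "?g x \<le> C * (1 - e) + e" using e(1) by (simp add: algebra_simps)
    then show "(?g x - e) / (1 - e) \<le> C" using e by (simp add: field_simps)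
  next
    fix x y :: real assume "0 \<le> x" "x \<le> y" "y < 1"
    then show "(?g y - e) / (1 - e) \<le> (?g x - e) / (1 - e)"
      using gD(4) e by (intro divide_right_mono) auto
  next
    show "(LINT x|lebesgue01. (?g x - e) / (1 - e)) = 1"
      using int gD(5) e by (simp add: measure_lebesgue01_space)
  qed auto
qed

text \<open>The constant part split off has the same weight \<open>e\<close> for \<open>f\<close>
  and \<open>g\<close> and cancels in the difference; what is left is \<open>1 - e\<close> times a
  difference of two densities of the same class.\<close>

lemma transfer_seq_contraction:
  assumes b: "b > 1" "\<And>\<beta>. \<beta> \<in> set cs \<Longrightarrow> b \<le> \<beta>"
    and fg: "decreasing_density C f" "decreasing_density C g"
    and C: "C \<ge> 4 * (b / (b - 1))" and N: "b ^ length cs \<ge> 2 * C" and x: "x \<in> {0..<1}"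
  shows "\<bar>(transfer_seq cs ^^ k) f x - (transfer_seq cs ^^ k) g x\<bar> \<le> (1 - 1 / (2 * prod_list cs)) ^ k * C"
  using fg x
proof (induction k arbitrary: f g x)
  case 0
  then show ?case using decreasing_densityD(2,3)[OF 0(1), of x] decreasing_densityD(2,3)[OF 0(2), of x] by auto
next
  case (Suc k)
  let ?L = "transfer_seq cs"
  define e where "e = 1 / (2 * prod_list cs)"
  define R where "R f x = (?L f x - e) / (1 - e)" for f x
  have R: "decreasing_density C (R f)" "decreasing_density C (R g)" and e: "0 < e" "e < 1"
    using decreasing_density_rest[OF b Suc.prems(1) C N] decreasing_density_rest[OF b Suc.prems(2) C N]
    by (simp_all add: R_def[abs_def] e_def)
  have Lk: "(?L ^^ k) h = transfer_seq (concat (replicate k cs)) h" for h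
    by (simp add: transfer_seq_concat_replicate)
  \<comment> \<open>Linearity applied to \<open>?L h = (1 - e) * R h + e * 1\<close>; the second
    summand does not depend on \<open>h\<close>.\<close>
  have one: "(?L ^^ Suc k) h = (\<lambda>x. (1 - e) * (?L ^^ k) (R h) x + e * (?L ^^ k) (\<lambda>_. 1) x)" for h
  proof -
    have "?L h = (\<lambda>x. (1 - e) * R h x + e * 1)"
      using e by (auto simp: R_def)
    then show ?thesis
      unfolding funpow_Suc_right o_def Lk using transfer_seq_linear[of _ "1 - e" "R h" e "\<lambda>_. 1"] by simp
  qed
  have "\<bar>(?L ^^ Suc k) f x - (?L ^^ Suc k) g x\<bar> = (1 - e) * \<bar>(?L ^^ k) (R f) x - (?L ^^ k) (R g) x\<bar>"
    unfolding one using e by (simp add: right_diff_distrib[symmetric] abs_mult)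
  also have "\<dots> \<le> (1 - e) * ((1 - e) ^ k * C)"
    using Suc.IH[OF R Suc.prems(3)] e unfolding e_def by (intro mult_left_mono) auto
  finally show ?case by (simp add: e_def)
qed

section \<open>Convergence tested on intervals\<close>

lemma integrable_mult_bounded:
  fixes u v :: "'a \<Rightarrow> real"
  assumes "integrable M u" "v \<in> borel_measurable M" "\<And>x. \<bar>v x\<bar> \<le> 1"
  shows "integrable M (\<lambda>x. v x * u x)"
proof (rule Bochner_Integration.integrable_bound[OF assms(1)])
  show "(\<lambda>x. v x * u x) \<in> borel_measurable M"
    using borel_measurable_integrable[OF assms(1)] assms(2) by measurable
  have "\<bar>v x\<bar> * \<bar>u x\<bar> \<le> 1 * \<bar>u x\<bar>" for x
    by (intro mult_right_mono assms(3)) auto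
  then show "AE x in M. norm (v x * u x) \<le> norm (u x)"
    by (simp add: abs_mult)
qed

text \<open>Since \<open>\<phi> n\<close> and \<open>m\<close> are bounded by 1, the functionals and
  their proposed limit are all 1-Lipschitz for the L1 norm, so the convergence passes to L1 limits
  by an epsilon/3 argument.\<close>

lemma tendsto_integral_L1_closed:
  fixes \<phi> :: "nat \<Rightarrow> 'a \<Rightarrow> real" and f :: "'a \<Rightarrow> real" and m :: real
  assumes [measurable]: "\<And>n. \<phi> n \<in> borel_measurable M" and \<phi>: "\<And>n x. \<bar>\<phi> n x\<bar> \<le> 1" and m: "\<bar>m\<bar> \<le> 1"
    and f: "integrable M f"
    and approx: "\<And>e. e > 0 \<Longrightarrow> \<exists>g. integrable M g \<and> (LINT x|M. \<bar>f x - g x\<bar>) \<le> e \<and>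
       (\<lambda>n. LINT x|M. \<phi> n x * g x) \<longlonglongrightarrow> m * (LINT x|M. g x)"
  shows "(\<lambda>n. LINT x|M. \<phi> n x * f x) \<longlonglongrightarrow> m * (LINT x|M. f x)"
proof (rule LIMSEQ_I)
  fix r :: real assume r: "r > 0"
  obtain g where g: "integrable M g" "(LINT x|M. \<bar>f x - g x\<bar>) \<le> r / 3"
    "(\<lambda>n. LINT x|M. \<phi> n x * g x) \<longlonglongrightarrow> m * (LINT x|M. g x)"
    using approx[of "r / 3"] r by auto
  obtain N where N: "\<And>n. n \<ge> N \<Longrightarrow> \<bar>(LINT x|M. \<phi> n x * g x) - m * (LINT x|M. g x)\<bar> < r / 3"
    using LIMSEQ_D[OF g(3), of "r / 3"] r by auto
  have i: "integrable M (\<lambda>x. \<phi> n x * u x)" if "integrable M u" for u n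
    by (rule integrable_mult_bounded[OF that assms(1) \<phi>])
  have fg: "integrable M (\<lambda>x. f x - g x)" using f g by auto
  have "\<bar>(LINT x|M. \<phi> n x * f x) - m * (LINT x|M. f x)\<bar> < r" if n: "n \<ge> N" for n
  proof -
    have "\<bar>(LINT x|M. \<phi> n x * f x) - (LINT x|M. \<phi> n x * g x)\<bar> = \<bar>LINT x|M. \<phi> n x * (f x - g x)\<bar>"
      using i[OF f] i[OF g(1)] by (simp add: right_diff_distrib)
    also have "\<dots> \<le> (LINT x|M. \<bar>\<phi> n x * (f x - g x)\<bar>)"
      by (rule integral_abs_bound)
    also have "\<dots> \<le> (LINT x|M. \<bar>f x - g x\<bar>)"
      using fg i[OF fg] \<phi> by (intro integral_mono integrable_abs) (auto simp: abs_mult intro!: mult_left_le_one_le)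
    finally have 1: "\<bar>(LINT x|M. \<phi> n x * f x) - (LINT x|M. \<phi> n x * g x)\<bar> \<le> r / 3" using g(2) by simp
    have "\<bar>m * (LINT x|M. f x) - m * (LINT x|M. g x)\<bar> = \<bar>m\<bar> * \<bar>LINT x|M. f x - g x\<bar>"
      using f g by (simp add: right_diff_distrib[symmetric] abs_mult)
    also have "\<dots> \<le> 1 * (LINT x|M. \<bar>f x - g x\<bar>)"
      using m by (intro mult_mono integral_abs_bound) auto
    finally have 2: "\<bar>m * (LINT x|M. f x) - m * (LINT x|M. g x)\<bar> \<le> r / 3" using g(2) by simp
    show ?thesis using 1 2 N[OF n] by linarith
  qed
  then show "\<exists>N. \<forall>n\<ge>N. norm ((LINT x|M. \<phi> n x * f x) - m * (LINT x|M. f x)) < r"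
    by auto
qed

text \<open>Intervals starting at 0 are the test sets for which convergence can be proved, because
  their normalised indicators are decreasing densities. They form an intersection-stable generator
  of the Borel sets; a Dynkin argument gives all indicators, and L1 closedness all integrable
  functions.\<close>

lemma tendsto_integral_from_intervals:
  fixes \<phi> :: "nat \<Rightarrow> real \<Rightarrow> real" and m :: real
  assumes [measurable]: "\<And>n. \<phi> n \<in> borel_measurable lebesgue01" and \<phi>: "\<And>n x. \<bar>\<phi> n x\<bar> \<le> 1" and m: "\<bar>m\<bar> \<le> 1"
    and int: "\<And>c. 0 < c \<Longrightarrow> c \<le> 1 \<Longrightarrow> (\<lambda>n. LINT x|lebesgue01. \<phi> n x * indicator {..<c} x) \<longlonglongrightarrow> m * c"
    and f: "integrable lebesgue01 f"
  shows "(\<lambda>n. LINT x|lebesgue01. \<phi> n x * f x) \<longlonglongrightarrow> m * (LINT x|lebesgue01. f x)"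
proof -
  interpret prob_space lebesgue01 by (rule prob_space_lebesgue01)
  define P where "P f \<longleftrightarrow> (\<lambda>n. LINT x|lebesgue01. \<phi> n x * f x) \<longlonglongrightarrow> m * (LINT x|lebesgue01. f x)" for f
  have mult_int: "integrable lebesgue01 (\<lambda>x. \<phi> n x * u x)" if "integrable lebesgue01 u" for u n
    by (rule integrable_mult_bounded[OF that assms(1) \<phi>])
  have P_add: "P (\<lambda>x. u x + v x)" if "integrable lebesgue01 u" "integrable lebesgue01 v" "P u" "P v" for u v
    using tendsto_add[OF that(3,4)[unfolded P_def]] that(1,2) mult_int[OF that(1)] mult_int[OF that(2)]
    unfolding P_def by (simp add: distrib_left)
  have P_cmult: "P (\<lambda>x. a * u x)" if "P u" for u a
    using tendsto_mult_left[OF that[unfolded P_def], of a] unfolding P_def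
    by (simp add: mult.left_commute[of _ a])
  have P_cong: "P u \<longleftrightarrow> P v" if "\<And>x. x \<in> {0..<1} \<Longrightarrow> u x = v x" for u v
  proof -
    have "(LINT x|lebesgue01. \<phi> n x * u x) = (LINT x|lebesgue01. \<phi> n x * v x)" for n
      using that by (intro Bochner_Integration.integral_cong) (auto simp: space_lebesgue01)
    moreover have "(LINT x|lebesgue01. u x) = (LINT x|lebesgue01. v x)"
      using that by (intro Bochner_Integration.integral_cong) (auto simp: space_lebesgue01)
    ultimately show ?thesis by (simp add: P_def)
  qed
  have ind_int: "integrable lebesgue01 (indicator E :: real \<Rightarrow> real)" if "E \<in> sets borel" for E
    using that by (intro integrable_lebesgue01[where C = 1]) (auto simp: indicator_def)
  \<comment> \<open>The Borel generator needs every real endpoint; those outside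
    \<open>(0,1]\<close> give on \<open>[0,1)\<close> the indicator of the empty set or of
    everything.\<close>
  have P_UNIV: "P (indicator {..<a})" for a :: real
  proof -
    consider "a \<le> 0" | "0 < a" "a \<le> 1" | "1 < a" by linarith
    then show ?thesis
    proof cases
      case 1
      then have "P (indicator {..<a}) \<longleftrightarrow> P (\<lambda>_. 0)" by (intro P_cong) (auto simp: indicator_def)
      then show ?thesis by (simp add: P_def)
    next
      case 2
      have "(LINT x|lebesgue01. indicator {..<a} x) = (LINT x|lebesgue01. indicator {0..<a} x :: real)"
        by (intro Bochner_Integration.integral_cong) (auto simp: space_lebesgue01 indicator_def)
      also have "\<dots> = measure lebesgue01 {0..<a}"
        using 2 by (subst Bochner_Integration.integral_indicator) (auto simp: space_lebesgue01 intro!: arg_cong[of _ _ "measure lebesgue01"])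
      also have "\<dots> = a" using 2 by (subst measure_restrict_space) auto
      finally show ?thesis using int[OF 2] by (simp add: P_def)
    next
      case 3
      then have "P (indicator {..<a}) \<longleftrightarrow> P (indicator {..<1})" by (intro P_cong) (auto simp: indicator_def)
      moreover have "(LINT x|lebesgue01. indicator {..<1} x :: real) = (LINT x|lebesgue01. 1)"
        by (intro Bochner_Integration.integral_cong) (auto simp: space_lebesgue01 indicator_def)
      ultimately show ?thesis using int[of 1] by (simp add: P_def measure_lebesgue01_space)
    qed
  qed
  have borel: "sets borel = sigma_sets UNIV (range (lessThan :: real \<Rightarrow> real set))"
    by (subst borel_Iio) simp
  have P_ind: "P (indicator E)" if "E \<in> sigma_sets UNIV (range (lessThan :: real \<Rightarrow> real set))" for E
  proof -
    have "Int_stable (range (lessThan :: real \<Rightarrow> real set))"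
      unfolding Int_stable_def
    proof (intro ballI)
      fix X Y assume "X \<in> range (lessThan :: real \<Rightarrow> real set)" "Y \<in> range (lessThan :: real \<Rightarrow> real set)"
      then obtain a b where "X = {..<a}" "Y = {..<b}" by auto
      then have "X \<inter> Y = {..<min a b}" by auto
      then show "X \<inter> Y \<in> range lessThan" by blast
    qed
    moreover have "range (lessThan :: real \<Rightarrow> real set) \<subseteq> Pow UNIV" by simp
    ultimately show ?thesis using that
  proof (induction rule: sigma_sets_induct_disjoint)
    case (basic A) then show ?case using P_UNIV by auto
  next
    case empty show ?case by (simp add: P_def)
  next
    case (compl A)
    have A: "A \<in> sets borel" using compl borel by simp
    \<comment> \<open>On \<open>[0,1)\<close> the complement is the constant 1, written as the
      interval ending at 1, minus the indicator of \<open>A\<close>.\<close>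
    have "P (\<lambda>x. indicator {..<1} x + (-1) * indicator A x)"
      using A compl by (intro P_add P_cmult P_UNIV Bochner_Integration.integrable_mult_right ind_int) auto
    also have "?this \<longleftrightarrow> P (indicator (UNIV - A))"
      by (intro P_cong) (auto simp: indicator_def)
    finally show ?case .
  next
    case (union A)
    have A: "A i \<in> sets borel" for i using union(2) borel by auto
    have fin: "P (indicator (\<Union>i<k. A i))" for k
    proof (induction k)
      case (Suc k)
      have "P (\<lambda>x. indicator (\<Union>i<k. A i) x + indicator (A k) x)"
        using A union Suc by (intro P_add ind_int) auto
      also have "?this \<longleftrightarrow> P (indicator (\<Union>i<Suc k. A i))"
      proof (rule P_cong)
        fix x
        have "(\<Union>i<k. A i) \<inter> A k = {}"
        proof -
          have "A i \<inter> A k = {}" if "i < k" for i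
            using disjoint_family_onD[OF union(1), of i k] that by simp
          then show ?thesis by blast
        qed
        then have "x \<notin> (\<Union>i<k. A i) \<or> x \<notin> A k" by blast
        moreover have "(\<Union>i<Suc k. A i) = (\<Union>i<k. A i) \<union> A k" by (auto simp: lessThan_Suc)
        ultimately show "indicator (\<Union>i<k. A i) x + indicator (A k) x = (indicator (\<Union>i<Suc k. A i) x :: real)"
          by (auto simp: indicator_def)
      qed
      finally show ?case .
    qed (simp add: P_def)
    \<comment> \<open>A countable union is the L1 limit of its finite subunions, by dominated
      convergence.\<close>
    have lim: "(\<lambda>k. LINT x|lebesgue01. \<bar>indicator (\<Union>i. A i) x - indicator (\<Union>i<k. A i) x :: real\<bar>) \<longlonglongrightarrow> (LINT x|lebesgue01. 0)"
    proof (rule integral_dominated_convergence[where w = "\<lambda>_. 1"])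
      show "AE x in lebesgue01. (\<lambda>k. \<bar>indicator (\<Union>i. A i) x - indicator (\<Union>i<k. A i) x :: real\<bar>) \<longlonglongrightarrow> 0"
      proof (rule AE_I2)
        fix x
        have "(\<lambda>k. indicator (\<Union>i. A i) x - indicator (\<Union>i<k. A i) x :: real) \<longlonglongrightarrow> indicator (\<Union>i. A i) x - indicator (\<Union>i. A i) x"
          by (intro tendsto_diff tendsto_const LIMSEQ_indicator_UN)
        from tendsto_rabs[OF this] show "(\<lambda>k. \<bar>indicator (\<Union>i. A i) x - indicator (\<Union>i<k. A i) x :: real\<bar>) \<longlonglongrightarrow> 0"
          by simp
      qed
      have [measurable]: "A i \<in> sets borel" for i by (rule A)
      show "(\<lambda>x. \<bar>indicator (\<Union>i. A i) x - indicator (\<Union>i<k. A i) x :: real\<bar>) \<in> borel_measurable lebesgue01" for k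
        by (intro borel_measurable_lebesgue01) measurable
    qed (auto simp: indicator_def)
    show ?case
      unfolding P_def
    proof (rule tendsto_integral_L1_closed[OF assms(1) \<phi> m])
      fix e :: real assume "e > 0"
      then obtain k where "(LINT x|lebesgue01. \<bar>indicator (\<Union>i. A i) x - indicator (\<Union>i<k. A i) x :: real\<bar>) < e"
        using LIMSEQ_D[OF lim, of e] by force
      then show "\<exists>g. integrable lebesgue01 g \<and> (LINT x|lebesgue01. \<bar>indicator (\<Union>i. A i) x - g x\<bar>) \<le> e \<and>
         (\<lambda>n. LINT x|lebesgue01. \<phi> n x * g x) \<longlonglongrightarrow> m * (LINT x|lebesgue01. g x)"
        using fin[of k] A unfolding P_def by (intro exI[of _ "indicator (\<Union>i<k. A i)"]) (auto intro!: ind_int)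
    qed (use A in \<open>auto intro!: ind_int\<close>)
  qed
  qed
  from f have "P f"
  proof (induct rule: integrable_induct)
    case (base A c)
    then have "A \<in> sigma_sets UNIV (range (lessThan :: real \<Rightarrow> real set))"
      unfolding borel[symmetric] by (simp add: sets_restrict_space_iff)
    from P_cmult[OF P_ind[OF this], of c] show ?case by (simp add: mult.commute)
  next
    case (add f g) then show ?case by (intro P_add)
  next
    case (lim f s)
    have bound: "\<bar>f x - s i x\<bar> \<le> 3 * \<bar>f x\<bar>" if "x \<in> space lebesgue01" for i x
    proof -
      have "\<bar>f x - s i x\<bar> \<le> \<bar>f x\<bar> + \<bar>s i x\<bar>" by (rule abs_triangle_ineq4)
      then show ?thesis using lim(4)[OF that, of i] by simp
    qed
    have l: "(\<lambda>i. LINT x|lebesgue01. \<bar>f x - s i x\<bar>) \<longlonglongrightarrow> (LINT x|lebesgue01. 0)"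
    proof (rule integral_dominated_convergence[where w = "\<lambda>x. 3 * \<bar>f x\<bar>"])
      show "AE x in lebesgue01. (\<lambda>i. \<bar>f x - s i x\<bar>) \<longlonglongrightarrow> 0"
      proof (rule AE_I2)
        fix x assume "x \<in> space lebesgue01"
        then have "(\<lambda>i. f x - s i x) \<longlonglongrightarrow> f x - f x" by (intro tendsto_diff lim(3) tendsto_const)
        from tendsto_rabs[OF this] show "(\<lambda>i. \<bar>f x - s i x\<bar>) \<longlonglongrightarrow> 0" by simp
      qed
      show "AE x in lebesgue01. norm \<bar>f x - s i x\<bar> \<le> 3 * \<bar>f x\<bar>" for i
        by (intro AE_I2) (simp add: bound)
      show "integrable lebesgue01 (\<lambda>x. 3 * \<bar>f x\<bar>)"
        by (intro Bochner_Integration.integrable_mult_right integrable_abs lim(5))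
      show "(\<lambda>x. \<bar>f x - s i x\<bar>) \<in> borel_measurable lebesgue01" for i
        by (intro borel_measurable_integrable integrable_abs Bochner_Integration.integrable_diff lim(1,5))
    qed simp
    show ?case unfolding P_def
    proof (rule tendsto_integral_L1_closed[OF assms(1) \<phi> m lim(5)])
      fix e :: real assume "e > 0"
      then obtain k where "(LINT x|lebesgue01. \<bar>f x - s k x\<bar>) < e"
        using LIMSEQ_D[OF l, of e] by force
      then show "\<exists>g. integrable lebesgue01 g \<and> (LINT x|lebesgue01. \<bar>f x - g x\<bar>) \<le> e \<and>
         (\<lambda>n. LINT x|lebesgue01. \<phi> n x * g x) \<longlonglongrightarrow> m * (LINT x|lebesgue01. g x)"
        using lim(1)[of k] lim(2)[of k] unfolding P_def by (intro exI[of _ "s k"] conjI less_imp_le)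
    qed
  qed
  then show ?thesis by (simp add: P_def)
qed

lemma invariant_measure_funpow:
  assumes "invariant_measure M T"
  shows "invariant_measure M (T ^^ n)"
proof (induction n)
  case (Suc n)
  have T: "T \<in> measurable M M" "\<And>B. B \<in> sets M \<Longrightarrow> emeasure M (T -` B \<inter> space M) = emeasure M B"
    using assms by (auto simp: invariant_measure_def)
  have Tn: "T ^^ n \<in> measurable M M" "\<And>B. B \<in> sets M \<Longrightarrow> emeasure M ((T ^^ n) -` B \<inter> space M) = emeasure M B"
    using Suc by (auto simp: invariant_measure_def)
  show ?case unfolding invariant_measure_def
  proof (intro conjI ballI)
    show "T ^^ Suc n \<in> measurable M M" using T Tn by auto
    fix B assume B: "B \<in> sets M"
    have "(T ^^ Suc n) -` B \<inter> space M = (T ^^ n) -` (T -` B \<inter> space M) \<inter> space M"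
      using measurable_space[OF Tn(1)] by auto
    then show "emeasure M ((T ^^ Suc n) -` B \<inter> space M) = emeasure M B"
      by (simp only: Tn(2)[OF measurable_sets[OF T(1) B]] T(2)[OF B])
  qed
qed (auto simp: invariant_measure_def)

section \<open>Invariant densities of compositions of beta-transformations\<close>

locale expanding_seq =
  fixes bs :: "real list"
  assumes nonempty: "bs \<noteq> []" and gt_1: "\<And>b. b \<in> set bs \<Longrightarrow> 1 < b"
begin

text \<open>The value is meaningful on \<open>[0,1)\<close> only, where convergence is shown
  below.\<close>

definition limit_density :: "real \<Rightarrow> real" where
  "limit_density x = lim (\<lambda>n. (transfer_seq bs ^^ n) (\<lambda>_. 1) x)"

abbreviation acip :: "real measure" where
  "acip \<equiv> density lebesgue01 (\<lambda>x. ennreal (limit_density x))"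

definition base :: real where
  "base = Min (set bs)"

lemma base: "base > 1" "\<And>b. b \<in> set bs \<Longrightarrow> base \<le> b"
  unfolding base_def using nonempty gt_1 by auto

text \<open>The factor 4 is the one demanded by \<open>decreasing_density_rest\<close>.\<close>

definition bound :: real where
  "bound = 4 * (base / (base - 1))"

lemma bound_ge: "bound \<ge> base / (base - 1)" "bound \<ge> 1"
proof -
  have "base / (base - 1) \<ge> 1" using base(1) by (simp add: field_simps)
  then show "bound \<ge> base / (base - 1)" "bound \<ge> 1" unfolding bound_def by linarith+
qed

lemma decreasing_density_funpow:
  assumes "decreasing_density C f" "C \<ge> bound"
  shows "decreasing_density C ((transfer_seq bs ^^ n) f)"
proof -
  have "decreasing_density C (transfer_seq (concat (replicate n bs)) f)"
    using assms base bound_ge by (intro decreasing_density_transfer_seq_same[of base]) (auto simp: set_replicate_conv_if split: if_splits)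
  then show ?thesis by (simp add: transfer_seq_concat_replicate)
qed

text \<open>Supplies the block length for the Doeblin condition; \<open>N > 0\<close> permits
  division of \<open>n\<close> into blocks of \<open>N\<close>.\<close>

lemma long_power:
  obtains N where "N > 0" "base ^ length (concat (replicate N bs)) \<ge> 2 * C"
proof -
  obtain N where N: "2 * C < base ^ N" using real_arch_pow[OF base(1)] by blast
  have "length bs \<ge> 1" using nonempty by (simp add: Suc_leI)
  then have "Suc N \<le> length (concat (replicate (Suc N) bs))"
    using mult_le_mono[of "Suc N" "Suc N" 1 "length bs"] by (simp add: length_concat sum_list_replicate)
  then have "base ^ N \<le> base ^ length (concat (replicate (Suc N) bs))"
    using base by (intro power_increasing) auto
  then show ?thesis using N by (intro that[of "Suc N"]) auto
qed

lemma set_concat_replicate_ge: "\<beta> \<in> set (concat (replicate N bs)) \<Longrightarrow> base \<le> \<beta>"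
  using base by (auto simp: set_replicate_conv_if split: if_splits)

text \<open>The rate \<open>e\<close> depends on \<open>C\<close> alone. Enlarging \<open>C\<close>
  to at least \<open>bound\<close> makes the class invariant; then \<open>n div N\<close> full
  blocks contract, after the \<open>n mod N\<close> left-over steps have been applied within the
  class.\<close>

lemma uniform_contraction:
  obtains e where "e \<longlonglongrightarrow> (0::real)"
    "\<And>f g n x. decreasing_density C f \<Longrightarrow> decreasing_density C g \<Longrightarrow> x \<in> {0..<1} \<Longrightarrow>
       \<bar>(transfer_seq bs ^^ n) f x - (transfer_seq bs ^^ n) g x\<bar> \<le> e n"
proof -
  define D where "D = max C bound"
  have D: "D \<ge> C" "D \<ge> bound" by (auto simp: D_def)
  obtain N where N: "N > 0" "base ^ length (concat (replicate N bs)) \<ge> 2 * D"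
    using long_power by blast
  let ?cs = "concat (replicate N bs)"
  define r where "r = 1 - 1 / (2 * prod_list ?cs)"
  have "prod_list ?cs \<ge> 2 * D"
    using N prod_list_ge_power[of base ?cs] base(1) set_concat_replicate_ge by force
  then have r: "0 \<le> r" "r < 1" unfolding r_def using D bound_ge(2) by (auto simp: field_simps)
  have div: "filterlim (\<lambda>n. n div N) at_top sequentially"
    unfolding filterlim_at_top eventually_sequentially
  proof
    fix Z
    show "\<exists>k. \<forall>n\<ge>k. Z \<le> n div N"
      using N(1) by (intro exI[of _ "Z * N"]) (metis div_le_mono nonzero_mult_div_cancel_right not_gr0)
  qed
  have "(\<lambda>n. r ^ (n div N) * D) \<longlonglongrightarrow> 0 * D"
    using r by (intro tendsto_mult tendsto_const filterlim_compose[OF LIMSEQ_realpow_zero div])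
  moreover have "\<bar>(transfer_seq bs ^^ n) f x - (transfer_seq bs ^^ n) g x\<bar> \<le> r ^ (n div N) * D"
    if fg: "decreasing_density C f" "decreasing_density C g" and x: "x \<in> {0..<1}" for f g n x
  proof -
    have eq: "(transfer_seq bs ^^ n) u = (transfer_seq ?cs ^^ (n div N)) ((transfer_seq bs ^^ (n mod N)) u)" for u
    proof -
      have "(transfer_seq bs ^^ n) u = (transfer_seq bs ^^ (N * (n div N) + n mod N)) u"
        by simp
      also have "\<dots> = (transfer_seq ?cs ^^ (n div N)) ((transfer_seq bs ^^ (n mod N)) u)"
        unfolding funpow_add o_def by (simp add: transfer_seq_concat_replicate funpow_mult)
      finally show ?thesis .
    qed
    have fg': "decreasing_density D f" "decreasing_density D g" using fg D decreasing_density_mono by blast+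
    show ?thesis unfolding eq r_def
      using D(2) N(2) x bound_def decreasing_density_funpow[OF fg'(1) D(2)] decreasing_density_funpow[OF fg'(2) D(2)]
      by (intro transfer_seq_contraction[OF base(1) set_concat_replicate_ge]) auto
  qed
  ultimately show ?thesis using that[of "\<lambda>n. r ^ (n div N) * D"] by simp
qed

lemma decreasing_density_1: "decreasing_density bound (\<lambda>_. 1)"
  unfolding decreasing_density_def using bound_ge by (auto simp: measure_lebesgue01_space space_lebesgue01)

text \<open>The iterates \<open>n + m\<close> and \<open>n\<close> of the constant 1 are the
  \<open>n\<close>-th iterates of two densities of one class, so they differ by at most
  \<open>e n\<close>: a Cauchy sequence.\<close>

lemma tendsto_limit_density_1:
  assumes x: "x \<in> {0..<1}"
  shows "(\<lambda>n. (transfer_seq bs ^^ n) (\<lambda>_. 1) x) \<longlonglongrightarrow> limit_density x"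
proof -
  let ?u = "\<lambda>n. (transfer_seq bs ^^ n) (\<lambda>_. 1) x"
  obtain e where e: "e \<longlonglongrightarrow> (0::real)"
    "\<And>f g n x. decreasing_density bound f \<Longrightarrow> decreasing_density bound g \<Longrightarrow> x \<in> {0..<1} \<Longrightarrow>
       \<bar>(transfer_seq bs ^^ n) f x - (transfer_seq bs ^^ n) g x\<bar> \<le> e n"
    using uniform_contraction by blast
  have d: "\<bar>?u (n + m) - ?u n\<bar> \<le> e n" for n m
    using e(2)[OF decreasing_density_funpow[OF decreasing_density_1, of m] decreasing_density_1 x, of n]
    by (simp add: funpow_add)
  have "Cauchy ?u"
  proof (rule CauchyI')
    fix r :: real assume "r > 0"
    then obtain M where M: "\<And>n. n \<ge> M \<Longrightarrow> \<bar>e n\<bar> < r"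
      using LIMSEQ_D[OF e(1)] by fastforce
    have "dist (?u m) (?u n) < r" if "m \<ge> M" "n > m" for m n
      using d[of m "n - m"] M[of m] that by (simp add: dist_real_def)
    then show "\<exists>M. \<forall>m\<ge>M. \<forall>n>m. dist (?u m) (?u n) < r" by blast
  qed
  then show ?thesis
    unfolding limit_density_def using Cauchy_convergent convergent_LIMSEQ_iff by blast
qed

text \<open>The contraction makes the limit independent of the initial density, which is the source
  of mixing.\<close>

lemma tendsto_limit_density:
  assumes "decreasing_density C f" and x: "x \<in> {0..<1}"
  shows "(\<lambda>n. (transfer_seq bs ^^ n) f x) \<longlonglongrightarrow> limit_density x"
proof -
  define D where "D = max C bound"
  obtain e where e: "e \<longlonglongrightarrow> (0::real)"
    "\<And>f g n x. decreasing_density D f \<Longrightarrow> decreasing_density D g \<Longrightarrow> x \<in> {0..<1} \<Longrightarrow>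
       \<bar>(transfer_seq bs ^^ n) f x - (transfer_seq bs ^^ n) g x\<bar> \<le> e n"
    using uniform_contraction by blast
  have "decreasing_density D f" "decreasing_density D (\<lambda>_. 1)"
    using decreasing_density_mono[OF assms(1)] decreasing_density_mono[OF decreasing_density_1] by (auto simp: D_def)
  from e(2)[OF this x] have "(\<lambda>n. (transfer_seq bs ^^ n) f x - (transfer_seq bs ^^ n) (\<lambda>_. 1) x) \<longlonglongrightarrow> 0"
    by (intro Lim_null_comparison[OF _ e(1)]) auto
  from tendsto_add[OF this tendsto_limit_density_1[OF x]] show ?thesis by simp
qed

lemma measurable_limit_density [measurable]: "limit_density \<in> borel_measurable borel"
proof -
  have [measurable]: "(transfer_seq bs ^^ n) (\<lambda>_. 1) \<in> borel_measurable borel" for n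
    using decreasing_densityD(1)[OF decreasing_density_funpow[OF decreasing_density_1]] by simp
  show ?thesis unfolding limit_density_def[abs_def] by measurable
qed

lemma tendsto_integral_limit_density:
  assumes f: "decreasing_density C f" and [measurable]: "A \<in> sets borel"
  shows "(\<lambda>n. LINT x|lebesgue01. indicator A x * (transfer_seq bs ^^ n) f x) \<longlonglongrightarrow>
    (LINT x|lebesgue01. indicator A x * limit_density x)"
proof -
  interpret prob_space lebesgue01 by (rule prob_space_lebesgue01)
  define D where "D = max C bound"
  have D: "D \<ge> C" "D \<ge> bound" by (auto simp: D_def)
  have d: "decreasing_density D ((transfer_seq bs ^^ n) f)" for n
    using decreasing_density_funpow[OF decreasing_density_mono[OF f]] D by blast
  note [measurable] = decreasing_densityD(1)[OF d]
  show ?thesis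
  proof (rule integral_dominated_convergence[where w = "\<lambda>_. D"])
    show "AE x in lebesgue01. (\<lambda>n. indicator A x * (transfer_seq bs ^^ n) f x) \<longlonglongrightarrow> indicator A x * limit_density x"
      using tendsto_limit_density[OF f] by (intro AE_I2 tendsto_mult tendsto_const) (simp add: space_lebesgue01)
    show "AE x in lebesgue01. norm (indicator A x * (transfer_seq bs ^^ n) f x) \<le> D" for n
      using decreasing_densityD(2,3)[OF d] D bound_ge by (intro AE_I2) (auto simp: space_lebesgue01 indicator_def)
  qed (auto intro!: borel_measurable_lebesgue01)
qed

lemma decreasing_density_limit: "decreasing_density bound limit_density"
proof -
  have d: "decreasing_density bound ((transfer_seq bs ^^ n) (\<lambda>_. 1))" for n
    using decreasing_density_funpow[OF decreasing_density_1] by simp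
  note lim = tendsto_limit_density_1
  show ?thesis unfolding decreasing_density_def
  proof (intro conjI ballI allI impI)
    fix x :: real assume x: "x \<in> {0..<1}"
    show "0 \<le> limit_density x" using decreasing_densityD(2)[OF d x] by (intro LIMSEQ_le_const[OF lim[OF x]]) auto
    show "limit_density x \<le> bound" using decreasing_densityD(3)[OF d x] by (intro LIMSEQ_le_const2[OF lim[OF x]]) auto
  next
    fix x y :: real assume xy: "0 \<le> x" "x \<le> y" "y < 1"
    then show "limit_density y \<le> limit_density x"
      using decreasing_densityD(4)[OF d xy] by (intro LIMSEQ_le[OF lim lim]) auto
  next
    have "(\<lambda>n. 1) \<longlonglongrightarrow> (LINT x|lebesgue01. limit_density x)"
      using tendsto_integral_limit_density[OF decreasing_density_1, of UNIV] decreasing_densityD(5)[OF d] by simp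
    then show "(LINT x|lebesgue01. limit_density x) = 1"
      using LIMSEQ_unique tendsto_const by metis
  qed simp
qed

text \<open>A transfer operator is a finite sum of point evaluations in \<open>[0,1)\<close>, hence
  commutes with pointwise limits there.\<close>

lemma transfer_limit_density:
  assumes "x \<in> {0..<1}"
  shows "(transfer_seq bs ^^ n) limit_density x = limit_density x"
proof (rule LIMSEQ_unique)
  have pos: "\<And>b. b \<in> set (concat (replicate n bs)) \<Longrightarrow> b > 0" using set_concat_replicate_ge base(1) by fastforce
  have "(\<lambda>k. transfer_seq (concat (replicate n bs)) ((transfer_seq bs ^^ k) (\<lambda>_. 1)) x) \<longlonglongrightarrow>
    transfer_seq (concat (replicate n bs)) limit_density x"
    using pos assms by (intro tendsto_transfer_seq tendsto_limit_density_1) auto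
  then show "(\<lambda>k. (transfer_seq bs ^^ (k + n)) (\<lambda>_. 1) x) \<longlonglongrightarrow> (transfer_seq bs ^^ n) limit_density x"
    by (simp add: transfer_seq_concat_replicate funpow_add add.commute[of _ n])
  show "(\<lambda>k. (transfer_seq bs ^^ (k + n)) (\<lambda>_. 1) x) \<longlonglongrightarrow> limit_density x"
    using tendsto_limit_density_1[OF assms] by (rule LIMSEQ_ignore_initial_segment)
qed

text \<open>The Doeblin splitting is applied to the fixed density itself: it stays nonnegative after
  \<open>e\<close> has been subtracted.\<close>

lemma limit_density_pos:
  obtains e where "e > 0" "\<And>x. x \<in> {0..<1} \<Longrightarrow> e \<le> limit_density x"
proof -
  obtain N where N: "N > 0" "base ^ length (concat (replicate N bs)) \<ge> 2 * bound"
    using long_power by blast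
  define e where "e = 1 / (2 * prod_list (concat (replicate N bs)))"
  have r: "decreasing_density bound (\<lambda>x. (transfer_seq (concat (replicate N bs)) limit_density x - e) / (1 - e))" "0 < e" "e < 1"
    using decreasing_density_rest[OF base(1) set_concat_replicate_ge[of _ N] decreasing_density_limit _ N(2)]
    by (simp_all add: bound_def e_def)
  have "e \<le> limit_density x" if "x \<in> {0..<1}" for x
    using decreasing_densityD(2)[OF r(1) that] transfer_limit_density[OF that, of N] r(3)
    by (simp add: transfer_seq_concat_replicate zero_le_divide_iff)
  with r(2) show ?thesis using that by blast
qed

section \<open>The invariant measure: comparison with Lebesgue measure, mixing, uniqueness,
  ergodicity\<close>

lemma emeasure_acip:
  assumes "A \<in> sets lebesgue01"
  shows "emeasure acip A = ennreal (LINT x|lebesgue01. indicator A x * limit_density x)"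
proof -
  have [measurable]: "A \<in> sets borel" using assms by (auto simp: sets_restrict_space_iff)
  have "emeasure acip A = (\<integral>\<^sup>+x. ennreal (limit_density x) * indicator A x \<partial>lebesgue01)"
    using assms by (intro emeasure_density borel_measurable_lebesgue01) auto
  also have "\<dots> = (\<integral>\<^sup>+x. ennreal (indicator A x * limit_density x) \<partial>lebesgue01)"
    by (intro nn_integral_cong) (auto simp: indicator_def)
  also have "\<dots> = ennreal (LINT x|lebesgue01. indicator A x * limit_density x)"
    using decreasing_densityD(2,3)[OF decreasing_density_limit] bound_ge
    by (intro nn_integral_eq_integral integrable_lebesgue01[where C = bound] AE_I2)
       (auto simp: indicator_def space_lebesgue01)
  finally show ?thesis .
qed

lemma emeasure_acip_le:
  assumes "A \<in> sets lebesgue01"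
  shows "emeasure acip A \<le> ennreal bound * emeasure lebesgue01 A"
proof -
  have "emeasure acip A = (\<integral>\<^sup>+x. ennreal (limit_density x) * indicator A x \<partial>lebesgue01)"
    using assms by (intro emeasure_density borel_measurable_lebesgue01) auto
  also have "\<dots> \<le> (\<integral>\<^sup>+x. ennreal bound * indicator A x \<partial>lebesgue01)"
    using decreasing_densityD(3)[OF decreasing_density_limit]
    by (intro nn_integral_mono mult_right_mono ennreal_leI) (auto simp: space_lebesgue01)
  also have "\<dots> = ennreal bound * emeasure lebesgue01 A"
    using assms by (simp add: nn_integral_cmult)
  finally show ?thesis .
qed

lemma emeasure_acip_ge:
  obtains e where "e > 0" "\<And>A. A \<in> sets lebesgue01 \<Longrightarrow> ennreal e * emeasure lebesgue01 A \<le> emeasure acip A"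
proof -
  obtain e where e: "e > 0" "\<And>x. x \<in> {0..<1} \<Longrightarrow> e \<le> limit_density x" using limit_density_pos by blast
  have "ennreal e * emeasure lebesgue01 A \<le> emeasure acip A" if A: "A \<in> sets lebesgue01" for A
  proof -
    have "ennreal e * emeasure lebesgue01 A = (\<integral>\<^sup>+x. ennreal e * indicator A x \<partial>lebesgue01)"
      using A by (simp add: nn_integral_cmult)
    also have "\<dots> \<le> (\<integral>\<^sup>+x. ennreal (limit_density x) * indicator A x \<partial>lebesgue01)"
      using e by (intro nn_integral_mono mult_right_mono ennreal_leI) (auto simp: space_lebesgue01)
    also have "\<dots> = emeasure acip A"
      using A by (intro emeasure_density[symmetric] borel_measurable_lebesgue01) auto
    finally show ?thesis .
  qed
  then show ?thesis using e that by blast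
qed

lemma prob_space_acip: "prob_space acip"
proof (rule prob_spaceI)
  have "emeasure acip {0..<1} = ennreal (LINT x|lebesgue01. limit_density x)"
    by (subst emeasure_acip) (auto intro!: arg_cong[of _ _ ennreal] Bochner_Integration.integral_cong simp: space_lebesgue01 sets_restrict_space_iff)
  then show "emeasure acip (space acip) = 1"
    using decreasing_densityD(5)[OF decreasing_density_limit] by (simp add: space_lebesgue01)
qed

lemma concat_replicate_pos: "b \<in> set (concat (replicate n bs)) \<Longrightarrow> b > 0"
  using set_concat_replicate_ge base(1) by fastforce

lemma integral_T_seq_funpow:
  fixes h :: "real \<Rightarrow> real"
  assumes "A \<in> sets borel" "h \<in> borel_measurable borel" "\<And>x. x \<in> {0..<1} \<Longrightarrow> h x \<ge> 0"
  shows "(LINT x|lebesgue01. indicator A ((T_seq bs ^^ n) x) * h x) =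
         (LINT x|lebesgue01. indicator A x * (transfer_seq bs ^^ n) h x)"
  using integral_T_seq[of "concat (replicate n bs)" A h, OF concat_replicate_pos[of _ n] assms] by (simp add: transfer_seq_concat_replicate T_seq_concat_replicate)

lemma is_acip_acip: "is_acip lebesgue01 (T_seq bs) acip"
  unfolding is_acip_def invariant_measure_def
proof (intro conjI ballI)
  show "absolutely_continuous lebesgue01 acip"
    by (intro absolutely_continuousI_density borel_measurable_lebesgue01) measurable
  show "T_seq bs \<in> measurable acip acip" by measurable
  fix B assume "B \<in> sets acip"
  then have B: "B \<in> sets lebesgue01" "B \<in> sets borel" by (auto simp: sets_restrict_space_iff)
  have m: "T_seq bs -` B \<inter> {0..<1} \<in> sets lebesgue01"
    using measurable_sets[OF measurable_T_seq[of bs] B(1)] by (simp add: space_lebesgue01)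
  have "emeasure acip (T_seq bs -` B \<inter> space acip) = ennreal (LINT x|lebesgue01. indicator (T_seq bs -` B \<inter> {0..<1}) x * limit_density x)"
    using emeasure_acip[OF m] by (simp add: space_lebesgue01)
  also have "\<dots> = ennreal (LINT x|lebesgue01. indicator B ((T_seq bs ^^ 1) x) * limit_density x)"
    by (intro arg_cong[of _ _ ennreal] Bochner_Integration.integral_cong) (auto simp: space_lebesgue01 indicator_def)
  also have "\<dots> = ennreal (LINT x|lebesgue01. indicator B x * (transfer_seq bs ^^ 1) limit_density x)"
    using B decreasing_densityD(2)[OF decreasing_density_limit] by (subst integral_T_seq_funpow) auto
  also have "\<dots> = ennreal (LINT x|lebesgue01. indicator B x * limit_density x)"
    using transfer_limit_density[of _ 1]
    by (intro arg_cong[of _ _ ennreal] Bochner_Integration.integral_cong) (auto simp: space_lebesgue01)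
  also have "\<dots> = emeasure acip B" using emeasure_acip[OF B(1)] by simp
  finally show "emeasure acip (T_seq bs -` B \<inter> space acip) = emeasure acip B" .
qed (auto intro: prob_space_acip)

text \<open>Stated for Lebesgue-integrable \<open>f\<close> instead of densities with respect to
  \<open>acip\<close>, so that it applies to any competing invariant measure. For \<open>f\<close>
  the normalised indicator of \<open>[0,c)\<close>, duality moves the iteration to a decreasing
  density, which converges to \<open>limit_density\<close>.\<close>

lemma mixing:
  assumes f: "integrable lebesgue01 f" and A: "A \<in> sets lebesgue01"
  shows "(\<lambda>n. LINT x|lebesgue01. indicator A ((T_seq bs ^^ n) x) * f x) \<longlonglongrightarrow> measure acip A * (LINT x|lebesgue01. f x)"
proof (rule tendsto_integral_from_intervals[OF _ _ _ _ f])
  interpret prob_space acip by (rule prob_space_acip)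
  have [measurable]: "A \<in> sets borel" using A by (auto simp: sets_restrict_space_iff)
  have [measurable]: "T_seq bs ^^ n \<in> borel_measurable borel" for n
    using measurable_T_seq_borel[of "concat (replicate n bs)"] by (simp add: T_seq_concat_replicate)
  show "(\<lambda>x. indicator A ((T_seq bs ^^ n) x) :: real) \<in> borel_measurable lebesgue01" for n
    by (intro borel_measurable_lebesgue01) measurable
  show "\<bar>measure acip A\<bar> \<le> 1" by simp
  have "0 \<le> (LINT x|lebesgue01. indicator A x * limit_density x)"
    using decreasing_densityD(2)[OF decreasing_density_limit]
    by (intro integral_nonneg_AE AE_I2) (auto simp: space_lebesgue01 indicator_def)
  then have mA: "measure acip A = (LINT x|lebesgue01. indicator A x * limit_density x)"
    using emeasure_acip[OF A] by (simp add: measure_def)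
  fix c :: real assume c: "0 < c" "c \<le> 1"
  let ?f = "\<lambda>x. indicator {..<c} x / c :: real"
  have "decreasing_density (1 / c) ?f"
    unfolding decreasing_density_def
  proof (intro conjI)
    have "(LINT x|lebesgue01. ?f x) = (LINT x|lebesgue01. indicator {0..<c} x :: real) / c"
      by (subst Bochner_Integration.integral_divide_zero[symmetric], intro Bochner_Integration.integral_cong) (auto simp: space_lebesgue01 indicator_def)
    also have "(LINT x|lebesgue01. indicator {0..<c} x :: real) = measure lebesgue01 {0..<c}"
      using c by (subst Bochner_Integration.integral_indicator) (auto simp: space_lebesgue01 intro!: arg_cong[of _ _ "measure lebesgue01"])
    also have "\<dots> = c" using c by (subst measure_restrict_space) auto
    finally show "(LINT x|lebesgue01. ?f x) = 1" using c by simp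
  qed (use c in \<open>auto simp: indicator_def\<close>)
  note d = this
  have "(\<lambda>n. LINT x|lebesgue01. indicator A ((T_seq bs ^^ n) x) * ?f x) \<longlonglongrightarrow> measure acip A"
    using tendsto_integral_limit_density[OF d, of A] decreasing_densityD(1,2)[OF d]
    unfolding mA by (subst integral_T_seq_funpow) auto
  from tendsto_mult_right[OF this, of c]
  show "(\<lambda>n. LINT x|lebesgue01. indicator A ((T_seq bs ^^ n) x) * indicator {..<c} x) \<longlonglongrightarrow> measure acip A * c"
    using c by simp
qed (auto simp: indicator_def)

text \<open>Mixing is tested with the Lebesgue density \<open>D\<close> of the competitor
  \<open>M\<close>: invariance makes the sequence constantly \<open>M\<close>'s value on
  \<open>A\<close>, while its limit is that of \<open>acip\<close>.\<close>

lemma acip_unique: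
  assumes M: "is_acip lebesgue01 (T_seq bs) M"
  shows "M = acip"
proof (rule measure_eqI)
  show s: "sets M = sets acip" using M by (simp add: is_acip_def)
  then have sp: "space M = {0..<1}" using sets_eq_imp_space_eq[OF s] by (simp add: space_lebesgue01)
  interpret M: prob_space M using M by (simp add: is_acip_def)
  interpret L: prob_space lebesgue01 by (rule prob_space_lebesgue01)
  obtain D where D: "D \<in> borel_measurable lebesgue01" "AE x in lebesgue01. RN_deriv lebesgue01 M x = ennreal (D x)" "\<And>x. 0 \<le> D x"
    using L.real_RN_deriv[of M] M M.finite_measure_axioms unfolding is_acip_def by metis
  have "M = density lebesgue01 (RN_deriv lebesgue01 M)"
    using M by (intro L.density_RN_deriv[symmetric]) (auto simp: is_acip_def)
  also have "\<dots> = density lebesgue01 (\<lambda>x. ennreal (D x))"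
    using D by (intro density_cong) auto
  finally have MD: "M = density lebesgue01 (\<lambda>x. ennreal (D x))" .
  have mD: "integrable lebesgue01 D" "(LINT x|lebesgue01. D x) = 1"
  proof -
    have e: "(\<integral>\<^sup>+x. ennreal (D x) \<partial>lebesgue01) = emeasure M (space M)"
    proof -
      have "emeasure M {0..<1} = emeasure (density lebesgue01 (\<lambda>x. ennreal (D x))) {0..<1}"
        using MD by (rule arg_cong)
      also have "\<dots> = (\<integral>\<^sup>+x. ennreal (D x) * indicator {0..<1} x \<partial>lebesgue01)"
        using D(1) sets.top[of lebesgue01] by (intro emeasure_density) (auto simp: space_lebesgue01)
      also have "\<dots> = (\<integral>\<^sup>+x. ennreal (D x) \<partial>lebesgue01)"
        by (intro nn_integral_cong) (auto simp: space_lebesgue01)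
      finally show ?thesis by (simp add: sp)
    qed
    then have "(\<integral>\<^sup>+x. ennreal (D x) \<partial>lebesgue01) = 1" using M.emeasure_space_1 by simp
    then show "integrable lebesgue01 D" "(LINT x|lebesgue01. D x) = 1"
      using D by (auto simp: integrable_iff_bounded integral_eq_nn_integral)
  qed
  fix A assume "A \<in> sets M"
  then have A: "A \<in> sets lebesgue01" "A \<in> sets M" using s by auto
  have inv: "invariant_measure M (T_seq bs ^^ n)" for n
    using M by (intro invariant_measure_funpow) (simp add: is_acip_def)
  \<comment> \<open>The left side is the \<open>M\<close>-measure of the preimage of
    \<open>A\<close> under the \<open>n\<close>-th iterate.\<close>
  have "(LINT x|lebesgue01. indicator A ((T_seq bs ^^ n) x) * D x) = measure M A" for n
  proof -
    let ?B = "(T_seq bs ^^ n) -` A \<inter> {0..<1}"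
    have B: "?B \<in> sets lebesgue01"
      using measurable_sets[OF measurable_T_seq[of "concat (replicate n bs)"] A(1)] by (simp add: space_lebesgue01 T_seq_concat_replicate)
    have "(LINT x|lebesgue01. indicator A ((T_seq bs ^^ n) x) * D x) = (LINT x|lebesgue01. D x * indicator ?B x)"
      by (intro Bochner_Integration.integral_cong) (auto simp: space_lebesgue01 indicator_def)
    also have "\<dots> = enn2real (\<integral>\<^sup>+x. ennreal (D x) * indicator ?B x \<partial>lebesgue01)"
      using D(3) by (subst integral_eq_nn_integral[OF borel_measurable_times[OF D(1) borel_measurable_indicator[OF B]]])
        (auto intro!: arg_cong[of _ _ enn2real] nn_integral_cong simp: indicator_def)
    also have "\<dots> = measure (density lebesgue01 (\<lambda>x. ennreal (D x))) ?B"
      unfolding measure_def using D B by (subst emeasure_density) auto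
    also have "\<dots> = measure M ?B" using MD by simp
    also have "\<dots> = measure M A"
      using inv[of n] A unfolding invariant_measure_def measure_def by (simp add: sp)
    finally show ?thesis .
  qed
  then have "(\<lambda>n. measure M A) \<longlonglongrightarrow> measure acip A" using mixing[OF mD(1) A(1)] mD(2) by simp
  then have "measure M A = measure acip A" using LIMSEQ_unique tendsto_const by blast
  then show "emeasure M A = emeasure acip A"
    using finite_measure.emeasure_eq_measure[of M A] finite_measure.emeasure_eq_measure[of acip A]
      M.finite_measure_axioms prob_space.axioms(1)[OF prob_space_acip] by simp
qed

text \<open>Mixing is tested with the indicator of the complement. Its orbits never enter
  \<open>A\<close>, so the product of \<open>acip A\<close> and the Lebesgue measure of the
  complement is 0.\<close>

lemma acip_invariant_set:
  assumes A: "A \<in> sets lebesgue01" and inv: "T_seq bs -` A \<inter> {0..<1} = A"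
  shows "measure acip A \<in> {0, 1}"
proof -
  interpret prob_space acip by (rule prob_space_acip)
  have A': "A \<in> sets borel" "A \<subseteq> {0..<1}" using A by (auto simp: sets_restrict_space_iff)
  have n: "(T_seq bs ^^ n) x \<in> A \<longleftrightarrow> x \<in> A" if "x \<in> {0..<1}" for n x
    using that
  proof (induction n arbitrary: x)
    case (Suc n)
    have "T_seq bs x \<in> {0..<1}"
      using measurable_space[OF measurable_T_seq, of x bs] Suc.prems by (simp add: space_lebesgue01)
    then show ?case using Suc inv by (auto simp: funpow_Suc_right simp del: funpow.simps)
  qed simp
  let ?f = "indicator ({0..<1} - A) :: real \<Rightarrow> real"
  have B: "{0..<1} - A \<in> sets lebesgue01" using sets.compl_sets[OF A] by (simp add: space_lebesgue01)
  have "(LINT x|lebesgue01. indicator A ((T_seq bs ^^ n) x) * ?f x) = (LINT x|lebesgue01. 0)" for n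
    using n by (intro Bochner_Integration.integral_cong) (auto simp: space_lebesgue01 indicator_def)
  moreover have "integrable lebesgue01 ?f"
    using A' by (intro integrable_lebesgue01[where C = 1]) (auto simp: indicator_def)
  ultimately have "(\<lambda>n. 0) \<longlonglongrightarrow> measure acip A * (LINT x|lebesgue01. ?f x)"
    using mixing[OF _ A, of ?f] by simp
  then have "measure acip A * (LINT x|lebesgue01. ?f x) = 0"
    using LIMSEQ_unique tendsto_const by metis
  moreover have "(LINT x|lebesgue01. ?f x) = measure lebesgue01 ({0..<1} - A)"
    by (subst Bochner_Integration.integral_indicator) (auto simp: space_lebesgue01 intro!: arg_cong[of _ _ "measure lebesgue01"])
  moreover have "measure acip A = 1" if z: "measure lebesgue01 ({0..<1} - A) = 0"
  proof -
    interpret L: prob_space lebesgue01 by (rule prob_space_lebesgue01)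
    have "emeasure acip ({0..<1} - A) \<le> ennreal bound * emeasure lebesgue01 ({0..<1} - A)"
      by (rule emeasure_acip_le[OF B])
    then have "measure acip ({0..<1} - A) = 0"
      using z by (simp add: L.emeasure_eq_measure emeasure_eq_measure)
    then show ?thesis using prob_compl[of A] A by (simp add: space_lebesgue01)
  qed
  ultimately show ?thesis by auto
qed

end

lemma T_seq_acip:
  assumes "bs \<noteq> []" "\<And>b. b \<in> set bs \<Longrightarrow> 1 < b"
  obtains M e C where "is_acip lebesgue01 (T_seq bs) M"
    "\<And>N. is_acip lebesgue01 (T_seq bs) N \<Longrightarrow> N = M"
    "e > 0" "\<And>A. A \<in> sets lebesgue01 \<Longrightarrow> ennreal e * emeasure lebesgue01 A \<le> emeasure M A"
    "C > 0" "\<And>A. A \<in> sets lebesgue01 \<Longrightarrow> emeasure M A \<le> ennreal C * emeasure lebesgue01 A"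
    "\<And>A. A \<in> sets lebesgue01 \<Longrightarrow> T_seq bs -` A \<inter> {0..<1} = A \<Longrightarrow> measure M A \<in> {0, 1}"
proof -
  interpret expanding_seq bs using assms by unfold_locales
  obtain e where e: "e > 0" "\<And>A. A \<in> sets lebesgue01 \<Longrightarrow> ennreal e * emeasure lebesgue01 A \<le> emeasure acip A"
    using emeasure_acip_ge by blast
  have "bound > 0" using bound_ge by simp
  show ?thesis
    by (rule that[OF is_acip_acip acip_unique e \<open>bound > 0\<close> emeasure_acip_le acip_invariant_set])
qed

section \<open>The alternate base transformation\<close>

lemma sets_restrict_borel: "sets (restrict_space borel {0..<1::real}) = sets lebesgue01"
  by (simp add: sets_restrict_space)

lemma fibre_measurable: "A \<in> fibre_algebra p \<Longrightarrow> i < p \<Longrightarrow> Pair i -` A \<in> sets lebesgue01"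
  by (simp add: fibre_algebra_iff sets_restrict_borel)

lemma times_in_fibre_algebra:
  assumes "B \<in> sets lebesgue01" "I \<subseteq> {..<p}"
  shows "I \<times> B \<in> fibre_algebra p"
proof -
  have "Pair i -` (I \<times> B) = (if i \<in> I then B else {})" for i by auto
  moreover have "B \<subseteq> {0..<1}" using sets.sets_into_space[OF assms(1)] by (simp add: space_lebesgue01)
  ultimately show ?thesis using assms by (auto simp: fibre_algebra_iff sets_restrict_borel)
qed

lemma sets_p_lebesgue: "sets (p_lebesgue p) = fibre_algebra p"
  by (simp add: p_lebesgue_def sets_average_measure)

lemma emeasure_p_lebesgue:
  "A \<in> fibre_algebra p \<Longrightarrow> emeasure (p_lebesgue p) A = (\<Sum>i<p. emeasure lebesgue01 (Pair i -` A)) / of_nat p"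
  unfolding p_lebesgue_def by (subst emeasure_average_measure) (auto simp: sets_restrict_borel)

text \<open>Nonsingularity: the measure of the preimage is the integral of
  \<open>transfer b 1\<close> over \<open>A\<close>. It keeps push-forwards absolutely
  continuous.\<close>

lemma emeasure_T_single_vimage_null:
  assumes "b > 0" "A \<in> null_sets lebesgue01"
  shows "T_single b -` A \<inter> {0..<1} \<in> null_sets lebesgue01"
proof (rule null_setsI)
  have A: "A \<in> sets lebesgue01" using assms(2) by auto
  then have A': "A \<in> sets borel" by (auto simp: sets_restrict_space_iff)
  show m: "T_single b -` A \<inter> {0..<1} \<in> sets lebesgue01"
    using measurable_sets[OF measurable_T_single[of b] A] by (simp add: space_lebesgue01)
  have "emeasure lebesgue01 (T_single b -` A \<inter> {0..<1}) = (\<integral>\<^sup>+x. indicator (T_single b -` A \<inter> {0..<1}) x \<partial>lebesgue01)"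
    using m by simp
  also have "\<dots> = (\<integral>\<^sup>+x. indicator A (T_single b x) * ennreal 1 \<partial>lebesgue01)"
    by (intro nn_integral_cong) (auto simp: space_lebesgue01 indicator_def)
  also have "\<dots> = (\<integral>\<^sup>+x. indicator A x * ennreal (transfer b (\<lambda>_. 1) x) \<partial>lebesgue01)"
    using A' by (intro nn_integral_T_single assms(1)) auto
  also have "\<dots> = (\<integral>\<^sup>+x. 0 \<partial>lebesgue01)"
    using AE_not_in[OF assms(2)] by (intro nn_integral_cong_AE) (auto simp: indicator_def)
  finally show "emeasure lebesgue01 (T_single b -` A \<inter> {0..<1}) = 0" by simp
qed

locale alternate_base =
  fixes p :: nat and \<beta> :: "nat \<Rightarrow> real"
  assumes p: "p \<ge> 1" and gt_1: "\<And>i. i < p \<Longrightarrow> \<beta> i > 1"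
begin

abbreviation T :: "nat \<times> real \<Rightarrow> nat \<times> real" where
  "T \<equiv> T_alt p \<beta>"

abbreviation X :: "(nat \<times> real) set" where
  "X \<equiv> {..<p} \<times> {0..<1}"

text \<open>The bases met in \<open>n\<close> steps from fibre \<open>i\<close>, latest first as
  \<open>T_seq\<close> requires: \<open>k = 1\<close> is the last step, with base index
  \<open>i + n - 1\<close>, and \<open>k = n\<close> the first, with index \<open>i\<close>.\<close>

definition digits :: "nat \<Rightarrow> nat \<Rightarrow> real list" where
  "digits i n = map (\<lambda>k. periodic_base p \<beta> (int i + int n - int k)) [1..<Suc n]"

lemma periodic_base_gt_1: "periodic_base p \<beta> k > 1"
proof -
  have "nat (k mod int p) < p" using p by (simp add: nat_less_iff)
  then show ?thesis by (simp add: periodic_base_def gt_1)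
qed

lemma periodic_base_int: "periodic_base p \<beta> (int i) = \<beta> (i mod p)"
  by (simp add: periodic_base_def zmod_int[symmetric])

text \<open>The indices differ by \<open>p\<close>, which \<open>periodic_base\<close> does not
  see.\<close>

lemma T_cycle_eq: "T_cycle p \<beta> i = T_seq (digits i p)"
proof -
  have "periodic_base p \<beta> (int i + int p - k) = periodic_base p \<beta> (int i - k)" for k
  proof -
    have "(int i + int p - k) mod int p = (int i - k) mod int p"
      by (metis add_diff_eq add.commute diff_add_eq mod_add_self2)
    then show ?thesis by (simp add: periodic_base_def)
  qed
  then show ?thesis by (simp add: T_cycle_def T_seq_def digits_def comp_def)
qed

lemma digits_Suc: "digits i (Suc n) = \<beta> ((i + n) mod p) # digits i n"
proof -
  have "[1..<Suc (Suc n)] = 1 # map Suc [1..<Suc n]"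
    by (simp add: upt_conv_Cons map_Suc_upt del: upt_Suc)
  then show ?thesis
    using periodic_base_int[of "i + n"] by (simp add: digits_def o_def algebra_simps del: upt_Suc)
qed

lemma T_funpow: "(T ^^ n) (i, x) = ((i + n) mod p, T_seq (digits i n) x)" if "i < p"
proof (induction n)
  case 0 then show ?case using that by (simp add: digits_def)
next
  case (Suc n)
  then show ?case by (simp add: T_alt_def digits_Suc mod_Suc_eq)
qed

lemma T_funpow_p: "(T ^^ p) (i, x) = (i, T_cycle p \<beta> i x)" if "i < p"
  using T_funpow[OF that, of p x] that by (simp add: T_cycle_eq)

lemma T_in_X: "z \<in> X \<Longrightarrow> T z \<in> X"
  using p T_single_bounds by (auto simp: T_alt_def split: prod.splits simp del: atLeastLessThan_iff)

text \<open>Both sides are the second coordinate of the iterate \<open>p + 1\<close> of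
  \<open>T\<close> at \<open>(i, x)\<close>.\<close>

lemma T_cycle_commute:
  assumes "i < p"
  shows "T_cycle p \<beta> ((i + 1) mod p) (T_single (\<beta> i) x) = T_single (\<beta> i) (T_cycle p \<beta> i x)"
proof -
  have "(T ^^ p) (T (i, x)) = T ((T ^^ p) (i, x))"
    by (simp add: funpow_swap1)
  moreover have "(i + 1) mod p < p" using p by simp
  ultimately show ?thesis
    using assms T_funpow_p by (simp add: T_alt_def)
qed

lemma measurable_T_cycle: "T_cycle p \<beta> i \<in> measurable lebesgue01 lebesgue01"
  unfolding T_cycle_eq by measurable

text \<open>Existence and uniqueness turn the \<open>THE\<close> in \<open>mu_fibre\<close> into an
  actual measure that inherits what was shown for the list \<open>digits i p\<close>.\<close>

lemma mu_fibre:
  shows is_acip_mu_fibre: "is_acip lebesgue01 (T_cycle p \<beta> i) (mu_fibre p \<beta> i)"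
    and mu_fibre_unique: "is_acip lebesgue01 (T_cycle p \<beta> i) N \<Longrightarrow> N = mu_fibre p \<beta> i"
    and mu_fibre_ge: "\<exists>e>0. \<forall>A\<in>sets lebesgue01. ennreal e * emeasure lebesgue01 A \<le> emeasure (mu_fibre p \<beta> i) A"
    and mu_fibre_le: "\<exists>C>0. \<forall>A\<in>sets lebesgue01. emeasure (mu_fibre p \<beta> i) A \<le> ennreal C * emeasure lebesgue01 A"
    and mu_fibre_ergodic: "A \<in> sets lebesgue01 \<Longrightarrow> T_cycle p \<beta> i -` A \<inter> {0..<1} = A \<Longrightarrow> measure (mu_fibre p \<beta> i) A \<in> {0, 1}"
proof -
  have ne: "digits i p \<noteq> []" and gt: "\<And>b. b \<in> set (digits i p) \<Longrightarrow> 1 < b"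
    using p periodic_base_gt_1 by (auto simp: digits_def)
  obtain M e C where M: "is_acip lebesgue01 (T_seq (digits i p)) M"
    "\<And>N. is_acip lebesgue01 (T_seq (digits i p)) N \<Longrightarrow> N = M"
    "e > 0" "\<And>A. A \<in> sets lebesgue01 \<Longrightarrow> ennreal e * emeasure lebesgue01 A \<le> emeasure M A"
    "C > 0" "\<And>A. A \<in> sets lebesgue01 \<Longrightarrow> emeasure M A \<le> ennreal C * emeasure lebesgue01 A"
    "\<And>A. A \<in> sets lebesgue01 \<Longrightarrow> T_seq (digits i p) -` A \<inter> {0..<1} = A \<Longrightarrow> measure M A \<in> {0, 1}"
    by (rule T_seq_acip[of "digits i p"]) (rule ne, erule gt, (rule that; assumption))
  have eq: "mu_fibre p \<beta> i = M"
    unfolding mu_fibre_def T_cycle_eq using M(1,2) by (rule the_equality)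
  show "is_acip lebesgue01 (T_cycle p \<beta> i) (mu_fibre p \<beta> i)"
    unfolding eq T_cycle_eq by (rule M(1))
  show "is_acip lebesgue01 (T_cycle p \<beta> i) N \<Longrightarrow> N = mu_fibre p \<beta> i"
    unfolding eq T_cycle_eq by (rule M(2))
  show "\<exists>e>0. \<forall>A\<in>sets lebesgue01. ennreal e * emeasure lebesgue01 A \<le> emeasure (mu_fibre p \<beta> i) A"
    unfolding eq using M(3,4) by blast
  show "\<exists>C>0. \<forall>A\<in>sets lebesgue01. emeasure (mu_fibre p \<beta> i) A \<le> ennreal C * emeasure lebesgue01 A"
    unfolding eq using M(5,6) by blast
  show "A \<in> sets lebesgue01 \<Longrightarrow> T_cycle p \<beta> i -` A \<inter> {0..<1} = A \<Longrightarrow> measure (mu_fibre p \<beta> i) A \<in> {0, 1}"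
    unfolding eq T_cycle_eq by (rule M(7))
qed

lemma sets_mu_fibre: "sets (mu_fibre p \<beta> i) = sets lebesgue01"
  using is_acip_mu_fibre by (simp add: is_acip_def)

lemma space_mu_fibre: "space (mu_fibre p \<beta> i) = {0..<1}"
  using sets_eq_imp_space_eq[OF sets_mu_fibre] by (simp add: space_lebesgue01)

lemma prob_space_mu_fibre: "prob_space (mu_fibre p \<beta> i)"
  using is_acip_mu_fibre by (simp add: is_acip_def)

text \<open>By the commutation relation the push-forward is invariant under the next return map, and
  nonsingularity keeps it absolutely continuous; uniqueness identifies it.\<close>

lemma mu_fibre_step:
  assumes i: "i < p"
  shows "mu_fibre p \<beta> ((i + 1) mod p) = distr (mu_fibre p \<beta> i) lebesgue01 (T_single (\<beta> i))"
proof (rule mu_fibre_unique[symmetric])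
  let ?N = "distr (mu_fibre p \<beta> i) lebesgue01 (T_single (\<beta> i))" and ?S = "T_cycle p \<beta> i" and ?S' = "T_cycle p \<beta> ((i + 1) mod p)"
  interpret prob_space "mu_fibre p \<beta> i" by (rule prob_space_mu_fibre)
  note sets_mu_fibre [measurable_cong]
  have T: "T_single (\<beta> i) \<in> measurable (mu_fibre p \<beta> i) lebesgue01" by measurable
  have ac: "absolutely_continuous lebesgue01 (mu_fibre p \<beta> i)" and inv: "invariant_measure (mu_fibre p \<beta> i) ?S"
    using is_acip_mu_fibre by (auto simp: is_acip_def)
  have inv': "emeasure (mu_fibre p \<beta> i) (?S -` B \<inter> {0..<1}) = emeasure (mu_fibre p \<beta> i) B" if "B \<in> sets lebesgue01" for B
    using inv that unfolding invariant_measure_def by (simp add: space_mu_fibre sets_mu_fibre)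
  show "is_acip lebesgue01 ?S' ?N"
    unfolding is_acip_def invariant_measure_def
  proof (intro conjI ballI)
    show "sets ?N = sets lebesgue01" by simp
    show "prob_space ?N" using T by (rule prob_space_distr)
    show "absolutely_continuous lebesgue01 ?N"
      unfolding absolutely_continuous_def
    proof
      fix A assume A: "A \<in> null_sets lebesgue01"
      then have "T_single (\<beta> i) -` A \<inter> {0..<1} \<in> null_sets (mu_fibre p \<beta> i)"
        using emeasure_T_single_vimage_null[OF _ A, of "\<beta> i"] gt_1[OF i] ac by (auto simp: absolutely_continuous_def)
      then show "A \<in> null_sets ?N" using A T
        by (auto simp: null_sets_def emeasure_distr space_mu_fibre)
    qed
    show "?S' \<in> measurable ?N ?N" using measurable_T_cycle by simp
    fix B assume "B \<in> sets ?N"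
    then have B: "B \<in> sets lebesgue01" by simp
    have TB: "T_single (\<beta> i) -` B \<inter> {0..<1} \<in> sets lebesgue01"
      using measurable_sets[OF T B] by (simp add: space_mu_fibre sets_mu_fibre)
    have SB: "?S' -` B \<inter> {0..<1} \<in> sets lebesgue01"
      using measurable_sets[OF measurable_T_cycle B] by (simp add: space_lebesgue01)
    have "emeasure ?N (?S' -` B \<inter> space ?N) = emeasure (mu_fibre p \<beta> i) (T_single (\<beta> i) -` (?S' -` B \<inter> {0..<1}) \<inter> {0..<1})"
      using SB T by (simp add: space_lebesgue01 emeasure_distr space_mu_fibre)
    also have "T_single (\<beta> i) -` (?S' -` B \<inter> {0..<1}) \<inter> {0..<1} = ?S -` (T_single (\<beta> i) -` B \<inter> {0..<1}) \<inter> {0..<1}"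
    proof -
      have "?S x \<in> {0..<1}" if "x \<in> {0..<1}" for x
        using measurable_space[OF measurable_T_cycle, of x i] that by (simp add: space_lebesgue01)
      then show ?thesis
        using T_cycle_commute[OF i] T_single_bounds[of "\<beta> i"] by (auto simp del: atLeastLessThan_iff)
    qed
    also have "emeasure (mu_fibre p \<beta> i) \<dots> = emeasure (mu_fibre p \<beta> i) (T_single (\<beta> i) -` B \<inter> {0..<1})"
      by (rule inv'[OF TB])
    also have "\<dots> = emeasure ?N B" using B T by (simp add: emeasure_distr space_mu_fibre)
    finally show "emeasure ?N (?S' -` B \<inter> space ?N) = emeasure ?N B" .
  qed
qed

lemma emeasure_mu_fibre_step:
  assumes "i < p" "B \<in> sets lebesgue01"
  shows "emeasure (mu_fibre p \<beta> ((i + 1) mod p)) B = emeasure (mu_fibre p \<beta> i) (T_single (\<beta> i) -` B \<inter> {0..<1})"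
proof -
  note sets_mu_fibre [measurable_cong]
  have "T_single (\<beta> i) \<in> measurable (mu_fibre p \<beta> i) lebesgue01" by measurable
  then show ?thesis unfolding mu_fibre_step[OF assms(1)] using assms(2) by (simp add: emeasure_distr space_mu_fibre)
qed

section \<open>The averaged measure: equivalence with \<open>p_lebesgue\<close> and
  invariance\<close>

lemma fibre_T_vimage:
  assumes "i < p"
  shows "Pair i -` (T -` A \<inter> X) = T_single (\<beta> i) -` (Pair ((i + 1) mod p) -` A) \<inter> {0..<1}"
  using assms by (auto simp: T_alt_def)

lemma T_vimage_in_fibre_algebra:
  assumes A: "A \<in> fibre_algebra p"
  shows "T -` A \<inter> X \<in> fibre_algebra p"
  unfolding fibre_algebra_iff
proof (intro conjI allI impI)
  fix i assume i: "i < p"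
  have "(i + 1) mod p < p" using p by simp
  from measurable_sets[OF measurable_T_single[of "\<beta> i"] fibre_measurable[OF A this]]
  show "Pair i -` (T -` A \<inter> X) \<in> sets (restrict_space borel {0..<1})"
    unfolding fibre_T_vimage[OF i] sets_restrict_borel by (simp add: space_lebesgue01)
qed auto

lemma measurable_T_alt: "T \<in> measurable M M" if "sets M = fibre_algebra p" "space M = X"
  using that T_in_X T_vimage_in_fibre_algebra by (intro measurableI) auto

lemma emeasure_mu_alt:
  "A \<in> fibre_algebra p \<Longrightarrow> emeasure (mu_alt p \<beta>) A = (\<Sum>i<p. emeasure (mu_fibre p \<beta> i) (Pair i -` A)) / of_nat p"
  unfolding mu_alt_def by (rule emeasure_average_measure) (auto simp: sets_mu_fibre sets_restrict_borel)

lemma space_mu_alt: "space (mu_alt p \<beta>) = X"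
  by (simp add: mu_alt_def space_average_measure)

lemma sets_mu_alt: "sets (mu_alt p \<beta>) = fibre_algebra p"
  by (simp add: mu_alt_def sets_average_measure)

lemma sum_rotate: "(\<Sum>i<p. f ((i + 1) mod p)) = (\<Sum>i<p. f i :: 'a :: comm_monoid_add)"
proof -
  obtain q where q: "p = Suc q" using p by (cases p) auto
  have "(\<Sum>i<p. f ((i + 1) mod p)) = (\<Sum>i<q. f (Suc i)) + f 0"
    unfolding q by simp
  also have "\<dots> = (\<Sum>i<p. f i)"
    unfolding q by (subst sum.lessThan_Suc_shift) (simp add: add.commute)
  finally show ?thesis .
qed

lemma of_nat_p_ennreal: "of_nat p \<noteq> (0 :: ennreal)" "of_nat p \<noteq> (top :: ennreal)"
    "of_nat p / of_nat p = (1 :: ennreal)"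
  using p by (auto simp: ennreal_of_nat_eq_real_of_nat intro!: ennreal_divide_self)

lemma mult_p_divide_p: "of_nat p * x / of_nat p = (x :: ennreal)"
  by (subst mult.commute) (rule ennreal_mult_divide_eq[OF of_nat_p_ennreal(1,2)])

lemma prob_space_mu_alt: "prob_space (mu_alt p \<beta>)"
proof (rule prob_spaceI)
  have "Pair i -` X = {0..<1}" if "i < p" for i using that by auto
  moreover have "emeasure (mu_fibre p \<beta> i) {0..<1} = 1" for i
    using prob_space.emeasure_space_1[OF prob_space_mu_fibre] by (simp add: space_mu_fibre)
  moreover have "X \<in> fibre_algebra p" using sets.top[of "mu_alt p \<beta>"] by (simp add: space_mu_alt sets_mu_alt)
  ultimately show "emeasure (mu_alt p \<beta>) (space (mu_alt p \<beta>)) = 1"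
    using of_nat_p_ennreal(3) by (simp add: space_mu_alt emeasure_mu_alt)
qed

text \<open>A constant, beyond absolute continuity, is wanted because the lower entropy bound and
  the approximation of partitions need explicit measure estimates. The sum of the fibre constants
  dominates each of them.\<close>

lemma mu_alt_le: "\<exists>C>0. \<forall>A\<in>fibre_algebra p. emeasure (mu_alt p \<beta>) A \<le> ennreal C * emeasure (p_lebesgue p) A"
proof -
  obtain c where c: "\<And>i. c i > 0" "\<And>i A. A \<in> sets lebesgue01 \<Longrightarrow> emeasure (mu_fibre p \<beta> i) A \<le> ennreal (c i) * emeasure lebesgue01 A"
    using mu_fibre_le by metis
  define C where "C = (\<Sum>i<p. c i)"
  have C: "c i \<le> C" if "i < p" for i unfolding C_def using c(1) that by (intro member_le_sum) (auto intro: less_imp_le)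
  have "C > 0" using C[of 0] c(1)[of 0] p by auto
  moreover have "emeasure (mu_alt p \<beta>) A \<le> ennreal C * emeasure (p_lebesgue p) A" if A: "A \<in> fibre_algebra p" for A
  proof -
    have "emeasure (mu_fibre p \<beta> i) (Pair i -` A) \<le> ennreal C * emeasure lebesgue01 (Pair i -` A)" if "i < p" for i
      using order_trans[OF c(2)[OF fibre_measurable[OF A that], of i] mult_right_mono[OF ennreal_leI[OF C[OF that]]]] by simp
    then have "(\<Sum>i<p. emeasure (mu_fibre p \<beta> i) (Pair i -` A)) \<le> ennreal C * (\<Sum>i<p. emeasure lebesgue01 (Pair i -` A))"
      unfolding sum_distrib_left by (intro sum_mono) auto
    then show ?thesis
      unfolding emeasure_mu_alt[OF A] emeasure_p_lebesgue[OF A] ennreal_times_divide by (rule divide_right_mono_ennreal)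
  qed
  ultimately show ?thesis by blast
qed

lemma mu_alt_ge: "\<exists>e>0. \<forall>A\<in>fibre_algebra p. ennreal e * emeasure (p_lebesgue p) A \<le> emeasure (mu_alt p \<beta>) A"
proof -
  obtain c where c: "\<And>i. c i > 0" "\<And>i A. A \<in> sets lebesgue01 \<Longrightarrow> ennreal (c i) * emeasure lebesgue01 A \<le> emeasure (mu_fibre p \<beta> i) A"
    using mu_fibre_ge by metis
  define e where "e = Min (c ` {..<p})"
  have ne: "c ` {..<p} \<noteq> {}" using p by (auto simp: lessThan_empty_iff)
  have e: "e \<le> c i" if "i < p" for i unfolding e_def using that by (intro Min_le) auto
  have "e > 0" unfolding e_def using c(1) ne by (subst Min_gr_iff) auto
  moreover have "ennreal e * emeasure (p_lebesgue p) A \<le> emeasure (mu_alt p \<beta>) A" if A: "A \<in> fibre_algebra p" for A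
  proof -
    have "ennreal e * emeasure lebesgue01 (Pair i -` A) \<le> emeasure (mu_fibre p \<beta> i) (Pair i -` A)" if "i < p" for i
      using order_trans[OF mult_right_mono[OF ennreal_leI[OF e[OF that]]] c(2)[OF fibre_measurable[OF A that], of i]] by simp
    then have "ennreal e * (\<Sum>i<p. emeasure lebesgue01 (Pair i -` A)) \<le> (\<Sum>i<p. emeasure (mu_fibre p \<beta> i) (Pair i -` A))"
      unfolding sum_distrib_left by (intro sum_mono) auto
    then show ?thesis
      unfolding emeasure_mu_alt[OF A] emeasure_p_lebesgue[OF A] ennreal_times_divide by (rule divide_right_mono_ennreal)
  qed
  ultimately show ?thesis by blast
qed

lemma null_sets_mu_alt: "null_sets (mu_alt p \<beta>) = null_sets (p_lebesgue p)"
proof -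
  obtain C where C: "\<And>A. A \<in> fibre_algebra p \<Longrightarrow> emeasure (mu_alt p \<beta>) A \<le> ennreal C * emeasure (p_lebesgue p) A"
    using mu_alt_le by blast
  obtain e where e: "e > 0" "\<And>A. A \<in> fibre_algebra p \<Longrightarrow> ennreal e * emeasure (p_lebesgue p) A \<le> emeasure (mu_alt p \<beta>) A"
    using mu_alt_ge by blast
  have "emeasure (mu_alt p \<beta>) A = 0 \<longleftrightarrow> emeasure (p_lebesgue p) A = 0" if "A \<in> fibre_algebra p" for A
    using C[OF that] e(1) e(2)[OF that] by auto
  then show ?thesis by (auto simp: null_sets_def sets_mu_alt sets_p_lebesgue)
qed

lemma equivalent_mu_alt: "equivalent_measures (mu_alt p \<beta>) (p_lebesgue p)"
  by (simp add: equivalent_measures_def absolutely_continuous_def null_sets_mu_alt sets_mu_alt sets_p_lebesgue)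

text \<open>By \<open>mu_fibre_step\<close>, taking preimages under \<open>T\<close> only permutes
  the summands of the average cyclically.\<close>

lemma is_acip_mu_alt: "is_acip (p_lebesgue p) T (mu_alt p \<beta>)"
  unfolding is_acip_def invariant_measure_def
proof (intro conjI ballI)
  show "sets (mu_alt p \<beta>) = sets (p_lebesgue p)" by (simp add: sets_mu_alt sets_p_lebesgue)
  show "prob_space (mu_alt p \<beta>)" by (rule prob_space_mu_alt)
  show "absolutely_continuous (p_lebesgue p) (mu_alt p \<beta>)"
    by (simp add: absolutely_continuous_def null_sets_mu_alt)
  show "T \<in> measurable (mu_alt p \<beta>) (mu_alt p \<beta>)"
    by (intro measurable_T_alt sets_mu_alt space_mu_alt)
  fix B assume "B \<in> sets (mu_alt p \<beta>)"
  then have B: "B \<in> fibre_algebra p" by (simp add: sets_mu_alt)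
  have "(\<Sum>i<p. emeasure (mu_fibre p \<beta> i) (Pair i -` (T -` B \<inter> X)))
      = (\<Sum>i<p. emeasure (mu_fibre p \<beta> ((i + 1) mod p)) (Pair ((i + 1) mod p) -` B))"
  proof (rule sum.cong[OF refl])
    fix i assume "i \<in> {..<p}"
    then have i: "i < p" "(i + 1) mod p < p" using p by auto
    show "emeasure (mu_fibre p \<beta> i) (Pair i -` (T -` B \<inter> X)) = emeasure (mu_fibre p \<beta> ((i + 1) mod p)) (Pair ((i + 1) mod p) -` B)"
      unfolding emeasure_mu_fibre_step[OF i(1) fibre_measurable[OF B i(2)]] fibre_T_vimage[OF i(1)] ..
  qed
  also have "\<dots> = (\<Sum>i<p. emeasure (mu_fibre p \<beta> i) (Pair i -` B))"
    by (rule sum_rotate)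
  finally show "emeasure (mu_alt p \<beta>) (T -` B \<inter> space (mu_alt p \<beta>)) = emeasure (mu_alt p \<beta>) B"
    by (simp add: space_mu_alt emeasure_mu_alt[OF B] emeasure_mu_alt[OF T_vimage_in_fibre_algebra[OF B]])
qed

section \<open>Uniqueness and ergodicity on all fibres together\<close>

lemma T_funpow_vimage_p:
  assumes "i < p"
  shows "(T ^^ p) -` ({i} \<times> B) \<inter> X = {i} \<times> (T_cycle p \<beta> i -` B \<inter> {0..<1})"
  using assms T_funpow_p by auto

text \<open>An invariant measure gives every fibre the mass \<open>1 / p\<close>, and its iterate
  \<open>p\<close> maps each fibre to itself by \<open>T_cycle\<close>. So \<open>p\<close> times
  the restriction to a fibre is a competitor for \<open>mu_fibre\<close>.\<close>

lemma mu_alt_unique: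
  assumes M: "is_acip (p_lebesgue p) T M"
  shows "M = mu_alt p \<beta>"
proof (rule measure_eqI)
  have sM: "sets M = fibre_algebra p" using M by (simp add: is_acip_def sets_p_lebesgue)
  then show "sets M = sets (mu_alt p \<beta>)" by (simp add: sets_mu_alt)
  have spM: "space M = X" using sets_eq_imp_space_eq[of M "mu_alt p \<beta>"] sM by (simp add: sets_mu_alt space_mu_alt)
  interpret M: prob_space M using M by (simp add: is_acip_def)
  have inv: "emeasure M (T -` A \<inter> X) = emeasure M A" if "A \<in> fibre_algebra p" for A
    using M that unfolding is_acip_def invariant_measure_def by (simp add: spM sM)
  have invp: "emeasure M ((T ^^ p) -` A \<inter> X) = emeasure M A" if "A \<in> fibre_algebra p" for A
    using invariant_measure_funpow[of M T p] M that unfolding is_acip_def by (auto simp: spM sM invariant_measure_def)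
  have fib: "{i} \<times> B \<in> fibre_algebra p" if "i < p" "B \<in> sets lebesgue01" for i B
    using that by (intro times_in_fibre_algebra) auto
  have U: "{0..<1} \<in> sets lebesgue01" using sets.top[of lebesgue01] by (simp add: space_lebesgue01)
  have split: "emeasure M A = (\<Sum>i<p. emeasure M ({i} \<times> (Pair i -` A)))" if A: "A \<in> fibre_algebra p" for A
  proof -
    have "A = (\<Union>i\<in>{..<p}. {i} \<times> (Pair i -` A))" using A by (auto simp: fibre_algebra_iff)
    also have "emeasure M \<dots> = (\<Sum>i<p. emeasure M ({i} \<times> (Pair i -` A)))"
      using fib fibre_measurable[OF A] sM by (intro sum_emeasure[symmetric]) (auto simp: disjoint_family_on_def)
    finally show ?thesis .
  qed
  \<comment> \<open>The preimage of a whole fibre is exactly the preceding fibre, so all fibres have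
    equal mass.\<close>
  have mass: "of_nat p * emeasure M ({i} \<times> {0..<1}) = 1" if i: "i < p" for i
  proof -
    have step: "emeasure M ({(i + 1) mod p} \<times> {0..<1}) = emeasure M ({i} \<times> {0..<1})" if "i < p" for i
    proof -
      have j: "(i + 1) mod p < p" using p by simp
      have inj: "k = i" if "k < p" "(k + 1) mod p = (i + 1) mod p" for k
        using that \<open>i < p\<close> by (auto simp: mod_Suc split: if_splits)
      have "T -` ({(i + 1) mod p} \<times> {0..<1}) \<inter> X = {i} \<times> {0..<1}"
        using \<open>i < p\<close> inj T_single_bounds by (auto simp: T_alt_def simp del: One_nat_def)
      then show ?thesis using inv[OF fib[OF j U]] by simp
    qed
    have all: "emeasure M ({k} \<times> {0..<1}) = emeasure M ({0} \<times> {0..<1})" if "k < p" for k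
      using that
    proof (induction k)
      case (Suc k)
      then show ?case using step[of k] by (simp add: mod_less)
    qed simp
    have "1 = emeasure M X" using M.emeasure_space_1 by (simp add: spM)
    also have "\<dots> = (\<Sum>i<p. emeasure M ({i} \<times> (Pair i -` X)))"
      using sets.top[of M] by (intro split) (simp add: spM sM)
    also have "\<dots> = (\<Sum>k<p. emeasure M ({i} \<times> {0..<1}))"
    proof (rule sum.cong[OF refl])
      fix k assume "k \<in> {..<p}"
      then have "Pair k -` X = {0..<1}" "k < p" by auto
      then show "emeasure M ({k} \<times> (Pair k -` X)) = emeasure M ({i} \<times> {0..<1})"
        using all[of k] all[OF i] by simp
    qed
    finally show ?thesis by simp
  qed
  have fibre: "of_nat p * emeasure M ({i} \<times> B) = emeasure (mu_fibre p \<beta> i) B" if i: "i < p" and B: "B \<in> sets lebesgue01" for i B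
  proof -
    \<comment> \<open>\<open>D\<close> keeps only fibre \<open>i\<close>; \<open>N\<close> is its
      projection to \<open>[0,1)\<close>, rescaled by \<open>p\<close> to a probability
      measure.\<close>
    define D where "D = density M (indicator ({i} \<times> {0..<1}))"
    define N where "N = scale_measure (of_nat p) (distr D lebesgue01 snd)"
    have snd: "snd \<in> measurable D lebesgue01"
    proof (rule measurableI)
      show "snd x \<in> space lebesgue01" if "x \<in> space D" for x
        using that by (auto simp: D_def spM space_lebesgue01)
      fix B assume B: "B \<in> sets lebesgue01"
      then have "B \<subseteq> {0..<1}" using sets.sets_into_space[OF B] by (simp add: space_lebesgue01)
      then have "snd -` B \<inter> X = {..<p} \<times> B" by auto
      then show "snd -` B \<inter> space D \<in> sets D"
        using times_in_fibre_algebra[OF B, of "{..<p}"] by (simp add: D_def spM sM)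
    qed
    have N: "emeasure N B = of_nat p * emeasure M ({i} \<times> B)" if B: "B \<in> sets lebesgue01" for B
    proof -
      have "emeasure D (snd -` B \<inter> space D) = emeasure M (({i} \<times> {0..<1}) \<inter> (snd -` B \<inter> space D))"
        unfolding D_def using fib[OF i U] measurable_sets[OF snd B] by (intro emeasure_restricted) (auto simp: sM D_def)
      also have "({i} \<times> {0..<1}) \<inter> (snd -` B \<inter> space D) = {i} \<times> B"
        using sets.sets_into_space[OF B] i by (auto simp: D_def spM space_lebesgue01)
      finally show ?thesis using B snd by (simp add: N_def emeasure_distr)
    qed
    have sN: "sets N = sets lebesgue01" "space N = {0..<1}" by (simp_all add: N_def space_scale_measure space_lebesgue01)
    have "is_acip lebesgue01 (T_cycle p \<beta> i) N"
      unfolding is_acip_def invariant_measure_def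
    proof (intro conjI ballI)
      show "sets N = sets lebesgue01" by (rule sN)
      show "prob_space N" by (rule prob_spaceI) (simp add: sN N U mass i)
      show "absolutely_continuous lebesgue01 N"
        unfolding absolutely_continuous_def
      proof
        fix A assume A: "A \<in> null_sets lebesgue01"
        then have A': "A \<in> sets lebesgue01" "emeasure lebesgue01 A = 0" by auto
        have "Pair k -` ({i} \<times> A) = (if k = i then A else {})" for k by auto
        then have "emeasure (p_lebesgue p) ({i} \<times> A) = 0"
          using fib[OF i A'(1)] A'(2) by (subst emeasure_p_lebesgue) (auto intro!: sum.neutral)
        then have "{i} \<times> A \<in> null_sets M"
          using M fib[OF i A'(1)] by (auto simp: is_acip_def absolutely_continuous_def null_sets_def sets_p_lebesgue)
        then show "A \<in> null_sets N" using N[OF A'(1)] A'(1) by (auto simp: null_sets_def sN)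
      qed
      show "T_cycle p \<beta> i \<in> measurable N N"
        using measurable_T_cycle measurable_cong_sets[OF sN(1) sN(1)] by blast
      fix B assume "B \<in> sets N"
      then have B: "B \<in> sets lebesgue01" by (simp add: sN)
      have "T_cycle p \<beta> i -` B \<inter> {0..<1} \<in> sets lebesgue01"
        using measurable_sets[OF measurable_T_cycle B] by (simp add: space_lebesgue01)
      then show "emeasure N (T_cycle p \<beta> i -` B \<inter> space N) = emeasure N B"
        using N[OF B] N[of "T_cycle p \<beta> i -` B \<inter> {0..<1}"] invp[OF fib[OF i B]] T_funpow_vimage_p[OF i, of B]
        by (simp add: sN)
    qed
    then have "N = mu_fibre p \<beta> i" by (rule mu_fibre_unique)
    then show ?thesis using N[OF B] by simp
  qed
  fix A assume "A \<in> sets M"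
  then have A: "A \<in> fibre_algebra p" by (simp add: sM)
  have "emeasure M A = (\<Sum>i<p. emeasure M ({i} \<times> (Pair i -` A)))" by (rule split[OF A])
  also have "\<dots> = (\<Sum>i<p. emeasure (mu_fibre p \<beta> i) (Pair i -` A) / of_nat p)"
  proof (rule sum.cong[OF refl])
    fix i assume "i \<in> {..<p}"
    then have i: "i < p" by simp
    show "emeasure M ({i} \<times> (Pair i -` A)) = emeasure (mu_fibre p \<beta> i) (Pair i -` A) / of_nat p"
      unfolding fibre[OF i fibre_measurable[OF A i], symmetric] mult_p_divide_p ..
  qed
  also have "\<dots> = emeasure (mu_alt p \<beta>) A"
    unfolding emeasure_mu_alt[OF A] by (simp add: divide_ennreal_def sum_distrib_right)
  finally show "emeasure M A = emeasure (mu_alt p \<beta>) A" .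
qed

text \<open>Each fibre of an invariant set is invariant under \<open>T_cycle\<close>, hence of
  measure 0 or 1; the one-step push-forward forces the same value on all fibres, so their average is
  0 or 1 too.\<close>

lemma ergodic_mu_alt: "ergodic (mu_alt p \<beta>) T"
  unfolding ergodic_def
proof (intro ballI impI)
  fix B assume "B \<in> sets (mu_alt p \<beta>)" and "T -` B \<inter> space (mu_alt p \<beta>) = B"
  then have B: "B \<in> fibre_algebra p" and inv: "T -` B \<inter> X = B" by (auto simp: sets_mu_alt space_mu_alt)
  have n: "z \<in> X \<Longrightarrow> (T ^^ n) z \<in> B \<longleftrightarrow> z \<in> B" for n z
  proof (induction n arbitrary: z)
    case (Suc n)
    then show ?case using inv T_in_X[OF Suc.prems] by (auto simp only: funpow_Suc_right o_apply)
  qed simp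
  have v: "measure (mu_fibre p \<beta> i) (Pair i -` B) \<in> {0, 1}" if i: "i < p" for i
  proof (rule mu_fibre_ergodic[OF fibre_measurable[OF B i]])
    have "Pair i -` B \<subseteq> {0..<1}" using B by (auto simp: fibre_algebra_iff)
    moreover have "T_cycle p \<beta> i x \<in> Pair i -` B \<longleftrightarrow> x \<in> Pair i -` B" if "x \<in> {0..<1}" for x
      using n[of "(i, x)" p] T_funpow_p[OF i, of x] i that by simp
    ultimately show "T_cycle p \<beta> i -` (Pair i -` B) \<inter> {0..<1} = Pair i -` B" by blast
  qed
  let ?m = "\<lambda>i. emeasure (mu_fibre p \<beta> i) (Pair i -` B)"
  have step: "?m ((i + 1) mod p) = ?m i" if i: "i < p" for i
  proof -
    have j: "(i + 1) mod p < p" using p by simp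
    have "T_single (\<beta> i) -` (Pair ((i + 1) mod p) -` B) \<inter> {0..<1} = Pair i -` B"
      using fibre_T_vimage[OF i, of B] inv by simp
    then show ?thesis using emeasure_mu_fibre_step[OF i fibre_measurable[OF B j]] by simp
  qed
  have all: "?m k = ?m 0" if "k < p" for k
    using that
  proof (induction k)
    case (Suc k)
    then show ?case using step[of k] by (simp add: mod_less)
  qed simp
  have "emeasure (mu_alt p \<beta>) B = (\<Sum>i<p. ?m 0) / of_nat p"
    unfolding emeasure_mu_alt[OF B] by (intro arg_cong2[of _ _ _ _ "(/)"] sum.cong all) auto
  also have "\<dots> = ?m 0"
    by (simp add: mult_p_divide_p)
  finally show "measure (mu_alt p \<beta>) B \<in> {0, 1}"
    using v[of 0] p by (simp add: measure_def)
qed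

end

section \<open>Entropy along itineraries\<close>

text \<open>Division with remainder, \<open>n = q * m + r\<close>. It makes the \<open>lim\<close>
  in \<open>entropy_wrt_partition\<close> a true limit, which may then be evaluated along multiples
  of \<open>p\<close>.\<close>

lemma fekete:
  fixes h :: "nat \<Rightarrow> real"
  assumes nn: "\<And>n. h n \<ge> 0" and sub: "\<And>m n. h (m + n) \<le> h m + h n"
  shows "convergent (\<lambda>n. h n / real n)"
proof -
  define L where "L = (INF n\<in>{0<..}. h n / real n)"
  have bdd: "bdd_below ((\<lambda>n. h n / real n) ` {0<..})"
    using nn by (intro bdd_belowI2[where m = 0]) auto
  have L: "L \<le> h n / real n" if "n > 0" for n
    unfolding L_def using bdd that by (intro cINF_lower) auto
  have mult: "h (q * m + r) \<le> real q * h m + h r" for q m r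
  proof (induction q)
    case (Suc q)
    have "h (Suc q * m + r) \<le> h m + h (q * m + r)" using sub[of m "q * m + r"] by (simp add: algebra_simps)
    then show ?case using Suc by (simp add: algebra_simps)
  qed simp
  have "(\<lambda>n. h n / real n) \<longlonglongrightarrow> L"
  proof (rule LIMSEQ_I)
    fix e :: real assume e: "e > 0"
    have "\<exists>m\<in>{0<..}. h m / real m < L + e / 2"
      using e bdd cINF_less_iff[of "{0<..}" "\<lambda>n. h n / real n" "L + e / 2"] by (auto simp: L_def)
    then obtain m where m: "m > 0" "h m / real m < L + e / 2" by auto
    \<comment> \<open>Bounds the remainder terms \<open>h r\<close> for all \<open>r < m\<close> at
      once.\<close>
    define C where "C = (\<Sum>r<m. h r)"
    have C: "h r \<le> C" if "r < m" for r unfolding C_def using that nn by (intro member_le_sum) auto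
    obtain N :: nat where N: "real N > 2 * C / e" using reals_Archimedean2 by blast
    have "\<bar>h n / real n - L\<bar> < e" if n: "n \<ge> Suc N" for n
    proof -
      have n0: "n > 0" using n by simp
      have "h n = h ((n div m) * m + n mod m)" by simp
      also have "\<dots> \<le> real (n div m) * h m + h (n mod m)" by (rule mult)
      also have "\<dots> \<le> (real n / real m) * h m + C"
        using C[of "n mod m"] m(1) nn by (intro add_mono mult_right_mono) (auto simp: of_nat_div_le_of_nat)
      finally have "h n / real n \<le> h m / real m + C / real n"
        using n0 m(1) by (simp add: field_simps)
      moreover have "C / real n < e / 2"
      proof -
        have "2 * C < e * real N" using N e by (simp add: field_simps)
        also have "e * real N \<le> e * real n" using n e by (intro mult_left_mono) auto
        finally show ?thesis using n0 by (simp add: field_simps)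
      qed
      ultimately show ?thesis using m(2) L[OF n0] by linarith
    qed
    then show "\<exists>no. \<forall>n\<ge>no. norm (h n / real n - L) < e" by auto
  qed
  then show ?thesis by (rule convergentI)
qed

text \<open>Shannon entropy of the law of \<open>f\<close>, in natural units. With functions in
  place of partitions, joins become pairs, and the information theory of random variables
  applies.\<close>

definition dist_entropy :: "'a measure \<Rightarrow> ('a \<Rightarrow> 'b) \<Rightarrow> real" where
  "dist_entropy M f = - (\<Sum>c\<in>f ` space M. measure M (f -` {c} \<inter> space M) * ln (measure M (f -` {c} \<inter> space M)))"

text \<open>\<open>restrict\<close> makes equality of itineraries mean agreement of the first
  \<open>n\<close> symbols and places them in the finite set
  \<open>{..<n} \<rightarrow>\<^sub>E P\<close> when the symbols lie in a finite
  \<open>P\<close>.\<close>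

definition itinerary :: "('a \<Rightarrow> 'a) \<Rightarrow> ('a \<Rightarrow> 'b) \<Rightarrow> nat \<Rightarrow> 'a \<Rightarrow> nat \<Rightarrow> 'b" where
  "itinerary T a n x = restrict (\<lambda>k. a ((T ^^ k) x)) {..<n}"

lemma itinerary_eq_iff: "itinerary T a n x = itinerary T a n y \<longleftrightarrow> (\<forall>k<n. a ((T ^^ k) x) = a ((T ^^ k) y))"
  unfolding itinerary_def restrict_def fun_eq_iff by auto

lemma itinerary_PiE:
  assumes "\<And>k. k < n \<Longrightarrow> a ((T ^^ k) x) \<in> P"
  shows "itinerary T a n x \<in> {..<n} \<rightarrow>\<^sub>E P"
  using assms by (auto simp: itinerary_def)

section \<open>Shannon entropy of finite-valued functions\<close>

context prob_space begin

lemma information_space_exp: "information_space M (exp 1)"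
  by unfold_locales auto

lemma dist_entropy_eq:
  assumes "simple_function M f"
  shows "dist_entropy M f = entropy (exp 1) (count_space (f ` space M)) f"
proof -
  interpret information_space M "exp 1" by (rule information_space_exp)
  show ?thesis
    unfolding dist_entropy_def entropy_simple_distributed[OF simple_distributedI[OF assms measure_nonneg refl]]
    by (simp add: log_def)
qed

lemma dist_entropy_Pair_le:
  assumes "simple_function M f" "simple_function M g"
  shows "dist_entropy M (\<lambda>x. (f x, g x)) \<le> dist_entropy M f + dist_entropy M g"
proof -
  interpret information_space M "exp 1" by (rule information_space_exp)
  show ?thesis
    using entropy_chain_rule[OF assms] conditional_entropy_less_eq_entropy[OF assms(2,1)]
    by (simp add: dist_entropy_eq assms simple_function_Pair)
qed

lemma dist_entropy_comp_le:
  assumes "simple_function M f"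
  shows "dist_entropy M (g \<circ> f) \<le> dist_entropy M f"
proof -
  interpret information_space M "exp 1" by (rule information_space_exp)
  show ?thesis
    using entropy_data_processing[OF assms, of g]
    by (simp add: dist_entropy_eq assms simple_function_compose)
qed

lemma dist_entropy_superset:
  assumes "finite S" "f ` space M \<subseteq> S"
  shows "dist_entropy M f = - (\<Sum>c\<in>S. measure M (f -` {c} \<inter> space M) * ln (measure M (f -` {c} \<inter> space M)))"
proof -
  have "f -` {c} \<inter> space M = {}" if "c \<in> S - f ` space M" for c using that by auto
  then show ?thesis
    unfolding dist_entropy_def using assms by (intro arg_cong[of _ _ uminus] sum.mono_neutral_left) auto
qed

lemma sum_simple_function:
  fixes g :: "'b \<Rightarrow> real"
  assumes f: "simple_function M f"
  shows "(\<Sum>c\<in>f ` space M. measure M (f -` {c} \<inter> space M) * g c) = (LINT x|M. g (f x))"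
    and "integrable M (\<lambda>x. g (f x))"
proof -
  have fin: "finite (f ` space M)" and s: "\<And>c. c \<in> f ` space M \<Longrightarrow> f -` {c} \<inter> space M \<in> sets M"
    using f by (auto simp: simple_function_def)
  have eq: "g (f x) = (\<Sum>c\<in>f ` space M. indicator (f -` {c} \<inter> space M) x * g c)" if "x \<in> space M" for x
  proof -
    have "(\<Sum>c\<in>f ` space M. indicator (f -` {c} \<inter> space M) x * g c) = (\<Sum>c\<in>f ` space M. if c = f x then g (f x) else 0)"
      using that by (intro sum.cong) (auto simp: indicator_def)
    then show ?thesis using that fin by (simp add: sum.delta)
  qed
  have i: "integrable M (\<lambda>x. indicator (f -` {c} \<inter> space M) x * g c)" if "c \<in> f ` space M" for c
    using s[OF that] by (intro integrable_mult_left) (auto simp: less_top[symmetric])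
  have "(LINT x|M. g (f x)) = (LINT x|M. (\<Sum>c\<in>f ` space M. indicator (f -` {c} \<inter> space M) x * g c))"
    using eq by (intro Bochner_Integration.integral_cong) auto
  also have "\<dots> = (\<Sum>c\<in>f ` space M. LINT x|M. indicator (f -` {c} \<inter> space M) x * g c)"
    using i by (rule Bochner_Integration.integral_sum)
  also have "\<dots> = (\<Sum>c\<in>f ` space M. measure M (f -` {c} \<inter> space M) * g c)"
    by (intro sum.cong) (auto simp: Int_assoc)
  finally show "(\<Sum>c\<in>f ` space M. measure M (f -` {c} \<inter> space M) * g c) = (LINT x|M. g (f x))" ..
  have "integrable M (\<lambda>x. \<Sum>c\<in>f ` space M. indicator (f -` {c} \<inter> space M) x * g c)"
    using i by (rule Bochner_Integration.integrable_sum)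
  then show "integrable M (\<lambda>x. g (f x))"
    using eq by (subst Bochner_Integration.integrable_cong[OF refl]) auto
qed

lemma sum_simple_function_measure:
  assumes "simple_function M f"
  shows "(\<Sum>c\<in>f ` space M. measure M (f -` {c} \<inter> space M)) = 1"
  using sum_simple_function(1)[OF assms, of "\<lambda>_. 1"] by (simp add: prob_space)

text \<open>Gibbs' inequality, from \<open>ln t \<le> t - 1\<close> at
  \<open>t = q c / ?m c\<close>. Total mass at most 1 is enough for \<open>q\<close>, so test
  distributions need not be normalised.\<close>

lemma dist_entropy_le_cross_entropy:
  assumes f: "simple_function M f" and q: "\<And>c. c \<in> f ` space M \<Longrightarrow> q c > 0" "(\<Sum>c\<in>f ` space M. q c) \<le> 1"
  shows "dist_entropy M f \<le> (LINT x|M. - ln (q (f x)))"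
proof -
  let ?m = "\<lambda>c. measure M (f -` {c} \<inter> space M)"
  have "?m c * ln (q c) - ?m c * ln (?m c) \<le> q c - ?m c" if c: "c \<in> f ` space M" for c
  proof (cases "?m c = 0")
    case True then show ?thesis using q(1)[OF c] by simp
  next
    case False
    then have m: "?m c > 0" by (simp add: measure_le_0_iff zero_less_measure_iff)
    have "?m c * ln (q c / ?m c) \<le> ?m c * (q c / ?m c - 1)"
      using m q(1)[OF c] by (intro mult_left_mono ln_le_minus_one) auto
    then show ?thesis using m q(1)[OF c] by (simp add: ln_div right_diff_distrib)
  qed
  then have "(\<Sum>c\<in>f ` space M. ?m c * ln (q c) - ?m c * ln (?m c)) \<le> (\<Sum>c\<in>f ` space M. q c - ?m c)"
    by (rule sum_mono)
  also have "\<dots> \<le> 0"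
    using q(2) sum_simple_function_measure[OF f] by (simp add: sum_subtractf)
  finally have "dist_entropy M f \<le> (\<Sum>c\<in>f ` space M. ?m c * - ln (q c))"
    by (simp add: dist_entropy_def sum_subtractf sum_negf)
  also have "\<dots> = (LINT x|M. - ln (q (f x)))"
    by (rule sum_simple_function(1)[OF f])
  finally show ?thesis .
qed

text \<open>Entropy is the mean of \<open>- ln\<close> of the atom masses, and each of these is at
  least \<open>- ln m\<close> on atoms of positive measure.\<close>

lemma dist_entropy_ge:
  assumes f: "simple_function M f" and m: "\<And>c. c \<in> f ` space M \<Longrightarrow> measure M (f -` {c} \<inter> space M) \<le> m" "m > 0"
  shows "dist_entropy M f \<ge> - ln m"
proof -
  let ?m = "\<lambda>c. measure M (f -` {c} \<inter> space M)"
  have "?m c * ln (?m c) \<le> ?m c * ln m" if c: "c \<in> f ` space M" for c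
  proof (cases "?m c = 0")
    case False
    then have "?m c > 0" by (simp add: zero_less_measure_iff)
    then show ?thesis using m(1)[OF c] m(2) by (intro mult_left_mono) auto
  qed simp
  then have "(\<Sum>c\<in>f ` space M. ?m c * ln (?m c)) \<le> (\<Sum>c\<in>f ` space M. ?m c * ln m)"
    by (rule sum_mono)
  also have "\<dots> = ln m"
    using sum_simple_function_measure[OF f] by (simp add: sum_distrib_right[symmetric])
  finally show ?thesis by (simp add: dist_entropy_def)
qed

lemma dist_entropy_nonneg:
  assumes f: "simple_function M f"
  shows "dist_entropy M f \<ge> 0"
  using dist_entropy_ge[OF f, of 1] by simp

end

section \<open>Itineraries under a measure-preserving map\<close>

locale invariant_prob_space = prob_space M for M :: "'a measure" +
  fixes T :: "'a \<Rightarrow> 'a"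
  assumes inv: "invariant_measure M T"
begin

lemma measurable_funpow [measurable]: "T ^^ k \<in> measurable M M"
  using invariant_measure_funpow[OF inv] by (simp add: invariant_measure_def)

lemma funpow_in_space: "x \<in> space M \<Longrightarrow> (T ^^ k) x \<in> space M"
  using measurable_space[OF measurable_funpow] .

lemma measure_funpow_vimage: "A \<in> sets M \<Longrightarrow> measure M ((T ^^ k) -` A \<inter> space M) = measure M A"
  using invariant_measure_funpow[OF inv, of k] by (simp add: invariant_measure_def measure_def)

lemma simple_function_itinerary:
  assumes a: "simple_function M a"
  shows "simple_function M (itinerary T a n)"
proof -
  let ?P = "a ` space M"
  have "itinerary T a n ` space M \<subseteq> {..<n} \<rightarrow>\<^sub>E ?P"
    using funpow_in_space by (auto intro!: itinerary_PiE)
  moreover have "finite ({..<n} \<rightarrow>\<^sub>E ?P)" using a by (intro finite_PiE) (auto simp: simple_function_def)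
  ultimately have fin: "finite (itinerary T a n ` space M)" by (rule finite_subset)
  have "itinerary T a n -` {itinerary T a n y} \<inter> space M \<in> sets M" if y: "y \<in> space M" for y
  proof -
    have "itinerary T a n -` {itinerary T a n y} \<inter> space M = {x \<in> space M. \<forall>k\<in>{..<n}. x \<in> (T ^^ k) -` (a -` {a ((T ^^ k) y)} \<inter> space M) \<inter> space M}"
      using funpow_in_space by (auto simp: itinerary_eq_iff)
    also have "\<dots> \<in> sets M"
    proof (rule sets.sets_Collect_finite_All)
      fix k
      have "a -` {a ((T ^^ k) y)} \<inter> space M \<in> sets M"
        using a funpow_in_space[OF y, of k] by (auto simp: simple_function_def)
      from measurable_sets[OF measurable_funpow this, of k]
      show "{x \<in> space M. x \<in> (T ^^ k) -` (a -` {a ((T ^^ k) y)} \<inter> space M) \<inter> space M} \<in> sets M"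
        by (simp add: Int_def conj_commute cong: conj_cong)
    qed auto
    finally show ?thesis .
  qed
  with fin show ?thesis by (auto simp: simple_function_def)
qed

text \<open>The level sets have equal measure by invariance. Values of \<open>f\<close> that are
  missed after \<open>k\<close> steps have measure 0, which is why the sum is taken over the larger
  range.\<close>

lemma dist_entropy_funpow:
  assumes f: "simple_function M f"
  shows "dist_entropy M (\<lambda>x. f ((T ^^ k) x)) = dist_entropy M f"
proof -
  have fin: "finite (f ` space M)" and s: "\<And>c. c \<in> f ` space M \<Longrightarrow> f -` {c} \<inter> space M \<in> sets M"
    using f by (auto simp: simple_function_def)
  have "(\<lambda>x. f ((T ^^ k) x)) -` {c} \<inter> space M = (T ^^ k) -` (f -` {c} \<inter> space M) \<inter> space M" for c
    using funpow_in_space by auto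
  then have "measure M ((\<lambda>x. f ((T ^^ k) x)) -` {c} \<inter> space M) = measure M (f -` {c} \<inter> space M)" if "c \<in> f ` space M" for c
    using measure_funpow_vimage[OF s[OF that]] by simp
  moreover have "(\<lambda>x. f ((T ^^ k) x)) ` space M \<subseteq> f ` space M" using funpow_in_space by auto
  ultimately show ?thesis
    unfolding dist_entropy_superset[OF fin \<open>(\<lambda>x. f ((T ^^ k) x)) ` space M \<subseteq> f ` space M\<close>]
    by (simp add: dist_entropy_def)
qed

lemma simple_function_funpow:
  assumes f: "simple_function M f"
  shows "simple_function M (\<lambda>x. f ((T ^^ k) x))"
proof -
  have fin: "finite (f ` space M)" and s: "\<And>c. c \<in> f ` space M \<Longrightarrow> f -` {c} \<inter> space M \<in> sets M"
    using f by (auto simp: simple_function_def)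
  have sub: "(\<lambda>x. f ((T ^^ k) x)) ` space M \<subseteq> f ` space M" using funpow_in_space by auto
  have "(\<lambda>x. f ((T ^^ k) x)) -` {c} \<inter> space M = (T ^^ k) -` (f -` {c} \<inter> space M) \<inter> space M" for c
    using funpow_in_space by auto
  then have "(\<lambda>x. f ((T ^^ k) x)) -` {c} \<inter> space M \<in> sets M" if "c \<in> f ` space M" for c
    using measurable_sets[OF measurable_funpow s[OF that]] by simp
  then show ?thesis using finite_subset[OF sub fin] sub by (auto simp: simple_function_def)
qed

text \<open>The long itinerary is glued by \<open>g\<close> from the first \<open>n\<close> symbols
  and the itinerary of length \<open>m\<close> started at time \<open>n\<close>; the latter has the
  entropy of an itinerary started at time 0.\<close>

lemma dist_entropy_itinerary_subadditive:
  assumes a: "simple_function M a"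
  shows "dist_entropy M (itinerary T a (n + m)) \<le> dist_entropy M (itinerary T a n) + dist_entropy M (itinerary T a m)"
proof -
  let ?f = "\<lambda>x. (itinerary T a n x, itinerary T a m ((T ^^ n) x))"
  have s: "simple_function M (itinerary T a n)" "simple_function M (\<lambda>x. itinerary T a m ((T ^^ n) x))"
    using simple_function_itinerary[OF a] simple_function_funpow by auto
  define g where "g = (\<lambda>(u, v). restrict (\<lambda>k. if k < n then u k else v (k - n)) {..<n + m} :: nat \<Rightarrow> 'b)"
  have "itinerary T a (n + m) = g \<circ> ?f"
  proof
    fix x
    have "itinerary T a (n + m) x k = (g \<circ> ?f) x k" for k
    proof (cases "n \<le> k")
      case True
      have "(T ^^ (k - n)) ((T ^^ n) x) = (T ^^ (k - n + n)) x" by (simp only: funpow_add comp_apply)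
      then show ?thesis using True by (auto simp: g_def itinerary_def)
    qed (auto simp: g_def itinerary_def)
    then show "itinerary T a (n + m) x = (g \<circ> ?f) x" ..
  qed
  then have "dist_entropy M (itinerary T a (n + m)) \<le> dist_entropy M ?f"
    using dist_entropy_comp_le[of ?f g] s by (simp add: simple_function_Pair)
  also have "\<dots> \<le> dist_entropy M (itinerary T a n) + dist_entropy M (\<lambda>x. itinerary T a m ((T ^^ n) x))"
    by (rule dist_entropy_Pair_le[OF s])
  finally show ?thesis
    using dist_entropy_funpow[OF simple_function_itinerary[OF a]] by simp
qed

text \<open>If \<open>a\<close> and \<open>b\<close> rarely differ, the \<open>a\<close>-itinerary
  is a \<open>b\<close>-itinerary with few corrupted symbols. Gibbs' inequality with the law of a
  noisy uniformly chosen \<open>b\<close>-itinerary costs \<open>ln\<close> of their number, plus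
  the noise price per time step.\<close>

lemma dist_entropy_itinerary_le:
  assumes a: "simple_function M a" and b: "simple_function M b"
    and P: "finite P" "a ` space M \<subseteq> P"
    and d: "0 < d" "d < 1" "measure M {x \<in> space M. a x \<noteq> b x} \<le> d"
  shows "dist_entropy M (itinerary T a n) \<le>
    ln (card (itinerary T b n ` space M)) + real n * (- ln (1 - d) + d * ln (card P / d))"
proof -
  define V where "V = itinerary T b n ` space M"
  define r where "r = card P"
  \<comment> \<open>The noisy channel: a symbol survives with weight \<open>1 - d\<close>, and every
    other symbol gets \<open>d / r\<close>, so the weights over \<open>P\<close> sum to at most
    1.\<close>
  define \<kappa> where "\<kappa> u v = (if u = v then 1 - d else d / r)" for u v :: 'b
  \<comment> \<open>Average over all \<open>b\<close>-itineraries \<open>v\<close> of the weight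
    with which independent noise turns \<open>v\<close> into \<open>w\<close>.\<close>
  define q where "q w = (\<Sum>v\<in>V. \<Prod>k<n. \<kappa> (w k) (v k)) / card V" for w
  have ne: "space M \<noteq> {}" by (rule not_empty)
  then have "P \<noteq> {}" using P by auto
  then have r: "r > 0" unfolding r_def using P by (simp add: card_gt_0_iff)
  have "finite V" unfolding V_def using simple_function_itinerary[OF b] by (simp add: simple_function_def)
  moreover have V_ne: "V \<noteq> {}" using ne by (simp add: V_def)
  ultimately have V: "finite V" "card V > 0" by (auto simp: card_gt_0_iff)
  have \<kappa>_pos: "\<kappa> u v > 0" for u v using d r by (simp add: \<kappa>_def)
  have q_pos: "q w > 0" for w unfolding q_def using V V_ne
    by (intro divide_pos_pos sum_pos prod_pos V_ne) (auto simp: \<kappa>_pos)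
  have sub: "itinerary T a n ` space M \<subseteq> {..<n} \<rightarrow>\<^sub>E P"
    using P funpow_in_space by (auto intro!: itinerary_PiE)
  have \<kappa>_sum: "(\<Sum>u\<in>P. \<kappa> u v) \<le> 1" for v
  proof -
    have "(\<Sum>u\<in>P. \<kappa> u v) \<le> (\<Sum>u\<in>P. (if u = v then 1 - d else 0) + d / r)"
      using d r by (intro sum_mono) (auto simp: \<kappa>_def)
    also have "\<dots> = (if v \<in> P then 1 - d else 0) + d"
      using P r \<open>P \<noteq> {}\<close> by (simp add: sum.distrib r_def)
    also have "\<dots> \<le> 1" using d by simp
    finally show ?thesis .
  qed
  have "(\<Sum>w\<in>itinerary T a n ` space M. q w) \<le> (\<Sum>w\<in>{..<n} \<rightarrow>\<^sub>E P. q w)"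
    using P q_pos by (intro sum_mono2 sub finite_PiE) (auto intro: less_imp_le)
  also have "\<dots> = (\<Sum>v\<in>V. \<Sum>w\<in>{..<n} \<rightarrow>\<^sub>E P. \<Prod>k<n. \<kappa> (w k) (v k)) / card V"
    unfolding q_def sum_divide_distrib[symmetric] by (subst sum.swap) simp
  also have "\<dots> = (\<Sum>v\<in>V. \<Prod>k<n. \<Sum>u\<in>P. \<kappa> u (v k)) / card V"
    using P by (simp add: prod_sum_PiE)
  also have "\<dots> \<le> (\<Sum>v\<in>V. 1) / card V"
    using \<kappa>_sum \<kappa>_pos by (intro divide_right_mono sum_mono prod_le_1 conjI sum_nonneg) (auto intro: less_imp_le)
  also have "\<dots> = 1" using V V_ne by simp
  finally have q_sum: "(\<Sum>w\<in>itinerary T a n ` space M. q w) \<le> 1" .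
  define D where "D = {x \<in> space M. a x \<noteq> b x}"
  have D: "D \<in> sets M"
  proof -
    have "simple_function M (\<lambda>x. (a x, b x))" using a b by (rule simple_function_Pair)
    then have "(\<lambda>x. (a x, b x)) -` {z. fst z \<noteq> snd z} \<inter> space M \<in> sets M" by (rule simple_functionD(2))
    then show ?thesis by (simp add: D_def vimage_def Int_def conj_commute)
  qed
  define \<alpha> where "\<alpha> = - ln (1 - d)"
  define \<gamma> where "\<gamma> = ln (r / d)"
  have \<alpha>: "\<alpha> \<ge> 0" using d by (simp add: \<alpha>_def)
  have \<gamma>: "\<gamma> \<ge> 0" using d r by (auto simp: \<gamma>_def intro!: ln_ge_zero)
  \<comment> \<open>Keeping only the point's own \<open>b\<close>-itinerary in the average loses
    \<open>ln (card V)\<close>; each time step then costs \<open>\<alpha>\<close>, and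
    \<open>\<gamma>\<close> more where \<open>a\<close> and \<open>b\<close> differ. By invariance
    the mean number of such times is at most \<open>n * d\<close>.\<close>
  have pt: "- ln (q (itinerary T a n x)) \<le> ln (card V) + (\<Sum>k<n. \<alpha> + \<gamma> * indicator D ((T ^^ k) x))"
    if x: "x \<in> space M" for x
  proof -
    have vx: "itinerary T b n x \<in> V" using x by (auto simp: V_def)
    let ?Q = "\<Prod>k<n. \<kappa> (a ((T ^^ k) x)) (b ((T ^^ k) x))"
    have Qpos: "?Q > 0" by (intro prod_pos) (auto simp: \<kappa>_pos)
    have "?Q = (\<Sum>v\<in>{itinerary T b n x}. \<Prod>k<n. \<kappa> (itinerary T a n x k) (v k))"
      by (simp add: itinerary_def)
    also have "\<dots> \<le> (\<Sum>v\<in>V. \<Prod>k<n. \<kappa> (itinerary T a n x k) (v k))"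
      using V vx \<kappa>_pos by (intro sum_mono2 prod_nonneg) (auto intro: less_imp_le)
    finally have "?Q / card V \<le> q (itinerary T a n x)"
      unfolding q_def by (intro divide_right_mono) auto
    then have "ln (?Q / card V) \<le> ln (q (itinerary T a n x))"
      using Qpos V q_pos by (subst ln_le_cancel_iff) auto
    moreover have "ln (?Q / card V) = ln ?Q - ln (card V)"
      using Qpos V by (subst ln_divide_pos) auto
    moreover have "ln ?Q = (\<Sum>k<n. ln (\<kappa> (a ((T ^^ k) x)) (b ((T ^^ k) x))))"
      by (intro ln_prod) (rule finite_lessThan, metis \<kappa>_pos less_irrefl)
    moreover have "(\<Sum>k<n. - ln (\<kappa> (a ((T ^^ k) x)) (b ((T ^^ k) x)))) \<le> (\<Sum>k<n. \<alpha> + \<gamma> * indicator D ((T ^^ k) x))"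
    proof (rule sum_mono)
      fix k
      have "- ln (d / r) = \<gamma>" using d r by (simp add: \<gamma>_def ln_div)
      then show "- ln (\<kappa> (a ((T ^^ k) x)) (b ((T ^^ k) x))) \<le> \<alpha> + \<gamma> * indicator D ((T ^^ k) x)"
        using \<alpha> \<gamma> funpow_in_space[OF x, of k] by (auto simp: \<kappa>_def \<alpha>_def D_def indicator_def)
    qed
    ultimately show ?thesis by (simp add: sum_negf)
  qed
  have iD: "integrable M (\<lambda>x. indicator D ((T ^^ k) x) :: real)" and ID: "(LINT x|M. indicator D ((T ^^ k) x)) = measure M D" for k
  proof -
    have s: "(T ^^ k) -` D \<inter> space M \<in> sets M" using measurable_sets[OF measurable_funpow D] .
    have eq: "indicator D ((T ^^ k) x) = (indicator ((T ^^ k) -` D \<inter> space M) x :: real)" if "x \<in> space M" for x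
      using that by (auto simp: indicator_def)
    have "integrable M (indicator ((T ^^ k) -` D \<inter> space M) :: 'a \<Rightarrow> real)"
      using s by (intro integrable_real_indicator) (auto simp: less_top[symmetric])
    then show "integrable M (\<lambda>x. indicator D ((T ^^ k) x) :: real)"
      using eq by (subst Bochner_Integration.integrable_cong[OF refl]) auto
    have "(LINT x|M. indicator D ((T ^^ k) x) :: real) = (LINT x|M. indicator ((T ^^ k) -` D \<inter> space M) x)"
      using eq by (intro Bochner_Integration.integral_cong) auto
    also have "\<dots> = measure M ((T ^^ k) -` D \<inter> space M)"
      by (subst Bochner_Integration.integral_indicator) (auto intro!: arg_cong[of _ _ "measure M"])
    finally show "(LINT x|M. indicator D ((T ^^ k) x)) = measure M D"
      using measure_funpow_vimage[OF D] by simp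
  qed
  have "dist_entropy M (itinerary T a n) \<le> (LINT x|M. - ln (q (itinerary T a n x)))"
    using q_pos q_sum by (intro dist_entropy_le_cross_entropy simple_function_itinerary a)
  also have "\<dots> \<le> (LINT x|M. ln (card V) + (\<Sum>k<n. \<alpha> + \<gamma> * indicator D ((T ^^ k) x)))"
    using pt iD sum_simple_function(2)[OF simple_function_itinerary[OF a], of "\<lambda>w. - ln (q w)" n]
    by (intro integral_mono) auto
  also have "\<dots> = ln (card V) + (\<Sum>k<n. \<alpha> + \<gamma> * measure M D)"
    using iD ID by (simp add: prob_space)
  also have "\<dots> \<le> ln (card V) + (\<Sum>k<n. \<alpha> + \<gamma> * d)"
    using \<gamma> d(3) unfolding D_def by (intro add_left_mono sum_mono mult_left_mono) auto
  also have "\<dots> = ln (card V) + real n * (\<alpha> + d * \<gamma>)" by (simp add: mult.commute)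
  finally show ?thesis by (simp add: V_def \<alpha>_def \<gamma>_def r_def)
qed

section \<open>Translation from partitions to itineraries\<close>

definition atom :: "'a set set \<Rightarrow> 'a \<Rightarrow> 'a set" where
  "atom P x = (THE A. A \<in> P \<and> x \<in> A)"

lemma atom:
  assumes "measurable_partition M P"
  shows atom_eq: "A \<in> P \<Longrightarrow> x \<in> A \<Longrightarrow> atom P x = A"
    and atom_mem: "x \<in> space M \<Longrightarrow> atom P x \<in> P \<and> x \<in> atom P x"
    and simple_function_atom: "simple_function M (atom P)"
    and atom_image: "atom P ` space M \<subseteq> P"
proof -
  have P: "finite P" "P \<subseteq> sets M" "\<Union>P = space M" "disjoint P"
    using assms by (auto simp: measurable_partition_def partition_on_def)
  have eq: "atom P x = A" if "A \<in> P" "x \<in> A" for A x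
    unfolding atom_def using that P(4) by (intro the_equality) (auto simp: disjoint_def)
  then show "A \<in> P \<Longrightarrow> x \<in> A \<Longrightarrow> atom P x = A" .
  have mem: "atom P x \<in> P \<and> x \<in> atom P x" if "x \<in> space M" for x
    using that P(3) eq by (metis UnionE)
  then show "x \<in> space M \<Longrightarrow> atom P x \<in> P \<and> x \<in> atom P x" .
  show im: "atom P ` space M \<subseteq> P" using mem by auto
  have "atom P -` {A} \<inter> space M = A" if "A \<in> P" for A
    using eq[OF that] mem P(3) that by auto
  then have "atom P -` {A} \<inter> space M \<in> sets M" if "A \<in> atom P ` space M" for A
    using that im P(2) by (metis subsetD)
  then show "simple_function M (atom P)"
    using finite_subset[OF im P(1)] unfolding simple_function_def by blast
qed

text \<open>Members of the iterated join are the sets of points with a prescribed atom itinerary.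
  The join is a set of sets, so the sum must be reindexed by itineraries.\<close>

lemma partition_entropy_iterated_join:
  assumes P: "measurable_partition M P"
  shows "partition_entropy M (iterated_join M T P n) = dist_entropy M (itinerary T (atom P) n)"
proof -
  define E where "E n w = {x \<in> space M. \<forall>k<n. (T ^^ k) x \<in> w k}" for n and w :: "nat \<Rightarrow> 'a set"
  have fin: "finite P" using P by (simp add: measurable_partition_def)
  have join: "iterated_join M T P n = E n ` ({..<n} \<rightarrow>\<^sub>E P)" for n
  proof (induction n)
    case 0 show ?case by (auto simp: E_def)
  next
    case (Suc n)
    have E_Suc: "E (Suc n) w = E n (restrict w {..<n}) \<inter> ((T ^^ n) -` w n \<inter> space M)" for w
      unfolding E_def by (auto simp: less_Suc_eq)
    show ?case
    proof (intro set_eqI iffI)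
      fix Z assume "Z \<in> iterated_join M T P (Suc n)"
      then obtain w A where w: "w \<in> {..<n} \<rightarrow>\<^sub>E P" "A \<in> P" and Z: "Z = E n w \<inter> ((T ^^ n) -` A \<inter> space M)"
        using Suc by (auto simp: partition_join_def)
      have "restrict (w(n := A)) {..<n} = restrict w {..<n}" by (intro restrict_ext) auto
      also have "\<dots> = w" by (rule PiE_restrict[OF w(1)])
      finally have "restrict (w(n := A)) {..<n} = w" .
      then have "Z = E (Suc n) (w(n := A))" unfolding Z E_Suc by simp
      moreover have "w(n := A) \<in> {..<Suc n} \<rightarrow>\<^sub>E P"
        using w by (auto simp: lessThan_Suc PiE_insert_eq)
      ultimately show "Z \<in> E (Suc n) ` ({..<Suc n} \<rightarrow>\<^sub>E P)" by blast
    next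
      fix Z assume "Z \<in> E (Suc n) ` ({..<Suc n} \<rightarrow>\<^sub>E P)"
      then obtain w where w: "w \<in> {..<Suc n} \<rightarrow>\<^sub>E P" and Z: "Z = E (Suc n) w" by blast
      have "restrict w {..<n} \<in> {..<n} \<rightarrow>\<^sub>E P" "w n \<in> P" using w by (auto simp: PiE_iff)
      then show "Z \<in> iterated_join M T P (Suc n)"
        unfolding Z E_Suc iterated_join.simps partition_join_def Suc by blast
    qed
  qed
  have vim: "E n w = itinerary T (atom P) n -` {w} \<inter> space M" if w: "w \<in> {..<n} \<rightarrow>\<^sub>E P" for w
  proof -
    have "(T ^^ k) x \<in> w k \<longleftrightarrow> atom P ((T ^^ k) x) = w k" if "x \<in> space M" "k < n" for x k
      using atom_eq[OF P, of "w k" "(T ^^ k) x"] atom_mem[OF P funpow_in_space[OF that(1), of k]] w that(2) by auto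
    moreover have "itinerary T (atom P) n x = w \<longleftrightarrow> (\<forall>k<n. atom P ((T ^^ k) x) = w k)" for x
      using w by (auto simp: itinerary_def fun_eq_iff restrict_def PiE_iff extensional_def)
    ultimately show ?thesis
      unfolding E_def by (intro set_eqI) (simp only: mem_Collect_eq Int_iff vimage_singleton_eq, blast)
  qed
  let ?g = "\<lambda>A. measure M A * ln (measure M A)"
  have "(\<Sum>A\<in>E n ` ({..<n} \<rightarrow>\<^sub>E P). ?g A) = (\<Sum>w\<in>{..<n} \<rightarrow>\<^sub>E P. ?g (E n w))"
  proof (subst sum.reindex_nontrivial)
    show "finite ({..<n} \<rightarrow>\<^sub>E P)" using fin by (intro finite_PiE) auto
    \<comment> \<open>Two itineraries can give the same set only if it is empty, and the empty set
      contributes 0.\<close>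
    fix w v assume wv: "w \<in> {..<n} \<rightarrow>\<^sub>E P" "v \<in> {..<n} \<rightarrow>\<^sub>E P" "w \<noteq> v" "E n w = E n v"
    then have "E n w = {}" using vim[OF wv(1)] vim[OF wv(2)] by auto
    then show "?g (E n w) = 0" by simp
  qed simp
  also have "\<dots> = (\<Sum>w\<in>{..<n} \<rightarrow>\<^sub>E P. ?g (itinerary T (atom P) n -` {w} \<inter> space M))"
    using vim by (intro sum.cong) auto
  finally show ?thesis
    unfolding partition_entropy_def join
    using fin funpow_in_space atom_image[OF P]
    by (subst dist_entropy_superset[of "{..<n} \<rightarrow>\<^sub>E P"]) (auto intro!: itinerary_PiE finite_PiE)
qed

lemma tendsto_entropy_wrt_partition:
  assumes P: "measurable_partition M P"
  shows "(\<lambda>n. dist_entropy M (itinerary T (atom P) n) / real n) \<longlonglongrightarrow> entropy_wrt_partition M T P"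
proof -
  have a: "simple_function M (atom P)" by (rule simple_function_atom[OF P])
  have "convergent (\<lambda>n. dist_entropy M (itinerary T (atom P) n) / real n)"
    by (intro fekete dist_entropy_itinerary_subadditive a dist_entropy_nonneg simple_function_itinerary)
  then show ?thesis
    unfolding entropy_wrt_partition_def partition_entropy_iterated_join[OF P] by (simp add: convergent_LIMSEQ_iff)
qed

end

section \<open>Counting and measuring cylinders\<close>

context alternate_base begin

text \<open>The fibre index belongs to the label because points of different fibres may have equal
  digits.\<close>

definition label :: "nat \<times> real \<Rightarrow> nat \<times> int" where
  "label z = (fst z, \<lfloor>\<beta> (fst z) * snd z\<rfloor>)"

text \<open>The common derivative of the branches of the \<open>n\<close>-th iterate of
  \<open>T\<close> on fibre \<open>i\<close>.\<close>

definition slope :: "nat \<Rightarrow> nat \<Rightarrow> real" where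
  "slope n i = (\<Prod>k<n. \<beta> ((i + k) mod p))"

sublocale mu: invariant_prob_space "mu_alt p \<beta>" T
proof -
  interpret prob_space "mu_alt p \<beta>" by (rule prob_space_mu_alt)
  show "invariant_prob_space (mu_alt p \<beta>) T"
    using is_acip_mu_alt by unfold_locales (simp add: is_acip_def)
qed

lemma beta_mod_gt_1: "\<beta> (k mod p) > 1"
  using p by (intro gt_1) auto

lemma slope_0 [simp]: "slope 0 i = 1"
  by (simp add: slope_def)

lemma slope_Suc: "i < p \<Longrightarrow> slope (Suc n) i = \<beta> i * slope n ((i + 1) mod p)"
  unfolding slope_def by (subst prod.lessThan_Suc_shift) (simp add: mod_add_left_eq)

lemma slope_add: "slope (n + m) i = slope n i * (\<Prod>k<m. \<beta> ((i + (n + k)) mod p))"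
  by (induction m) (simp_all add: slope_def mult.assoc)

lemma slope_ge_1: "slope n i \<ge> 1"
  unfolding slope_def using beta_mod_gt_1 by (intro prod_ge_1) (auto intro: less_imp_le)

text \<open>Over full periods the slope does not depend on the fibre; this is why entropies are
  computed along multiples of \<open>p\<close>.\<close>

lemma slope_period:
  assumes "i < p"
  shows "slope (m * p) i = (\<Prod>i<p. \<beta> i) ^ m"
proof -
  have rot: "(\<Prod>k<p. \<beta> ((j + k) mod p)) = (\<Prod>i<p. \<beta> i)" for j
  proof (induction j)
    case (Suc j)
    obtain q where q: "p = Suc q" using p by (cases p) auto
    have e: "Suc (j + q) mod Suc q = j mod Suc q" by (metis add_Suc_right mod_add_self2)
    have "(\<Prod>k<p. \<beta> ((Suc j + k) mod p)) = (\<Prod>k<q. \<beta> ((j + Suc k) mod p)) * \<beta> (j mod p)"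
      unfolding q by (simp add: e)
    also have "\<dots> = (\<Prod>k<p. \<beta> ((j + k) mod p))"
      unfolding q by (subst prod.lessThan_Suc_shift) (simp add: mult.commute)
    finally show ?case using Suc by simp
  qed (use p in \<open>auto intro!: prod.cong\<close>)
  show ?thesis
  proof (induction m)
    case (Suc m)
    have "slope (Suc m * p) i = slope (m * p) i * (\<Prod>k<p. \<beta> ((i + (m * p + k)) mod p))"
      using slope_add[of "m * p" p i] by (simp add: add.commute)
    then show ?case using rot[of "i + m * p"] Suc by (simp add: add.assoc)
  qed simp
qed

lemma itinerary_Suc:
  "itinerary T label (Suc n) z =
     restrict (\<lambda>k. case k of 0 \<Rightarrow> label z | Suc j \<Rightarrow> itinerary T label n (T z) j) {..<Suc n}"
  unfolding itinerary_def by (intro restrict_ext) (auto simp: funpow_Suc_right simp del: funpow.simps split: nat.split)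

lemma itinerary_Suc_eqD:
  assumes "itinerary T label (Suc n) z = itinerary T label (Suc n) z'"
  shows "label z = label z'" "itinerary T label n (T z) = itinerary T label n (T z')"
proof -
  have e: "label ((T ^^ k) z) = label ((T ^^ k) z')" if "k < Suc n" for k
    using assms that by (simp add: itinerary_eq_iff)
  from e[of 0] show "label z = label z'" by simp
  show "itinerary T label n (T z) = itinerary T label n (T z')"
    using e[of "Suc k" for k] unfolding itinerary_eq_iff by (simp add: funpow_Suc_right del: funpow.simps)
qed

text \<open>Counting on \<open>[0,c)\<close> for all \<open>c\<close> makes the recursion close: the
  first step has \<open>\<lfloor>b * c\<rfloor>\<close> full branches with image
  \<open>[0,1)\<close> and a last one with image \<open>[0,f)\<close>. Since their number plus
  \<open>f\<close> is \<open>b * c\<close>, the bound is linear in \<open>c\<close>.\<close>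

lemma card_itineraries_le:
  assumes "i < p" "0 \<le> c" "c \<le> 1"
  shows "finite (itinerary T label n ` ({i} \<times> {0..<c})) \<and>
    real (card (itinerary T label n ` ({i} \<times> {0..<c}))) \<le> 1 + c * real n * slope n i"
  using assms
proof (induction n arbitrary: i c)
  case 0
  have "itinerary T label 0 ` ({i} \<times> {0..<c}) \<subseteq> {\<lambda>_. undefined}" by (auto simp: itinerary_def)
  from finite_subset[OF this] card_mono[OF _ this] show ?case by simp
next
  case (Suc n)
  define j where "j = (i + 1) mod p"
  define K where "K c = itinerary T label n ` ({j} \<times> {0..<c})" for c :: real
  define cons where "cons d w = restrict (\<lambda>k. case k of 0 \<Rightarrow> (i, int d) | Suc l \<Rightarrow> w l) {..<Suc n}" for d :: nat and w :: "nat \<Rightarrow> nat \<times> int"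
  define b where "b = \<beta> i"
  have b: "b > 1" using Suc.prems gt_1 by (simp add: b_def)
  have j: "j < p" using p by (simp add: j_def)
  \<comment> \<open>The right end of the image of the incomplete branch; it is 0 when
    \<open>b * c\<close> is an integer, and then that piece is empty.\<close>
  define f where "f = b * c - of_int \<lfloor>b * c\<rfloor>"
  have f: "0 \<le> f" "f < 1" unfolding f_def by linarith+
  define m where "m = nat \<lfloor>b * c\<rfloor>"
  have "b * c \<ge> 0" using b Suc.prems by simp
  then have m: "real m = of_int \<lfloor>b * c\<rfloor>" by (simp add: m_def)
  have K1: "finite (K 1)" "real (card (K 1)) \<le> 1 + real n * slope n j"
    using Suc.IH[OF j, of 1] by (auto simp: K_def)
  have Kf: "finite (K f)" "real (card (K f)) \<le> 1 + f * real n * slope n j"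
    using Suc.IH[OF j, of f] f by (auto simp: K_def)
  let ?I = "itinerary T label (Suc n) ` ({i} \<times> {0..<c})"
  let ?U = "(\<Union>d\<in>{..<m}. cons d ` K 1) \<union> cons m ` K f"
  have sub: "?I \<subseteq> ?U"
  proof
    fix w assume "w \<in> ?I"
    then obtain x where x: "0 \<le> x" "x < c" and w: "w = itinerary T label (Suc n) (i, x)" by auto
    define d where "d = nat \<lfloor>b * x\<rfloor>"
    have bx: "0 \<le> b * x" "b * x < b * c" using x b by auto
    have d: "int d = \<lfloor>b * x\<rfloor>" unfolding d_def using bx(1) by simp
    have dm: "d \<le> m" unfolding d_def m_def using bx(2) by (intro nat_mono floor_mono) simp
    have Tx: "T (i, x) = (j, T_single b x)" by (simp add: T_alt_def j_def b_def)
    have w': "w = cons d (itinerary T label n (T (i, x)))"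
      unfolding w cons_def itinerary_Suc by (simp add: label_def d b_def)
    show "w \<in> ?U"
    proof (cases "d < m")
      case True
      have "T (i, x) \<in> {j} \<times> {0..<1}" using T_single_bounds[of b x] by (simp add: Tx)
      then have "itinerary T label n (T (i, x)) \<in> K 1" unfolding K_def by (rule imageI)
      then show ?thesis using True unfolding w' by blast
    next
      case False
      then have "d = m" using dm by simp
      then have "T_single b x < f" using bx d m unfolding T_single_def f_def by linarith
      then have "T (i, x) \<in> {j} \<times> {0..<f}" using T_single_bounds[of b x] by (simp add: Tx)
      then have "itinerary T label n (T (i, x)) \<in> K f" unfolding K_def by (rule imageI)
      then show ?thesis unfolding w' \<open>d = m\<close> by blast
    qed
  qed
  have finU: "finite ?U" using K1 Kf by simp
  have "card ?U \<le> card (\<Union>d\<in>{..<m}. cons d ` K 1) + card (cons m ` K f)" by (rule card_Un_le)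
  also have "\<dots> \<le> (\<Sum>d<m. card (cons d ` K 1)) + card (K f)"
    using K1 Kf by (intro add_mono card_UN_le card_image_le) auto
  also have "\<dots> \<le> (\<Sum>d<m. card (K 1)) + card (K f)"
    using K1 by (intro add_mono sum_mono card_image_le) auto
  finally have "real (card ?U) \<le> real m * real (card (K 1)) + real (card (K f))"
    by (metis (mono_tags) of_nat_le_iff of_nat_add of_nat_mult sum_constant card_lessThan of_nat_id)
  also have "\<dots> \<le> real m * (1 + real n * slope n j) + (1 + f * real n * slope n j)"
    using K1 Kf by (intro add_mono mult_left_mono) auto
  also have "\<dots> = 1 + real m + (real m + f) * (real n * slope n j)" by (simp add: algebra_simps)
  also have "\<dots> \<le> 1 + b * c + (b * c) * (real n * slope n j)"
    using m f by (simp add: f_def)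
  \<comment> \<open>The leading ones of the \<open>m\<close> full branches are charged to one more
    copy of \<open>b * c * slope n j\<close>; this is how \<open>n\<close> becomes
    \<open>Suc n\<close>.\<close>
  also have "\<dots> \<le> 1 + b * c * slope n j + (b * c) * (real n * slope n j)"
    using \<open>b * c \<ge> 0\<close> slope_ge_1[of n j] mult_left_mono[of 1 "slope n j" "b * c"] by simp
  also have "\<dots> = 1 + c * real (Suc n) * slope (Suc n) i"
    using Suc.prems(1) by (simp add: slope_Suc j_def b_def algebra_simps)
  finally show ?case
    using finite_subset[OF sub finU] card_mono[OF finU sub] by linarith
qed

lemma card_itineraries_X_le:
  "real (card (itinerary T label (m * p) ` X)) \<le> real p * (1 + real (m * p) * (\<Prod>i<p. \<beta> i) ^ m)"
proof -
  have "itinerary T label (m * p) ` X = (\<Union>i<p. itinerary T label (m * p) ` ({i} \<times> {0..<1}))" by auto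
  also have "card \<dots> \<le> (\<Sum>i<p. card (itinerary T label (m * p) ` ({i} \<times> {0..<1})))"
    by (rule card_UN_le) simp
  finally have "real (card (itinerary T label (m * p) ` X)) \<le> (\<Sum>i<p. real (card (itinerary T label (m * p) ` ({i} \<times> {0..<1}))))"
    by (metis of_nat_le_iff of_nat_sum)
  also have "\<dots> \<le> (\<Sum>i<p. 1 + real (m * p) * (\<Prod>i<p. \<beta> i) ^ m)"
  proof (rule sum_mono)
    fix i assume "i \<in> {..<p}"
    then have "i < p" by simp
    from card_itineraries_le[OF this, of 1 "m * p"] slope_period[OF this, of m]
    show "real (card (itinerary T label (m * p) ` ({i} \<times> {0..<1}))) \<le> 1 + real (m * p) * (\<Prod>i<p. \<beta> i) ^ m" by simp
  qed
  finally show ?thesis by simp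
qed

text \<open>While labels agree, \<open>T\<close> is affine with slope \<open>\<beta> i\<close> on
  both points, so distances grow by the slope; after \<open>n\<close> steps they are still below
  1.\<close>

lemma itinerary_distance:
  assumes "i < p" "x \<in> {0..<1}" "y \<in> {0..<1}" "itinerary T label n (i, x) = itinerary T label n (i, y)"
  shows "\<bar>x - y\<bar> * slope n i < 1"
  using assms
proof (induction n arbitrary: i x y)
  case 0 then show ?case by auto
next
  case (Suc n)
  let ?j = "(i + 1) mod p"
  have T: "T (i, u) = (?j, T_single (\<beta> i) u)" for u by (simp add: T_alt_def)
  note e = itinerary_Suc_eqD[OF Suc.prems(4), unfolded T]
  have "?j < p" using p by simp
  from Suc.IH[OF this T_single_bounds T_single_bounds e(2)]
  have "\<bar>T_single (\<beta> i) x - T_single (\<beta> i) y\<bar> * slope n ?j < 1" .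
  moreover have "T_single (\<beta> i) x - T_single (\<beta> i) y = \<beta> i * (x - y)"
    using e(1) by (simp add: T_single_def label_def algebra_simps)
  ultimately show ?case
    using gt_1[OF Suc.prems(1)] Suc.prems(1) by (simp add: slope_Suc abs_mult mult.assoc mult.left_commute)
qed

lemma simple_function_label: "simple_function (mu_alt p \<beta>) label"
  unfolding simple_function_def space_mu_alt sets_mu_alt
proof (intro conjI ballI)
  have "label ` X \<subseteq> (\<Union>i<p. {i} \<times> {0..\<lfloor>\<beta> i\<rfloor>})"
  proof
    fix w assume "w \<in> label ` X"
    then obtain i x where w: "w = (i, \<lfloor>\<beta> i * x\<rfloor>)" and ix: "i < p" "0 \<le> x" "x < 1" by (auto simp: label_def)
    have "0 \<le> \<beta> i * x" "\<beta> i * x \<le> \<beta> i" using gt_1[OF ix(1)] ix by auto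
    then show "w \<in> (\<Union>i<p. {i} \<times> {0..\<lfloor>\<beta> i\<rfloor>})" using ix by (auto simp: w intro: floor_mono)
  qed
  then show "finite (label ` X)" by (rule finite_subset) auto
  fix w assume "w \<in> label ` X"
  have "Pair i -` (label -` {w} \<inter> X) \<in> sets (restrict_space borel {0..<1})" if "i < p" for i
  proof -
    have "Pair i -` (label -` {w} \<inter> X) = (if i = fst w then {x \<in> {0..<1}. \<lfloor>\<beta> i * x\<rfloor> = snd w} else {})"
      using that by (auto simp: label_def)
    also have "\<dots> \<in> sets (restrict_space borel {0..<1})"
      by (auto simp: sets_restrict_space_iff)
    finally show ?thesis .
  qed
  then show "label -` {w} \<inter> X \<in> fibre_algebra p" by (auto simp: fibre_algebra_iff)
qed

lemma measure_mu_alt_le: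
  obtains C where "C > 0" "\<And>A d. A \<in> fibre_algebra p \<Longrightarrow> d \<ge> 0 \<Longrightarrow>
    (\<And>i. i < p \<Longrightarrow> emeasure lebesgue01 (Pair i -` A) \<le> ennreal d) \<Longrightarrow> measure (mu_alt p \<beta>) A \<le> C * d"
proof -
  obtain C where C: "C > 0" "\<And>A. A \<in> fibre_algebra p \<Longrightarrow> emeasure (mu_alt p \<beta>) A \<le> ennreal C * emeasure (p_lebesgue p) A"
    using mu_alt_le by blast
  have "measure (mu_alt p \<beta>) A \<le> C * d"
    if A: "A \<in> fibre_algebra p" and d: "d \<ge> 0" and fib: "\<And>i. i < p \<Longrightarrow> emeasure lebesgue01 (Pair i -` A) \<le> ennreal d" for A d
  proof -
    have "emeasure (p_lebesgue p) A \<le> (\<Sum>i<p. ennreal d) / of_nat p"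
      unfolding emeasure_p_lebesgue[OF A] using fib by (intro divide_right_mono_ennreal sum_mono) auto
    also have "\<dots> = ennreal d" by (simp add: mult_p_divide_p)
    finally have "ennreal C * emeasure (p_lebesgue p) A \<le> ennreal C * ennreal d"
      by (intro mult_left_mono) auto
    with C(2)[OF A] have "emeasure (mu_alt p \<beta>) A \<le> ennreal (C * d)"
      using C(1) d by (simp add: ennreal_mult)
    then show ?thesis using C(1) d by (simp add: mu.emeasure_eq_measure)
  qed
  then show ?thesis using that C(1) by blast
qed

definition label_partition :: "(nat \<times> real) set set" where
  "label_partition = (\<lambda>w. label -` {w} \<inter> X) ` (label ` X)"

lemma measurable_partition_label: "measurable_partition (mu_alt p \<beta>) label_partition"
  using simple_function_label
  unfolding measurable_partition_def partition_on_def simple_function_def label_partition_def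
  by (auto simp: space_mu_alt disjoint_def)

lemma atom_label_eqD:
  assumes "z \<in> X" "z' \<in> X" "mu.atom label_partition z = mu.atom label_partition z'"
  shows "label z = label z'"
proof -
  have "mu.atom label_partition z = label -` {label z} \<inter> X" if "z \<in> X" for z
    using that by (intro mu.atom_eq[OF measurable_partition_label]) (auto simp: label_partition_def)
  then show ?thesis using assms by blast
qed

lemma prod_beta_gt_1: "(\<Prod>i<p. \<beta> i) > 1"
  using p gt_1 by (intro less_1_prod) (auto simp: lessThan_empty_iff)

lemma emeasure_lebesgue01_le:
  assumes "Y \<in> sets lebesgue01" "Y \<subseteq> {x - r<..<x + r}" "r \<ge> 0"
  shows "emeasure lebesgue01 Y \<le> ennreal (2 * r)"
proof -
  have "emeasure lebesgue01 Y = emeasure lborel Y"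
    using assms(1) by (intro emeasure_restrict_space) (auto simp: sets_restrict_space_iff)
  also have "\<dots> \<le> emeasure lborel {x - r<..<x + r}" using assms(2) by (intro emeasure_mono) auto
  also have "\<dots> = ennreal (2 * r)" using assms(3) by simp
  finally show ?thesis .
qed

lemma itinerary_fst:
  assumes "n > 0" "itinerary T label n z = itinerary T label n z'"
  shows "fst z = fst z'"
  using assms unfolding itinerary_eq_iff by (force simp: label_def dest!: spec[of _ 0])

text \<open>A cylinder of length \<open>m * p\<close> lies in one fibre, within distance
  \<open>1 / ?B ^ m\<close> of any of its points, hence has measure at most
  \<open>2 * C / ?B ^ m\<close>. The bound by the largest atom then gives the rate.\<close>

lemma entropy_label_partition:
  "ln (\<Prod>i<p. \<beta> i) / real p \<le> entropy_wrt_partition (mu_alt p \<beta>) T label_partition"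
proof -
  let ?B = "\<Prod>i<p. \<beta> i" and ?a = "mu.atom label_partition"
  have B: "?B > 1" by (rule prod_beta_gt_1)
  obtain C where C: "C > 0" "\<And>A d. A \<in> fibre_algebra p \<Longrightarrow> d \<ge> 0 \<Longrightarrow>
    (\<And>i. i < p \<Longrightarrow> emeasure lebesgue01 (Pair i -` A) \<le> ennreal d) \<Longrightarrow> measure (mu_alt p \<beta>) A \<le> C * d"
    using measure_mu_alt_le by blast
  have sf: "simple_function (mu_alt p \<beta>) (itinerary T ?a n)" for n
    by (intro mu.simple_function_itinerary mu.simple_function_atom measurable_partition_label)
  have lower: "real m * ln ?B - ln (2 * C) \<le> dist_entropy (mu_alt p \<beta>) (itinerary T ?a (m * p))" if m: "m > 0" for m
  proof -
    let ?n = "m * p" and ?s = "?B ^ m"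
    have s: "?s > 0" using B by simp
    have "measure (mu_alt p \<beta>) (itinerary T ?a ?n -` {c} \<inter> space (mu_alt p \<beta>)) \<le> C * (2 * (1 / ?s))"
      if c: "c \<in> itinerary T ?a ?n ` space (mu_alt p \<beta>)" for c
    proof (rule C(2))
      let ?A = "itinerary T ?a ?n -` {c} \<inter> space (mu_alt p \<beta>)"
      show A: "?A \<in> fibre_algebra p"
        using simple_functionD(2)[OF sf, of ?n "{c}"] by (simp add: sets_mu_alt)
      obtain i x where ix: "i < p" "x \<in> {0..<1}" and c: "c = itinerary T ?a ?n (i, x)"
        using c by (auto simp: space_mu_alt)
      have lab: "itinerary T label ?n z = itinerary T label ?n (i, x)" if "z \<in> ?A" for z
      proof -
        have "z \<in> X" "(i, x) \<in> X" using that ix by (auto simp: space_mu_alt)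
        then have X: "(T ^^ k) z \<in> X" "(T ^^ k) (i, x) \<in> X" for k
          using mu.funpow_in_space[of z k] mu.funpow_in_space[of "(i, x)" k] by (simp_all only: space_mu_alt)
        have "itinerary T ?a ?n z = itinerary T ?a ?n (i, x)" using that c by simp
        then show ?thesis using atom_label_eqD[OF X] unfolding itinerary_eq_iff by blast
      qed
      fix j assume j: "j < p"
      have "Pair j -` ?A \<subseteq> {x - 1 / ?s<..<x + 1 / ?s}"
      proof
        fix y assume y: "y \<in> Pair j -` ?A"
        then have y01: "y \<in> {0..<1}" using j by (simp add: space_mu_alt)
        have l: "itinerary T label ?n (j, y) = itinerary T label ?n (i, x)" using y lab by simp
        then have "j = i" using itinerary_fst[of ?n "(j, y)" "(i, x)"] m p by simp
        then have "\<bar>y - x\<bar> * ?s < 1"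
          using itinerary_distance[OF ix(1) y01 ix(2), of ?n] l slope_period[OF ix(1), of m] by simp
        then have "\<bar>y - x\<bar> < 1 / ?s" using s by (simp add: field_simps)
        then show "y \<in> {x - 1 / ?s<..<x + 1 / ?s}" by (auto simp: abs_less_iff)
      qed
      then show "emeasure lebesgue01 (Pair j -` ?A) \<le> ennreal (2 * (1 / ?s))"
        by (rule emeasure_lebesgue01_le[OF fibre_measurable[OF A j]]) (use s in simp)
    qed (use s in simp)
    from mu.dist_entropy_ge[OF sf this] have "- ln (C * (2 * (1 / ?s))) \<le> dist_entropy (mu_alt p \<beta>) (itinerary T ?a ?n)"
      using C(1) s by simp
    moreover have "ln (C * (2 * (1 / ?s))) = ln (2 * C) - real m * ln ?B"
    proof -
      have "C * (2 * (1 / ?s)) = (2 * C) / ?s" by simp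
      also have "ln \<dots> = ln (2 * C) - ln ?s" using C(1) s by (intro ln_divide_pos) auto
      also have "ln ?s = real m * ln ?B" using B by (simp add: ln_realpow)
      finally show ?thesis .
    qed
    ultimately show ?thesis by simp
  qed
  \<comment> \<open>The full limit exists, so the subsequence along multiples of \<open>p\<close>
    determines it.\<close>
  have sub: "strict_mono (\<lambda>m. m * p)" using p by (auto simp: strict_mono_def)
  have lim: "(\<lambda>m. dist_entropy (mu_alt p \<beta>) (itinerary T ?a (m * p)) / real (m * p)) \<longlonglongrightarrow>
      entropy_wrt_partition (mu_alt p \<beta>) T label_partition"
    using LIMSEQ_subseq_LIMSEQ[OF mu.tendsto_entropy_wrt_partition[OF measurable_partition_label] sub] by (simp add: o_def)
  have "(\<lambda>m. ln ?B / real p - (ln (2 * C) / real p) / real m) \<longlonglongrightarrow> ln ?B / real p - 0"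
    by (intro tendsto_diff tendsto_const lim_const_over_n)
  then have lower_lim: "(\<lambda>m. ln ?B / real p - (ln (2 * C) / real p) / real m) \<longlonglongrightarrow> ln ?B / real p"
    by (simp only: diff_zero)
  have "ln ?B / real p - (ln (2 * C) / real p) / real m \<le> dist_entropy (mu_alt p \<beta>) (itinerary T ?a (m * p)) / real (m * p)" if "m > 0" for m
  proof -
    have "ln ?B / real p - (ln (2 * C) / real p) / real m = (real m * ln ?B - ln (2 * C)) / real (m * p)"
      using that p by (simp add: field_simps)
    also have "\<dots> \<le> dist_entropy (mu_alt p \<beta>) (itinerary T ?a (m * p)) / real (m * p)"
      using lower[OF that] by (intro divide_right_mono) auto
    finally show ?thesis .
  qed
  then show ?thesis
    by (intro LIMSEQ_le[OF lower_lim lim] exI[of _ 1]) simp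
qed

text \<open>The atoms of a partition are approximated from inside by compact sets. These have a positive
  distance from each other, so that sufficiently long itineraries separate them.\<close>

lemma approximate_by_itineraries:
  assumes P: "measurable_partition (mu_alt p \<beta>) P" and d: "d > 0"
  obtains l and g :: "(nat \<Rightarrow> nat \<times> int) \<Rightarrow> (nat \<times> real) set" where
    "measure (mu_alt p \<beta>) {z \<in> X. mu.atom P z \<noteq> g (itinerary T label (l * p) z)} \<le> d"
proof -
  have fin: "finite P" and P_sets: "P \<subseteq> fibre_algebra p" using P by (auto simp: measurable_partition_def sets_mu_alt)
  let ?a = "mu.atom P"
  obtain C where C: "C > 0" "\<And>A d. A \<in> fibre_algebra p \<Longrightarrow> d \<ge> 0 \<Longrightarrow>
    (\<And>i. i < p \<Longrightarrow> emeasure lebesgue01 (Pair i -` A) \<le> ennreal d) \<Longrightarrow> measure (mu_alt p \<beta>) A \<le> C * d"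
    using measure_mu_alt_le by blast
  \<comment> \<open>The error allowed per atom and fibre: \<open>card P\<close> such errors, times
    the density constant \<open>C\<close>, stay below \<open>d\<close>.\<close>
  define e where "e = d / (C * (1 + real (card P)))"
  have e: "e > 0" using d C(1) by (auto simp: e_def intro!: divide_pos_pos mult_pos_pos add_pos_nonneg)
  have "\<exists>K. compact K \<and> K \<subseteq> Pair i -` A \<and> emeasure lebesgue01 (Pair i -` A - K) \<le> ennreal e"
    if A: "A \<in> P" and i: "i < p" for A i
  proof -
    have m: "Pair i -` A \<in> sets lebesgue01" using fibre_measurable[OF _ i] A P_sets by blast
    then have b: "Pair i -` A \<in> sets borel" "Pair i -` A \<subseteq> {0..<1}" by (auto simp: sets_restrict_space_iff)
    have "Pair i -` A \<in> sets lebesgue" using b(1) by simp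
    then obtain K where K: "closed K" "K \<subseteq> Pair i -` A" "Pair i -` A - K \<in> lmeasurable" "emeasure lebesgue (Pair i -` A - K) < ennreal e"
      using e by (rule sets_lebesgue_inner_closed)
    have "K \<subseteq> {0..1}" using K(2) b(2) by force
    then have "bounded K" using bounded_subset[OF bounded_closed_interval] by blast
    then have "compact K" using K(1) by (simp add: compact_eq_bounded_closed)
    have "K \<in> sets borel" using K(1) by (rule borel_closed)
    then have d: "Pair i -` A - K \<in> sets borel" using b by (intro sets.Diff)
    have "emeasure lebesgue01 (Pair i -` A - K) = emeasure lborel (Pair i -` A - K)"
      using b by (intro emeasure_restrict_space) auto
    also have "\<dots> = emeasure lebesgue (Pair i -` A - K)" using d by simp
    finally show ?thesis using K \<open>compact K\<close> by (intro exI[of _ K]) auto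
  qed
  then obtain K where K: "\<And>A i. A \<in> P \<Longrightarrow> i < p \<Longrightarrow> compact (K A i)" "\<And>A i. A \<in> P \<Longrightarrow> i < p \<Longrightarrow> K A i \<subseteq> Pair i -` A"
    "\<And>A i. A \<in> P \<Longrightarrow> i < p \<Longrightarrow> emeasure lebesgue01 (Pair i -` A - K A i) \<le> ennreal e"
    by metis
  have disj: "A \<inter> A' = {}" if "A \<in> P" "A' \<in> P" "A \<noteq> A'" for A A'
    using P that by (auto simp: measurable_partition_def partition_on_def disjoint_def)
  have "\<exists>r>0. \<forall>x\<in>K A i. \<forall>y\<in>K A' i. r \<le> dist x y" if "A \<in> P" "A' \<in> P" "A \<noteq> A'" "i < p" for A A' i
  proof -
    have "K A i \<inter> K A' i = {}" using K(2)[OF that(1,4)] K(2)[OF that(2,4)] disj[OF that(1-3)] by blast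
    then show ?thesis using separate_compact_closed[of "K A i" "K A' i"] K(1) that compact_imp_closed by blast
  qed
  then have "\<forall>A A' i. \<exists>r. A \<in> P \<longrightarrow> A' \<in> P \<longrightarrow> A \<noteq> A' \<longrightarrow> i < p \<longrightarrow> r > 0 \<and> (\<forall>x\<in>K A i. \<forall>y\<in>K A' i. r \<le> dist x y)"
    by blast
  then obtain r where "\<And>A A' i. A \<in> P \<Longrightarrow> A' \<in> P \<Longrightarrow> A \<noteq> A' \<Longrightarrow> i < p \<Longrightarrow> r A A' i > 0 \<and> (\<forall>x\<in>K A i. \<forall>y\<in>K A' i. r A A' i \<le> dist x y)"
    by (metis (no_types))
  then have r: "\<And>A A' i. A \<in> P \<Longrightarrow> A' \<in> P \<Longrightarrow> A \<noteq> A' \<Longrightarrow> i < p \<Longrightarrow> r A A' i > 0"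
    "\<And>A A' i x y. A \<in> P \<Longrightarrow> A' \<in> P \<Longrightarrow> A \<noteq> A' \<Longrightarrow> i < p \<Longrightarrow> x \<in> K A i \<Longrightarrow> y \<in> K A' i \<Longrightarrow> r A A' i \<le> dist x y"
    by blast+
  \<comment> \<open>A finite sum of the reciprocals bounds each of them and is defined even when
    there is no pair of distinct atoms; \<open>?B ^ l > R\<close> makes cylinders shorter than every
    separation.\<close>
  define R where "R = (\<Sum>(A, A', i)\<in>{(A, A', i). A \<in> P \<and> A' \<in> P \<and> A \<noteq> A' \<and> i < p}. 1 / r A A' i)"
  have R: "1 / r A A' i \<le> R" if "A \<in> P" "A' \<in> P" "A \<noteq> A'" "i < p" for A A' i
  proof -
    let ?S = "{(A, A', i). A \<in> P \<and> A' \<in> P \<and> A \<noteq> A' \<and> i < p}"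
    have "?S \<subseteq> P \<times> P \<times> {..<p}" by auto
    then have finS: "finite ?S" by (rule finite_subset) (use fin in auto)
    have "(\<lambda>(A, A', i). 1 / r A A' i) (A, A', i) \<le> R"
      unfolding R_def
    proof (rule member_le_sum)
      fix z assume "z \<in> ?S - {(A, A', i)}"
      then obtain B B' j where z: "z = (B, B', j)" and B: "B \<in> P" "B' \<in> P" "B \<noteq> B'" "j < p" by blast
      show "0 \<le> (\<lambda>(A, A', i). 1 / r A A' i) z" using r(1)[OF B] by (simp add: z)
    qed (use that finS in auto)
    then show ?thesis by simp
  qed
  let ?B = "\<Prod>i<p. \<beta> i"
  obtain l0 where l0: "R < ?B ^ l0" using real_arch_pow[OF prod_beta_gt_1] by blast
  \<comment> \<open>The successor makes the itineraries nonempty, so that they record the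
    fibre.\<close>
  define l where "l = Suc l0"
  have "?B ^ l0 \<le> ?B ^ l"
    unfolding l_def using prod_beta_gt_1 by (intro power_increasing) auto
  with l0 have l: "l > 0" "R < ?B ^ l"
    by (simp add: l_def, linarith)
  let ?I = "itinerary T label (l * p)"
  \<comment> \<open>An atom whose compact core meets the cylinder \<open>w\<close>. The separation
    allows at most one; if there is none, the value is arbitrary and the points of the cylinder lie
    in the exceptional set \<open>D\<close>.\<close>
  define g where "g w = (SOME A. A \<in> P \<and> (\<exists>y\<in>X. ?I y = w \<and> snd y \<in> K A (fst y)))" for w
  have good: "g (?I z) = ?a z" if z: "z \<in> X" "snd z \<in> K (?a z) (fst z)" for z
    unfolding g_def
  proof (rule some_equality)
    have az: "?a z \<in> P" using mu.atom_mem[OF P, of z] z by (simp add: space_mu_alt)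
    then show "?a z \<in> P \<and> (\<exists>y\<in>X. ?I y = ?I z \<and> snd y \<in> K (?a z) (fst y))" using z by blast
    fix A assume "A \<in> P \<and> (\<exists>y\<in>X. ?I y = ?I z \<and> snd y \<in> K A (fst y))"
    then obtain y where A: "A \<in> P" and y: "y \<in> X" "?I y = ?I z" "snd y \<in> K A (fst y)" by blast
    have f: "fst y = fst z" using itinerary_fst[OF _ y(2)] l(1) p by simp
    obtain i u where yu: "y = (i, u)" by (cases y)
    obtain v where zv: "z = (i, v)" using f yu by (cases z) auto
    note yz = yu zv
    have i: "i < p" "u \<in> {0..<1}" "v \<in> {0..<1}" using y(1) z(1) yz by auto
    show "A = ?a z"
    proof (rule ccontr)
      assume ne: "A \<noteq> ?a z"
      have "\<bar>u - v\<bar> * ?B ^ l < 1"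
        using itinerary_distance[OF i, of "l * p"] y(2) slope_period[OF i(1), of l] by (simp add: yz)
      moreover have "r A (?a z) i \<le> \<bar>u - v\<bar>"
        using r(2)[OF A az ne i(1), of u v] y(3) z(2) by (simp add: yz dist_real_def)
      moreover have "1 < r A (?a z) i * ?B ^ l"
      proof -
        have "1 / r A (?a z) i < ?B ^ l" using R[OF A az ne i(1)] l(2) by (rule le_less_trans)
        then show ?thesis using r(1)[OF A az ne i(1)] by (simp add: field_simps)
      qed
      moreover have "r A (?a z) i * ?B ^ l \<le> \<bar>u - v\<bar> * ?B ^ l"
        using calculation(2) prod_beta_gt_1 by (intro mult_right_mono) auto
      ultimately show False by linarith
    qed
  qed
  define D where "D = (\<Union>i<p. {i} \<times> (\<Union>A\<in>P. Pair i -` A - K A i))"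
  have mAK: "Pair i -` A - K A i \<in> sets lebesgue01" if "A \<in> P" "i < p" for A i
  proof -
    have "Pair i -` A \<in> sets lebesgue01" using fibre_measurable[OF _ that(2)] that(1) P_sets by blast
    moreover have "K A i \<in> sets borel" using K(1)[OF that] by (intro borel_closed compact_imp_closed)
    ultimately show ?thesis by (auto simp: sets_restrict_space_iff)
  qed
  have fibD: "Pair i -` D = (\<Union>A\<in>P. Pair i -` A - K A i)" if "i < p" for i
    using that by (auto simp: D_def)
  have D: "D \<in> fibre_algebra p"
    unfolding fibre_algebra_iff sets_restrict_borel
  proof (intro conjI allI impI)
    have PX: "A \<subseteq> X" if "A \<in> P" for A
      using subsetD[OF P_sets that] by (simp add: fibre_algebra_iff)
    show "D \<subseteq> X"
    proof
      fix z assume "z \<in> D"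
      then obtain i x A where "z = (i, x)" "(i, x) \<in> A" "A \<in> P" by (auto simp: D_def)
      then show "z \<in> X" using PX by blast
    qed
    fix i assume i: "i < p"
    show "Pair i -` D \<in> sets lebesgue01"
      unfolding fibD[OF i] using fin mAK[OF _ i] by (intro sets.finite_UN) auto
  qed
  have "measure (mu_alt p \<beta>) D \<le> C * (real (card P) * e)"
  proof (rule C(2)[OF D])
    fix i assume i: "i < p"
    have "emeasure lebesgue01 (Pair i -` D) \<le> (\<Sum>A\<in>P. emeasure lebesgue01 (Pair i -` A - K A i))"
      unfolding fibD[OF i] using fin mAK[OF _ i] by (intro emeasure_subadditive_finite) auto
    also have "\<dots> \<le> (\<Sum>A\<in>P. ennreal e)" using K(3) i by (intro sum_mono) auto
    also have "\<dots> = ennreal (real (card P) * e)" using e by (simp add: ennreal_mult ennreal_of_nat_eq_real_of_nat)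
    finally show "emeasure lebesgue01 (Pair i -` D) \<le> ennreal (real (card P) * e)" .
  qed (use e in simp)
  also have "\<dots> \<le> C * ((1 + real (card P)) * e)" using C(1) e by (intro mult_left_mono mult_right_mono) auto
  also have "\<dots> = d"
  proof -
    have "C * (1 + real (card P)) \<noteq> 0" using C(1) by (simp add: add_nonneg_eq_0_iff)
    then show ?thesis by (simp add: e_def)
  qed
  finally have "measure (mu_alt p \<beta>) D \<le> d" .
  moreover have "measure (mu_alt p \<beta>) {z \<in> X. ?a z \<noteq> g (?I z)} \<le> measure (mu_alt p \<beta>) D"
  proof (rule mu.finite_measure_mono)
    show "{z \<in> X. ?a z \<noteq> g (?I z)} \<subseteq> D"
    proof
      fix z assume "z \<in> {z \<in> X. ?a z \<noteq> g (?I z)}"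
      then have z: "z \<in> X" "g (?I z) \<noteq> ?a z" by auto
      have "snd z \<notin> K (?a z) (fst z)" using good z by blast
      moreover have "?a z \<in> P" "z \<in> ?a z" using mu.atom_mem[OF P, of z] z by (simp_all add: space_mu_alt)
      ultimately show "z \<in> D" using z(1) unfolding D_def by (intro UN_I[of "fst z"]) (auto simp: mem_Times_iff)
    qed
  qed (use D in \<open>simp add: sets_mu_alt\<close>)
  ultimately show ?thesis using that[of g l] by linarith
qed

end

section \<open>Upper bound for the entropy\<close>

context alternate_base begin

text \<open>A sliding block code: the symbol at time \<open>k\<close> is read off the
  \<open>l\<close> labels from time \<open>k\<close> on, so \<open>n + l\<close> labels determine
  all \<open>n\<close> symbols.\<close>

lemma card_coarse_itineraries_le:
  "card (itinerary T (\<lambda>z. g (itinerary T label l z)) n ` X) \<le> card (itinerary T label (n + l) ` X)"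
proof -
  let ?b = "\<lambda>z. g (itinerary T label l z)"
  define \<phi> where "\<phi> u = restrict (\<lambda>k. g (restrict (\<lambda>j. u (j + k)) {..<l})) {..<n}" for u
  have "itinerary T label l ((T ^^ k) z) = restrict (\<lambda>j. itinerary T label (n + l) z (j + k)) {..<l}" if "k < n" for k z
    unfolding itinerary_def using that by (intro restrict_ext) (auto simp: funpow_add)
  then have "itinerary T ?b n z = \<phi> (itinerary T label (n + l) z)" for z
    unfolding \<phi>_def itinerary_def[of T ?b] by (intro restrict_ext) auto
  then have "itinerary T ?b n ` X = \<phi> ` (itinerary T label (n + l) ` X)" by (simp add: image_image)
  moreover have "finite (itinerary T label (n + l) ` X)"
    using mu.simple_function_itinerary[OF simple_function_label] by (simp add: simple_function_def space_mu_alt)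
  ultimately show ?thesis by (simp add: card_image_le)
qed

text \<open>The polynomial factor of the count is separated as a logarithm, which vanishes after
  division by \<open>m * p\<close>.\<close>

lemma ln_card_itineraries_le:
  "ln (card (itinerary T label (m * p) ` X)) \<le>
     ln (real p * (1 + real p)) + ln (1 + real m) + real m * ln (\<Prod>i<p. \<beta> i)"
proof -
  let ?B = "\<Prod>i<p. \<beta> i"
  have B: "?B ^ m \<ge> 1" using prod_beta_gt_1 by (intro one_le_power) simp
  have fin: "finite (itinerary T label (m * p) ` X)"
    using mu.simple_function_itinerary[OF simple_function_label] by (simp add: simple_function_def space_mu_alt)
  have ne: "X \<noteq> {}" using p by (auto simp: lessThan_empty_iff)
  have pos: "real (card (itinerary T label (m * p) ` X)) > 0" using fin ne by (simp add: card_gt_0_iff)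
  have "real (card (itinerary T label (m * p) ` X)) \<le> real p * (1 + real (m * p) * ?B ^ m)"
    by (rule card_itineraries_X_le)
  also have "\<dots> \<le> real p * (?B ^ m + real (m * p) * ?B ^ m)"
    using B by (intro mult_left_mono add_right_mono) auto
  also have "\<dots> = real p * (1 + real m * real p) * ?B ^ m" by (simp add: algebra_simps)
  also have "\<dots> \<le> real p * ((1 + real p) * (1 + real m)) * ?B ^ m"
    using B by (intro mult_right_mono mult_left_mono) (auto simp: algebra_simps)
  also have "\<dots> = real p * (1 + real p) * (1 + real m) * ?B ^ m" by simp
  finally have "ln (card (itinerary T label (m * p) ` X)) \<le> ln (real p * (1 + real p) * (1 + real m) * ?B ^ m)"
    using pos by (subst ln_le_cancel_iff) auto
  also have "\<dots> = ln (real p * (1 + real p)) + ln (1 + real m) + ln (?B ^ m)"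
  proof -
    have "ln (u * v * w) = ln u + ln v + ln w" if "u > 0" "v > 0" "w > 0" for u v w :: real
      using that by (simp add: ln_mult_pos)
    moreover have "0 < real p * (1 + real p)" using p by simp
    moreover have "0 < ?B ^ m" using B by linarith
    ultimately show ?thesis by simp
  qed
  also have "ln (?B ^ m) = real m * ln ?B" by (rule ln_realpow)
  finally show ?thesis .
qed

text \<open>For fixed \<open>d\<close> the block length \<open>l\<close> is fixed too, so letting
  \<open>m\<close> grow removes the \<open>l\<close> extra periods; only then does \<open>d\<close>
  tend to 0.\<close>

lemma entropy_wrt_partition_le:
  assumes P: "measurable_partition (mu_alt p \<beta>) P"
  shows "entropy_wrt_partition (mu_alt p \<beta>) T P \<le> ln (\<Prod>i<p. \<beta> i) / real p"
proof -
  let ?L = "ln (\<Prod>i<p. \<beta> i)" and ?a = "mu.atom P" and ?h = "entropy_wrt_partition (mu_alt p \<beta>) T P"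
  define r where "r = real (card P)"
  \<comment> \<open>The noise price per time step from
    \<open>dist_entropy_itinerary_le\<close>.\<close>
  define \<eta> where "\<eta> d = - ln (1 - d) + d * ln (r / d)" for d
  have fin: "finite P" using P by (simp add: measurable_partition_def)
  have "P \<noteq> {}"
    using mu.atom_image[OF P] mu.not_empty by blast
  then have r: "r > 0" using fin by (simp add: r_def card_gt_0_iff)
  have sub: "strict_mono (\<lambda>m. m * p)" using p by (auto simp: strict_mono_def)
  have lim: "(\<lambda>m. dist_entropy (mu_alt p \<beta>) (itinerary T ?a (m * p)) / real (m * p)) \<longlonglongrightarrow> ?h"
    using LIMSEQ_subseq_LIMSEQ[OF mu.tendsto_entropy_wrt_partition[OF P] sub] by (simp add: o_def)
  have le: "?h \<le> ?L / real p + \<eta> d" if d: "0 < d" "d < 1" for d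
  proof -
    obtain l and g :: "(nat \<Rightarrow> nat \<times> int) \<Rightarrow> (nat \<times> real) set" where
      g: "measure (mu_alt p \<beta>) {z \<in> X. ?a z \<noteq> g (itinerary T label (l * p) z)} \<le> d"
      using approximate_by_itineraries[OF P d(1)] by blast
    let ?b = "\<lambda>z. g (itinerary T label (l * p) z)"
    have sb: "simple_function (mu_alt p \<beta>) ?b"
      using simple_function_compose[OF mu.simple_function_itinerary[OF simple_function_label], of g "l * p"]
      by (simp add: o_def)
    define c where "c = ln (real p * (1 + real p))"
    have up: "dist_entropy (mu_alt p \<beta>) (itinerary T ?a (m * p)) / real (m * p) \<le>
        (c + ln (1 + real (m + l)) + real (m + l) * ?L) / real (m * p) + \<eta> d" if m: "m > 0" for m
    proof -
      have card_pos: "card (itinerary T ?b (m * p) ` X) > 0"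
        using mu.simple_function_itinerary[OF sb] mu.not_empty by (simp add: simple_function_def card_gt_0_iff space_mu_alt)
      have "dist_entropy (mu_alt p \<beta>) (itinerary T ?a (m * p)) \<le>
          ln (card (itinerary T ?b (m * p) ` X)) + real (m * p) * \<eta> d"
        using mu.dist_entropy_itinerary_le[OF mu.simple_function_atom[OF P] sb fin mu.atom_image[OF P] d, of "m * p"] g
        by (simp add: space_mu_alt \<eta>_def r_def)
      also have "ln (card (itinerary T ?b (m * p) ` X)) \<le> ln (card (itinerary T label ((m + l) * p) ` X))"
        using card_coarse_itineraries_le[of g "l * p" "m * p"] card_pos
        by (subst ln_le_cancel_iff) (auto simp: add_mult_distrib)
      also have "\<dots> \<le> c + ln (1 + real (m + l)) + real (m + l) * ?L"
        unfolding c_def by (rule ln_card_itineraries_le)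
      finally have "dist_entropy (mu_alt p \<beta>) (itinerary T ?a (m * p)) / real (m * p) \<le>
        (c + ln (1 + real (m + l)) + real (m + l) * ?L + real (m * p) * \<eta> d) / real (m * p)"
        by (intro divide_right_mono) auto
      also have "\<dots> = (c + ln (1 + real (m + l)) + real (m + l) * ?L) / real (m * p) + \<eta> d"
        using m p by (simp add: add_divide_distrib)
      finally show ?thesis .
    qed
    have "((\<lambda>m. (c + ln (1 + real (m + l)) + real (m + l) * ?L) / real (m * p) + \<eta> d) \<longlongrightarrow> ?L / real p + \<eta> d) sequentially"
    proof -
      have "real p > 0" using p by simp
      have "((\<lambda>m. (c + ln (1 + (real m + y)) + (real m + y) * K) / (real m * q)) \<longlongrightarrow> K / q) sequentially" if "q > 0" for c y K q :: real
        using that by real_asymp (simp add: divide_inverse)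
      from this[OF \<open>real p > 0\<close>, of c "real l" ?L] show ?thesis
        by (intro tendsto_add tendsto_const) (simp add: add.assoc)
    qed
    then show ?thesis
      using up by (intro LIMSEQ_le[OF lim] exI[of _ 1]) auto
  qed
  \<comment> \<open>The price vanishes because \<open>d * ln (r / d)\<close> tends to 0; the left
    side \<open>?h\<close> does not involve \<open>d\<close>.\<close>
  have "((\<lambda>d. ?L / real p + \<eta> d) \<longlongrightarrow> ?L / real p + 0) (at_right 0)"
  proof (intro tendsto_add tendsto_const)
    show "(\<eta> \<longlongrightarrow> 0) (at_right 0)" unfolding \<eta>_def[abs_def] using r by real_asymp
  qed
  moreover have "eventually (\<lambda>d. ?h \<le> ?L / real p + \<eta> d) (at_right 0)"
    unfolding eventually_at_right_field using le by (intro exI[of _ 1]) auto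
  ultimately have "?h \<le> ?L / real p + 0"
    by (intro tendsto_lowerbound) auto
  then show ?thesis by simp
qed

text \<open>The supremum is attained by the digit partition.\<close>

lemma ks_entropy_mu_alt: "ks_entropy (mu_alt p \<beta>) T = ereal (ln (\<Prod>i<p. \<beta> i) / real p)"
  unfolding ks_entropy_def
proof (rule antisym)
  show "(SUP P\<in>{P. measurable_partition (mu_alt p \<beta>) P}. ereal (entropy_wrt_partition (mu_alt p \<beta>) T P))
      \<le> ereal (ln (\<Prod>i<p. \<beta> i) / real p)"
    using entropy_wrt_partition_le by (intro SUP_least) simp
  show "ereal (ln (\<Prod>i<p. \<beta> i) / real p)
      \<le> (SUP P\<in>{P. measurable_partition (mu_alt p \<beta>) P}. ereal (entropy_wrt_partition (mu_alt p \<beta>) T P))"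
    using entropy_label_partition measurable_partition_label by (intro SUP_upper2[of label_partition]) auto
qed

end

theorem theorem23:
  fixes p :: nat and \<beta> :: "nat \<Rightarrow> real"
  assumes "p \<ge> 1" and "\<And>i. i < p \<Longrightarrow> \<beta> i > 1"
  shows "is_acip (p_lebesgue p) (T_alt p \<beta>) (mu_alt p \<beta>)
    \<and> (\<forall>M. is_acip (p_lebesgue p) (T_alt p \<beta>) M \<longrightarrow> M = mu_alt p \<beta>)
    \<and> equivalent_measures (mu_alt p \<beta>) (p_lebesgue p)
    \<and> ergodic (mu_alt p \<beta>) (T_alt p \<beta>)
    \<and> ks_entropy (mu_alt p \<beta>) (T_alt p \<beta>) = ereal (1 / real p * ln (\<Prod>i<p. \<beta> i))"
proof -
  interpret alternate_base p \<beta> using assms by unfold_locales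
  show ?thesis
  proof (intro conjI allI impI)
    show "is_acip (p_lebesgue p) (T_alt p \<beta>) M \<Longrightarrow> M = mu_alt p \<beta>" for M by (rule mu_alt_unique)
  qed (simp_all add: is_acip_mu_alt equivalent_mu_alt ergodic_mu_alt ks_entropy_mu_alt)
qed

end
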